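(* Let $A\in\mathbb{R}$ and suppose that $g$ is $C^2$ in a neighborhood of $A$ and that $\int_1^\infty\Pi(\mathrm{d}u)\max_{A-u\le\zeta\le A}|g(\zeta)-g(A)|<\infty$. Then $$\Gamma_2(x;A)=W^{(q)}(x-A)\,\rho_{g,A}^{(q)}-\varphi_{g,A}^{(q)}(x),\qquad x>A.$$
   Context: $X=\{X_t:t\ge0\}$ is a spectrally negative L\'evy process (only negative jumps) with Laplace exponent $\psi$, i.e. $\mathbb{E}^0[e^{\beta X_t}]=e^{t\psi(\beta)}$ for $\beta\ge0$, where $$\psi(\beta)=c\beta+\tfrac12\sigma^2\beta^2+\int_{(0,\infty)}(e^{-\beta z}-1+\beta z1_{\{0<z<1\}})\,\Pi(\mathrm{d}z),$$ $c\in\mathbb{R}$, $\sigma\ge0$, and $\Pi$ is a measure on $(0,\infty)$ with $\int_{(0,\infty)}(1\wedge z^2)\Pi(\mathrm{d}z)<\infty$. $\mathbb{P}^x,\mathbb{E}^x$ refer to $X_0=x$. If $\sigma=0$ and $\int_{(0,\infty)}(1\wedge z)\Pi(\mathrm{d}z)<\infty$ (bounded variation), it is assumed that $\mu:=c+\int_{(0,1)}z\,\Pi(\mathrm{d}z)>0$. $\Pi$ has no atoms. Fix $q>0$ and let $\Phi(q):=\sup\{\lambda\ge0:\psi(\lambda)=q\}>0$. The scale function $W^{(q)}:\mathbb{R}\to\mathbb{R}$ vanishes on $(-\infty,0)$, is continuous and strictly increasing on $[0,\infty)$, and is determined by $\int_0^\infty e^{-\beta x}W^{(q)}(x)\,\mathrm{d}x=1/(\psi(\beta)-q)$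 for $\beta>\Phi(q)$. $g:\mathbb{R}\to\mathbb{R}$ is locally bounded and measurable. Let $\tau_A:=\inf\{t>0:X_t\le A\}$ ($\inf\emptyset=\infty$). For $x>A$, $$\Gamma_2(x;A):=\mathbb{E}^x\big[e^{-q\tau_A}(g(X_{\tau_A})-g(A))1_{\{X_{\tau_A}<A,\ \tau_A<\infty\}}\big],$$ $$\rho_{g,A}^{(q)}:=\int_0^\infty\Pi(\mathrm{d}u)\int_0^ue^{-\Phi(q)z}(g(z+A-u)-g(A))\,\mathrm{d}z,$$ $$\varphi_{g,A}^{(q)}(x):=\int_0^\infty\Pi(\mathrm{d}u)\int_0^{u\wedge(x-A)}W^{(q)}(x-z-A)(g(z+A-u)-g(A))\,\mathrm{d}z.$$ *)

theory Defs
  imports "HOL-Probability.Probability"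
begin

definition cadlag :: "(real \<Rightarrow> real) \<Rightarrow> bool" where
  "cadlag f \<longleftrightarrow>
     (\<forall>t\<ge>0. (f \<longlongrightarrow> f t) (at_right t)) \<and>
     (\<forall>t>0. \<exists>l. (f \<longlongrightarrow> l) (at_left t))"

definition only_negative_jumps :: "(real \<Rightarrow> real) \<Rightarrow> bool" where
  "only_negative_jumps f \<longleftrightarrow> (\<forall>t>0. \<forall>l. (f \<longlongrightarrow> l) (at_left t) \<longrightarrow> f t \<le> l)"

text \<open>Time is \<open>[0, \<infinity>)\<close>; values of \<open>X\<close> at negative times are irrelevant.
  The path regularity is imposed on every path rather than almost every path, so that first passage
  times are measurable without completing the probability space.\<close>

definition levy_process :: "'a measure \<Rightarrow> (real \<Rightarrow> 'a \<Rightarrow> real) \<Rightarrow> bool" where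
  "levy_process M X \<longleftrightarrow>
     prob_space M \<and>
     (\<forall>t\<ge>0. X t \<in> borel_measurable M) \<and>
     (\<forall>n::nat. \<forall>t::nat \<Rightarrow> real. 0 \<le> t 0 \<and> mono t \<longrightarrow>
        prob_space.indep_vars M (\<lambda>_. borel) (\<lambda>i \<omega>. X (t (Suc i)) \<omega> - X (t i) \<omega>) {..<n}) \<and>
     (\<forall>s\<ge>0. \<forall>t\<ge>0.
        distr M borel (\<lambda>\<omega>. X (s + t) \<omega> - X s \<omega>) = distr M borel (\<lambda>\<omega>. X t \<omega> - X 0 \<omega>)) \<and>
     (\<forall>\<omega>\<in>space M. cadlag (\<lambda>t. X t \<omega>))"

definition levy_measure :: "real measure \<Rightarrow> bool" where
  "levy_measure \<nu> \<longleftrightarrow>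
     sets \<nu> = sets borel \<and> emeasure \<nu> {..0} = 0 \<and>
     (\<integral>\<^sup>+z\<in>{0<..}. ennreal (min 1 (z\<^sup>2)) \<partial>\<nu>) < \<infinity>"

definition laplace_exponent :: "real \<Rightarrow> real \<Rightarrow> real measure \<Rightarrow> real \<Rightarrow> real" where
  "laplace_exponent c \<sigma> \<nu> \<beta> =
     c * \<beta> + 1/2 * \<sigma>\<^sup>2 * \<beta>\<^sup>2 +
     (LINT z:{0<..}|\<nu>. exp (- \<beta> * z) - 1 + \<beta> * z * indicator {0<..<1} z)"

text \<open>\<open>P x\<close> is the law under which \<open>X\<close> starts from \<open>x\<close>. Since the right-hand side of the
  exponential moment identity is nonzero, the identity also forces integrability of its integrand;
  it determines the law of the increments of \<open>X\<close> under each \<open>P x\<close>. The last conjunct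
  (the bounded variation case) rules out the negatives of subordinators.\<close>

definition spectrally_negative_levy ::
    "(real \<Rightarrow> 'a measure) \<Rightarrow> (real \<Rightarrow> 'a \<Rightarrow> real) \<Rightarrow> real \<Rightarrow> real \<Rightarrow> real measure \<Rightarrow> bool" where
  "spectrally_negative_levy P X c \<sigma> \<nu> \<longleftrightarrow>
     \<sigma> \<ge> 0 \<and> levy_measure \<nu> \<and>
     (\<forall>x. levy_process (P x) X \<and>
          (AE \<omega> in P x. X 0 \<omega> = x) \<and>
          (\<forall>\<omega>\<in>space (P x). only_negative_jumps (\<lambda>t. X t \<omega>)) \<and>
          (\<forall>\<beta>\<ge>0. \<forall>t\<ge>0.
             (\<integral>\<omega>. exp (\<beta> * X t \<omega>) \<partial>P x) = exp (\<beta> * x + t * laplace_exponent c \<sigma> \<nu> \<beta>))) \<and>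
     (\<sigma> = 0 \<and> (\<integral>\<^sup>+z\<in>{0<..}. ennreal (min 1 z) \<partial>\<nu>) < \<infinity> \<longrightarrow>
        c + (LINT z:{0<..<1}|\<nu>. z) > 0)"

definition Phi :: "real \<Rightarrow> real \<Rightarrow> real measure \<Rightarrow> real \<Rightarrow> real" where
  "Phi c \<sigma> \<nu> q = Sup {l. l \<ge> 0 \<and> laplace_exponent c \<sigma> \<nu> l = q}"

definition is_scale_function ::
    "real \<Rightarrow> real \<Rightarrow> real measure \<Rightarrow> real \<Rightarrow> (real \<Rightarrow> real) \<Rightarrow> bool" where
  "is_scale_function c \<sigma> \<nu> q W \<longleftrightarrow>
     (\<forall>x<0. W x = 0) \<and> continuous_on {0..} W \<and> strict_mono_on {0..} W \<and>
     (\<forall>\<beta> > Phi c \<sigma> \<nu> q.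
        set_integrable lborel {0..} (\<lambda>x. exp (- \<beta> * x) * W x) \<and>
        (LINT x:{0..}|lborel. exp (- \<beta> * x) * W x) = 1 / (laplace_exponent c \<sigma> \<nu> \<beta> - q))"

definition locally_bounded :: "(real \<Rightarrow> real) \<Rightarrow> bool" where
  "locally_bounded g \<longleftrightarrow> (\<forall>K. compact K \<longrightarrow> bounded (g ` K))"

definition C2_near :: "(real \<Rightarrow> real) \<Rightarrow> real \<Rightarrow> bool" where
  "C2_near g a \<longleftrightarrow>
     (\<exists>U g' g''. open U \<and> a \<in> U \<and>
        (\<forall>y\<in>U. (g has_real_derivative g' y) (at y)) \<and>
        (\<forall>y\<in>U. (g' has_real_derivative g'' y) (at y)) \<and>
        continuous_on U g'')"

text \<open>The infimum is taken in \<^typ>\<open>ereal\<close>, so it is \<open>\<infinity>\<close> if level \<open>A\<close> is never passed.\<close>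

definition first_passage :: "(real \<Rightarrow> 'a \<Rightarrow> real) \<Rightarrow> real \<Rightarrow> 'a \<Rightarrow> ereal" where
  "first_passage X A \<omega> = Inf (ereal ` {t. t > 0 \<and> X t \<omega> \<le> A})"

definition Gamma2 ::
    "(real \<Rightarrow> 'a measure) \<Rightarrow> (real \<Rightarrow> 'a \<Rightarrow> real) \<Rightarrow> real \<Rightarrow> (real \<Rightarrow> real) \<Rightarrow> real \<Rightarrow> real \<Rightarrow> real" where
  "Gamma2 P X q g x A =
     (\<integral>\<omega>. (let \<tau> = first_passage X A \<omega>; t = real_of_ereal \<tau>
           in if \<tau> < \<infinity> \<and> X t \<omega> < A then exp (- q * t) * (g (X t \<omega>) - g A) else 0) \<partial>P x)"

definition rho ::
    "real \<Rightarrow> real \<Rightarrow> real measure \<Rightarrow> real \<Rightarrow> (real \<Rightarrow> real) \<Rightarrow> real \<Rightarrow> real" where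
  "rho c \<sigma> \<nu> q g A =
     (LINT u:{0<..}|\<nu>. LINT z:{0..u}|lborel. exp (- Phi c \<sigma> \<nu> q * z) * (g (z + A - u) - g A))"

definition varphi ::
    "real measure \<Rightarrow> (real \<Rightarrow> real) \<Rightarrow> (real \<Rightarrow> real) \<Rightarrow> real \<Rightarrow> real \<Rightarrow> real" where
  "varphi \<nu> W g A x =
     (LINT u:{0<..}|\<nu>. LINT z:{0..min u (x - A)}|lborel. W (x - z - A) * (g (z + A - u) - g A))"

end

theory Submission
  imports Defs
begin

text \<open>Let \<open>Y = X - X 0\<close> and let \<open>e\<close> be exponential of rate \<open>q\<close>, independent of \<open>Y\<close>. Along dyadic grids
  \<open>Y\<close> stopped at \<open>e\<close> is a random walk with a geometric number of steps, for which the strong Markov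
  property at first passages is a renewal identity on sequence space. Since \<open>Y\<close> has no upward jumps,
  the limit of the upward identity shows that \<open>sup\<^bsub>s\<le>e\<^esub> Y s\<close> is exponential of rate \<open>\<Phi>\<close> and,
  with the reversal duality, that \<open>E exp (\<beta> inf\<^bsub>s\<le>e\<^esub> Y s) = q (\<beta> - \<Phi>) / (\<Phi> (\<psi> \<beta> - q))\<close>.
  By uniqueness of Laplace transforms
  \<open>W x = (\<Phi> / q) \<integral>\<^bsub>[0,x]\<^esub> exp (\<Phi> (x - s)) P (- inf Y \<in> ds)\<close>, whence
  \<open>W y exp (- \<Phi> z) - W (y - z) \<ge> 0\<close>.

  The downward identity gives the Laplace transform in \<open>\<beta>\<close> of the discounted overshoot at passage
  below \<open>- y\<close>. Taking the difference of its values at \<open>\<beta>\<close> and \<open>\<beta> + 1\<close> replaces the kernel by one vanishing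
  to first order at overshoot 0, so that creeping drops out. Comparing Laplace transforms in \<open>y\<close>
  then identifies the overshoot law on \<open>(0, \<infinity>)\<close> with the image of
  \<open>\<Pi>(du) dz (W y exp (- \<Phi> z) - W (y - z))\<close>, \<open>0 \<le> z \<le> u\<close>, under \<open>u - z\<close>. The formula is the integral of
  \<open>g (A - v) - g A\<close> against this law; it converges because \<open>g\<close> is differentiable at \<open>A\<close>, which makes
  the integrand \<open>O(v)\<close>.\<close>

text \<open>Conditioning at passage times takes place only on sequence space, where it amounts to
  splitting a product measure; continuous time enters through limits of integrals alone. The limit
  of the upward identity has a term with the factor \<open>\<psi> \<beta> - q\<close>. At \<beta> =
  \<Phi> this term drops out, and what remains is P (sup > x) = exp (- \<Phi> x); for all other
  \<beta> the identity can then be solved for the transform of the infimum. Since \<open>W\<close>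
  is given only by its transform, the overshoot law is also identified by transforms, and every
  equality is first obtained almost everywhere and then pointwise by right continuity. A separate
  obstacle is that the grids see the entry into an open half-line, whereas the statement has weak
  passage, X \<le> A. The two times agree almost surely because the infimum at the exponential time
  has no atom away from 0, and this in turn comes from the continuity of \<open>W\<close>.\<close>

abbreviation eexp :: "real \<Rightarrow> ennreal" where "eexp x \<equiv> ennreal (exp x)"

section \<open>Uniqueness of Laplace transforms\<close>

text \<open>Substituting exp (- x) turns the given integrals into moments on [0, 1]. Weierstrass
  approximation extends the equality to continuous functions, and steep ramps then recover the
  tails.\<close>

lemma finite_measure_eqI_moments:
  fixes M N :: "real measure"
  assumes fin: "finite_measure M" "finite_measure N"
    and sets[measurable_cong]: "sets M = sets borel" "sets N = sets borel"
    and null: "emeasure M {..<0} = 0" "emeasure N {..<0} = 0"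
    and eq: "\<And>n::nat. (\<integral>x. exp (- real n * x) \<partial>M) = (\<integral>x. exp (- real n * x) \<partial>N)"
  shows "M = N"
proof -
  interpret M: finite_measure M by fact
  interpret N: finite_measure N by fact
  \<comment> \<open>The maximum with 0 keeps \<open>y\<close> in [0, 1] on the whole line; almost
    everywhere \<open>y x\<close> is exp (- x).\<close>
  define y where "y x = exp (- max 0 x)" for x :: real
  have ym[measurable]: "y \<in> borel_measurable borel" unfolding y_def by measurable
  have y01: "0 \<le> y x" "y x \<le> 1" for x by (auto simp: y_def)
  have AEM: "AE x in M. 0 \<le> x" using null sets by (intro AE_I[of _ _ "{..<0}"]) auto
  have AEN: "AE x in N. 0 \<le> x" using null sets by (intro AE_I[of _ _ "{..<0}"]) auto
  have mom: "(\<integral>x. y x ^ n \<partial>M) = (\<integral>x. y x ^ n \<partial>N)" for n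
  proof -
    have "(\<integral>x. y x ^ n \<partial>M) = (\<integral>x. exp (- real n * x) \<partial>M)"
      proof (rule integral_cong_AE)
        show "AE x in M. y x ^ n = exp (- real n * x)"
          using AEM by eventually_elim (auto simp: y_def exp_of_nat_mult[symmetric])
      qed auto
    moreover have "(\<integral>x. y x ^ n \<partial>N) = (\<integral>x. exp (- real n * x) \<partial>N)"
      proof (rule integral_cong_AE)
        show "AE x in N. y x ^ n = exp (- real n * x)"
          using AEN by eventually_elim (auto simp: y_def exp_of_nat_mult[symmetric])
      qed auto
    ultimately show ?thesis using eq by simp
  qed
  have intb: "integrable M (\<lambda>x. \<phi> (y x))" "integrable N (\<lambda>x. \<phi> (y x))"
    if "\<phi> \<in> borel_measurable borel" "\<And>z. 0 \<le> z \<Longrightarrow> z \<le> 1 \<Longrightarrow> \<bar>\<phi> z\<bar> \<le> B" for \<phi> :: "real \<Rightarrow> real" and B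
    using that y01 by (auto intro!: M.integrable_const_bound[of _ B] N.integrable_const_bound[of _ B])
  have poly: "(\<integral>x. p (y x) \<partial>M) = (\<integral>x. p (y x) \<partial>N)" if pp: "real_polynomial_function p" for p
  proof -
    obtain a n where p: "p = (\<lambda>x. \<Sum>i\<le>n::nat. a i * x ^ i)"
      using pp real_polynomial_function_iff_sum[of p] by blast
    have i: "integrable M (\<lambda>x. y x ^ i)" "integrable N (\<lambda>x. y x ^ i)" for i
      by (rule intb[of "\<lambda>z. z ^ i" 1]; force simp: power_le_one)+
    show ?thesis unfolding p using i by (simp add: mom)
  qed
  have cont: "(\<integral>x. \<phi> (y x) \<partial>M) = (\<integral>x. \<phi> (y x) \<partial>N)"
    if c: "continuous_on UNIV \<phi>" for \<phi> :: "real \<Rightarrow> real"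
  proof -
    let ?C = "measure M (space M) + measure N (space N)"
    have [measurable]: "\<phi> \<in> borel_measurable borel"
      using c by (rule borel_measurable_continuous_onI)
    have c01: "continuous_on {0..1} \<phi>" using c continuous_on_subset by blast
    then have "bounded (\<phi> ` {0..1})"
      by (intro compact_imp_bounded compact_continuous_image) auto
    then obtain B where B: "\<And>z. 0 \<le> z \<Longrightarrow> z \<le> 1 \<Longrightarrow> \<bar>\<phi> z\<bar> \<le> B"
      by (force simp: bounded_iff)
    have "\<bar>(\<integral>x. \<phi> (y x) \<partial>M) - (\<integral>x. \<phi> (y x) \<partial>N)\<bar> \<le> e * ?C" if "0 < e" for e
    proof -
      obtain p where p: "real_polynomial_function p" "\<And>z. z \<in> {0..1} \<Longrightarrow> \<bar>\<phi> z - p z\<bar> < e"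
        using Stone_Weierstrass_real_polynomial_function[OF compact_Icc c01 \<open>0 < e\<close>] by blast
      have [measurable]: "p \<in> borel_measurable borel"
        using p(1) by (intro borel_measurable_continuous_onI continuous_on_polymonial_function)
          (simp add: real_polynomial_function_eq)
      have pB: "\<bar>p z\<bar> \<le> B + e" if "0 \<le> z" "z \<le> 1" for z
        using p(2)[of z] B[of z] that by auto
      note i1 = intb[of \<phi>, OF _ B, simplified] and i2 = intb[of p, OF _ pB, simplified]
      have *: "\<bar>\<phi> (y x) - p (y x)\<bar> \<le> e" for x
        using p(2)[of "y x"] y01[of x] by auto
      have "\<bar>(\<integral>x. \<phi> (y x) \<partial>M) - (\<integral>x. p (y x) \<partial>M)\<bar> \<le> (\<integral>x. e \<partial>M)"
      proof -
        have "\<bar>\<integral>x. (\<phi> (y x) - p (y x)) \<partial>M\<bar> \<le> (\<integral>x. e \<partial>M)"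
          by (rule integral_abs_bound_integral) (use * i1(1) i2(1) in simp_all)
        then show ?thesis by (simp add: Bochner_Integration.integral_diff i1(1) i2(1))
      qed
      moreover have "\<bar>(\<integral>x. \<phi> (y x) \<partial>N) - (\<integral>x. p (y x) \<partial>N)\<bar> \<le> (\<integral>x. e \<partial>N)"
      proof -
        have "\<bar>\<integral>x. (\<phi> (y x) - p (y x)) \<partial>N\<bar> \<le> (\<integral>x. e \<partial>N)"
          by (rule integral_abs_bound_integral) (use * i1(2) i2(2) in simp_all)
        then show ?thesis by (simp add: Bochner_Integration.integral_diff i1(2) i2(2))
      qed
      ultimately show ?thesis using poly[OF p(1)] by (simp add: algebra_simps)
    qed
    note bound = this
    define C where "C = ?C"
    have *: "\<bar>(\<integral>x. \<phi> (y x) \<partial>M) - (\<integral>x. \<phi> (y x) \<partial>N)\<bar> \<le> e" if "0 < e" for e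
    proof -
      have C: "0 \<le> C" by (simp add: C_def)
      \<comment> \<open>Division by \<open>C + 1\<close> because the total mass \<open>C\<close> may
        be 0.\<close>
      have "\<bar>(\<integral>x. \<phi> (y x) \<partial>M) - (\<integral>x. \<phi> (y x) \<partial>N)\<bar> \<le> e / (C + 1) * C"
        using C \<open>0 < e\<close> by (intro bound[folded C_def] divide_pos_pos) linarith+
      also have "e / (C + 1) * C \<le> e" using C \<open>0 < e\<close> by (simp add: pos_divide_le_eq algebra_simps)
      finally show ?thesis .
    qed
    have "\<bar>(\<integral>x. \<phi> (y x) \<partial>M) - (\<integral>x. \<phi> (y x) \<partial>N)\<bar> \<le> 0"
      by (rule field_le_epsilon) (use * in simp)
    then show ?thesis by simp
  qed
  \<comment> \<open>The ramps increase to the indicator of \<open>y x < exp (- a)\<close>, which for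
    a \<ge> 0 is the indicator of x > a.\<close>
  have lim: "(\<lambda>m. \<integral>x. max 0 (min 1 (real m * (exp (-a) - y x))) \<partial>K) \<longlonglongrightarrow> measure K {a<..}"
    if "0 \<le> a" "finite_measure K" "sets K = sets borel" for a and K :: "real measure"
  proof -
    interpret K: finite_measure K by fact
    have [measurable_cong]: "sets K = sets borel" by fact
    have eqi: "y x < exp (-a) \<longleftrightarrow> x \<in> {a<..}" for x using that(1) by (auto simp: y_def)
    have "(\<lambda>m. max 0 (min 1 (real m * (exp (-a) - y x)))) \<longlonglongrightarrow> indicator {a<..} x" for x
    proof (cases "x \<in> {a<..}")
      case True
      then have pos: "exp (-a) - y x > 0" using eqi by simp
      obtain m0 where m0: "1 / (exp (-a) - y x) \<le> real m0" using real_arch_simple by blast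
      have "max 0 (min 1 (real m * (exp (-a) - y x))) = 1" if "m \<ge> m0" for m
      proof -
        have "1 / (exp (-a) - y x) \<le> real m" using m0 that of_nat_le_iff[of m0 m, where ?'a = real] by linarith
        then have "1 \<le> real m * (exp (-a) - y x)" using pos by (simp add: pos_divide_le_eq)
        then show ?thesis by linarith
      qed
      then show ?thesis using True
        by (intro tendsto_eventually) (auto simp: eventually_sequentially)
    next
      case False
      then have "exp (-a) - y x \<le> 0" using eqi[of x] by linarith
      then have le0: "real m * (exp (-a) - y x) \<le> 0" for m by (intro mult_nonneg_nonpos) auto
      have "max 0 (min 1 (real m * (exp (-a) - y x))) = 0" for m using le0[of m] by linarith
      then show ?thesis using False by simp
    qed
    then have "(\<lambda>m. \<integral>x. max 0 (min 1 (real m * (exp (-a) - y x))) \<partial>K)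
        \<longlonglongrightarrow> (\<integral>x. indicator {a<..} x \<partial>K)"
      by (intro integral_dominated_convergence[where w="\<lambda>_. 1"]) auto
    then show ?thesis by simp
  qed
  have gt: "measure M {a<..} = measure N {a<..}" if "0 \<le> a" for a
  proof (rule LIMSEQ_unique[OF lim[OF that fin(1) sets(1)]])
    have "(\<integral>x. max 0 (min 1 (real m * (exp (-a) - y x))) \<partial>M)
      = (\<integral>x. max 0 (min 1 (real m * (exp (-a) - y x))) \<partial>N)" for m
      by (intro cont[of "\<lambda>z. max 0 (min 1 (real m * (exp (-a) - z)))"] continuous_intros)
    then show "(\<lambda>m. \<integral>x. max 0 (min 1 (real m * (exp (-a) - y x))) \<partial>M) \<longlonglongrightarrow> measure N {a<..}"
      using lim[OF that fin(2) sets(2)] by simp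
  qed
  have neg: "measure K {a<..} = measure K (space K)"
    if "a < 0" "AE x in K. 0 \<le> x" "sets K = sets borel" for a and K :: "real measure"
  proof -
    have sp: "space K = UNIV" using that(3) by (metis sets_eq_imp_space_eq space_borel)
    show ?thesis
    proof (rule measure_eq_AE)
      show "AE x in K. (x \<in> {a<..}) = (x \<in> space K)"
        using that(2) by eventually_elim (use that(1) sp in simp)
    qed (use that(3) in auto)
  qed
  have tot: "measure M (space M) = measure N (space N)"
    using eq[of 0] by simp
  show ?thesis
  proof (rule measure_eqI_lessThan)
    fix x :: real
    show "emeasure M {x<..} < \<infinity>" by (metis M.emeasure_finite less_top infinity_ennreal_def)
    show "emeasure M {x<..} = emeasure N {x<..}"
    proof (cases "0 \<le> x")
      case True
      then show ?thesis by (simp add: gt M.emeasure_eq_measure N.emeasure_eq_measure)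
    next
      case False
      then have "x < 0" by simp
      from neg[OF this AEM sets(1)] neg[OF this AEN sets(2)] show ?thesis
        by (simp add: tot M.emeasure_eq_measure N.emeasure_eq_measure)
    qed
  qed fact+
qed

text \<open>The measures may be infinite. The weight exp (- (b + 1) x) makes them finite and turns
  the transforms at b + 1 + n into the integrals of \<open>finite_measure_eqI_moments\<close>; being
  positive, it can be divided out again.\<close>

lemma measure_eqI_laplace:
  fixes M N :: "real measure"
  assumes sets[measurable_cong]: "sets M = sets borel" "sets N = sets borel"
    and null: "emeasure M {..<0} = 0" "emeasure N {..<0} = 0"
    and eq: "\<And>l. l > b \<Longrightarrow> (\<integral>\<^sup>+x. eexp (- l * x) \<partial>M) = (\<integral>\<^sup>+x. eexp (- l * x) \<partial>N)"
    and fin: "\<And>l. l > b \<Longrightarrow> (\<integral>\<^sup>+x. eexp (- l * x) \<partial>M) < \<infinity>"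
  shows "M = N"
proof -
  define D where "D K = density K (\<lambda>x. eexp (- (b + 1) * x))" for K :: "real measure"
  have DL: "(\<integral>x. exp (- real n * x) \<partial>D K) = enn2real (\<integral>\<^sup>+x. eexp (- (b + 1 + real n) * x) \<partial>K)"
    if [measurable_cong]: "sets K = sets borel" for K n
  proof -
    have "(\<integral>x. exp (- real n * x) \<partial>D K) = enn2real (\<integral>\<^sup>+x. eexp (- real n * x) \<partial>D K)"
      by (rule integral_eq_nn_integral) (auto simp: D_def)
    also have "(\<integral>\<^sup>+x. eexp (- real n * x) \<partial>D K) = (\<integral>\<^sup>+x. eexp (- (b + 1 + real n) * x) \<partial>K)"
      unfolding D_def
      by (subst nn_integral_density) (auto simp: ennreal_mult[symmetric] exp_add[symmetric] algebra_simps)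
    finally show ?thesis .
  qed
  have undo: "K = density (D K) (\<lambda>x. eexp ((b + 1) * x))"
    if [measurable_cong]: "sets K = sets borel" for K
    unfolding D_def
    by (simp add: density_density_eq ennreal_mult[symmetric] exp_add[symmetric] algebra_simps density_1)
  have Dfin: "finite_measure (D K)"
    if [measurable_cong]: "sets K = sets borel" and "(\<integral>\<^sup>+x. eexp (- (b + 1) * x) \<partial>K) < \<infinity>" for K
    using that(2) by (intro finite_measureI) (simp add: D_def emeasure_density)
  have Dnull: "emeasure (D K) {..<0} = 0" if "sets K = sets borel" "emeasure K {..<0} = 0" for K
  proof -
    have [measurable_cong]: "sets K = sets borel" by fact
    have "{..<0} \<in> null_sets (density K (\<lambda>x. eexp (- (b + 1) * x)))"
    proof (subst null_sets_density_iff)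
      have "AE x in K. x \<notin> {..<0}" by (rule AE_not_in[OF null_setsI]) (simp_all add: that)
      then show "{..<0} \<in> sets K \<and> (AE x in K. x \<in> {..<0} \<longrightarrow> eexp (- (b + 1) * x) = 0)"
        by (auto simp: that(1))
    qed simp
    then show ?thesis unfolding D_def by auto
  qed
  have "D M = D N"
  proof (rule finite_measure_eqI_moments)
    show "finite_measure (D M)" by (rule Dfin[OF sets(1) fin]) simp
    have "(\<integral>\<^sup>+x. eexp (- (b + 1) * x) \<partial>N) < \<infinity>"
      by (subst eq[symmetric], simp, rule fin, simp)
    then show "finite_measure (D N)" by (rule Dfin[OF sets(2)])
    show "sets (D M) = sets borel" "sets (D N) = sets borel" by (simp_all add: D_def sets)
    show "emeasure (D M) {..<0} = 0" "emeasure (D N) {..<0} = 0"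
      by (intro Dnull sets null)+
    show "(\<integral>x. exp (- real n * x) \<partial>D M) = (\<integral>x. exp (- real n * x) \<partial>D N)" for n
      unfolding DL[OF sets(1)] DL[OF sets(2)] by (subst eq) simp_all
  qed
  then show ?thesis using undo[OF sets(1)] undo[OF sets(2)] by metis
qed

text \<open>Uniqueness for the measures on [0, \<infinity>) with densities \<open>f\<close> and
  \<open>g\<close>. Densities are determined almost everywhere only, so pointwise conclusions need a
  further continuity argument.\<close>

lemma AE_eq_laplace:
  fixes f g :: "real \<Rightarrow> ennreal"
  assumes [measurable]: "f \<in> borel_measurable borel" "g \<in> borel_measurable borel"
    and eq: "\<And>l. l > b \<Longrightarrow> (\<integral>\<^sup>+x\<in>{0..}. eexp (- l * x) * f x \<partial>lborel)
                = (\<integral>\<^sup>+x\<in>{0..}. eexp (- l * x) * g x \<partial>lborel)"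
    and fin: "\<And>l. l > b \<Longrightarrow> (\<integral>\<^sup>+x\<in>{0..}. eexp (- l * x) * f x \<partial>lborel) < \<infinity>"
  shows "AE x in lborel. 0 \<le> x \<longrightarrow> f x = g x"
proof -
  define D where "D h = density lborel (\<lambda>x::real. h x * indicator {0..} x)" for h :: "real \<Rightarrow> ennreal"
  have nn: "(\<integral>\<^sup>+x. eexp (- l * x) \<partial>D h) = (\<integral>\<^sup>+x\<in>{0..}. eexp (- l * x) * h x \<partial>lborel)"
    if [measurable]: "h \<in> borel_measurable borel" for h l
    unfolding D_def by (subst nn_integral_density) (auto simp: mult_ac)
  have null: "emeasure (D h) {..<0} = 0" if [measurable]: "h \<in> borel_measurable borel" for h
  proof -
    have "{..<0} \<in> null_sets (D h)"
      unfolding D_def by (subst null_sets_density_iff) (auto simp: indicator_def)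
    then show ?thesis by auto
  qed
  have "D f = D g"
  proof (rule measure_eqI_laplace[of _ _ b])
    show "emeasure (D f) {..<0} = 0" "emeasure (D g) {..<0} = 0" by (intro null assms)+
    show "(\<integral>\<^sup>+x. eexp (- l * x) \<partial>D f) = (\<integral>\<^sup>+x. eexp (- l * x) \<partial>D g)" if "b < l" for l
      unfolding nn[OF assms(1)] nn[OF assms(2)] by (rule eq[OF that])
    show "(\<integral>\<^sup>+x. eexp (- l * x) \<partial>D f) < \<infinity>" if "b < l" for l
      unfolding nn[OF assms(1)] by (rule fin[OF that])
  qed (simp_all add: D_def)
  then have "AE x in lborel. f x * indicator {0..} x = g x * indicator {0..} x"
    unfolding D_def by (subst (asm) sigma_finite_measure.density_unique_iff[OF sigma_finite_lborel]) auto
  then show ?thesis by eventually_elim auto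
qed

text \<open>Every interval to the right of y has positive length, so a difference at y, which
  persists for a while to the right, would be seen almost everywhere. Right limits suffice, which
  matters because distribution functions may jump.\<close>

lemma AE_lborel_right_continuous_eq:
  fixes f g :: "real \<Rightarrow> real"
  assumes ae: "AE x in lborel. a \<le> x \<longrightarrow> f x = g x"
    and "a \<le> y" "(f \<longlongrightarrow> f y) (at_right y)" "(g \<longlongrightarrow> g y) (at_right y)"
  shows "f y = g y"
proof (rule ccontr)
  assume ne: "f y \<noteq> g y"
  have "((\<lambda>x. f x - g x) \<longlongrightarrow> f y - g y) (at_right y)" using assms by (intro tendsto_diff)
  moreover have "f y - g y \<in> - {0}" using ne by simp
  ultimately have "\<forall>\<^sub>F x in at_right y. f x - g x \<in> - {0}"
    by (intro topological_tendstoD) auto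
  then obtain b where b: "b > y" "\<And>x. y < x \<Longrightarrow> x < b \<Longrightarrow> f x \<noteq> g x"
    by (auto simp: eventually_at_right_field)
  have "AE x in lborel. x \<notin> {y<..<b}"
    using ae by eventually_elim (use b assms in force)
  then have "{y<..<b} \<in> null_sets lborel"
    by (subst AE_iff_null_sets) auto
  then have "emeasure lborel {y<..<b} = 0" by auto
  then show False using b(1) by simp
qed

section \<open>First passage of random walks\<close>

lemma suminf_ennreal_commute:
  fixes f :: "nat \<Rightarrow> nat \<Rightarrow> ennreal"
  shows "(\<Sum>k. \<Sum>i. f i k) = (\<Sum>i. \<Sum>k. f i k)"
  using nn_integral_suminf[of f "count_space UNIV"]
  by (simp add: nn_integral_count_space_nat)

lemma suminf_ennreal_offset:
  fixes f :: "nat \<Rightarrow> ennreal"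
  assumes "\<And>i. i < n \<Longrightarrow> f i = 0"
  shows "suminf f = (\<Sum>i. f (n + i))"
  using assms
proof (induction n arbitrary: f)
  case (Suc n)
  have "(\<lambda>i. f (Suc i)) sums (\<Sum>i. f (Suc i))" by (rule summable_sums) simp
  then have "f sums ((\<Sum>i. f (Suc i)) + f 0)" by (rule sums_Suc)
  then have "suminf f = (\<Sum>i. f (Suc i))" using Suc.prems[of 0] by (simp add: sums_iff)
  also have "\<dots> = (\<Sum>i. f (Suc (n + i)))" by (rule Suc.IH) (use Suc.prems in simp)
  finally show ?case by simp
qed simp

lemma suminf_ennreal_cauchy_product:
  fixes a b :: "nat \<Rightarrow> ennreal"
  shows "(\<Sum>k. \<Sum>i\<le>k. a i * b (k - i)) = (\<Sum>i. a i) * (\<Sum>j. b j)"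
proof -
  have "(\<Sum>k. \<Sum>i\<le>k. a i * b (k - i)) = (\<Sum>k. \<Sum>i. if i \<le> k then a i * b (k - i) else 0)"
  proof (rule arg_cong[where f = suminf], rule ext)
    fix k
    have "(\<lambda>i. if i \<in> {..k} then a i * b (k - i) else 0) sums (\<Sum>i\<le>k. a i * b (k - i))"
      by (rule sums_If_finite_set) simp
    then show "(\<Sum>i\<le>k. a i * b (k - i)) = (\<Sum>i. if i \<le> k then a i * b (k - i) else 0)"
      by (simp add: sums_iff)
  qed
  also have "\<dots> = (\<Sum>i. \<Sum>k. if i \<le> k then a i * b (k - i) else 0)"
    by (rule suminf_ennreal_commute)
  also have "\<dots> = (\<Sum>i. a i * (\<Sum>j. b j))"
  proof (rule arg_cong[where f = suminf], rule ext)
    fix i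
    have "(\<Sum>k. if i \<le> k then a i * b (k - i) else 0) = (\<Sum>j. a i * b j)"
      by (subst suminf_ennreal_offset[of i]) auto
    then show "(\<Sum>k. if i \<le> k then a i * b (k - i) else 0) = a i * (\<Sum>j. b j)"
      by simp
  qed
  finally show ?thesis by simp
qed

section \<open>Partial sums, running extrema and first hits of a sequence\<close>

definition psum :: "(nat \<Rightarrow> real) \<Rightarrow> nat \<Rightarrow> real" where
  "psum v k = (\<Sum>i<k. v i)"

definition pmax :: "(nat \<Rightarrow> real) \<Rightarrow> nat \<Rightarrow> real" where
  "pmax v k = Max (psum v ` {..k})"

definition pmin :: "(nat \<Rightarrow> real) \<Rightarrow> nat \<Rightarrow> real" where
  "pmin v k = Min (psum v ` {..k})"

definition hitup :: "real \<Rightarrow> (nat \<Rightarrow> real) \<Rightarrow> nat \<Rightarrow> bool" where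
  "hitup x v i \<longleftrightarrow> x < psum v i \<and> (\<forall>j<i. psum v j \<le> x)"

definition hitdn :: "real \<Rightarrow> (nat \<Rightarrow> real) \<Rightarrow> nat \<Rightarrow> bool" where
  "hitdn x v i \<longleftrightarrow> psum v i < x \<and> (\<forall>j<i. x \<le> psum v j)"

abbreviation seq_shift :: "nat \<Rightarrow> (nat \<Rightarrow> real) \<Rightarrow> nat \<Rightarrow> real" where
  "seq_shift i v \<equiv> (\<lambda>j. v (i + j))"

lemma psum_0[simp]: "psum v 0 = 0" by (simp add: psum_def)

lemma psum_add: "psum v (i + j) = psum v i + psum (seq_shift i v) j"
  unfolding psum_def by (induction j) (auto simp: algebra_simps)

lemma pmax_le_iff: "pmax v k \<le> x \<longleftrightarrow> (\<forall>j\<le>k. psum v j \<le> x)"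
  unfolding pmax_def by (subst Max_le_iff) auto

lemma less_pmax_iff: "x < pmax v k \<longleftrightarrow> (\<exists>j\<le>k. x < psum v j)"
  using pmax_le_iff[of v k x] by (auto simp: not_less[symmetric])

lemma le_pmin_iff: "x \<le> pmin v k \<longleftrightarrow> (\<forall>j\<le>k. x \<le> psum v j)"
  unfolding pmin_def by (subst Min_ge_iff) auto

lemma pmin_less_iff: "pmin v k < x \<longleftrightarrow> (\<exists>j\<le>k. psum v j < x)"
  using le_pmin_iff[of x v k] by (auto simp: not_less[symmetric])

lemma pmax_ge: "j \<le> k \<Longrightarrow> psum v j \<le> pmax v k"
  using pmax_le_iff[of v k "pmax v k"] by simp

lemma pmin_le: "j \<le> k \<Longrightarrow> pmin v k \<le> psum v j"
  using le_pmin_iff[of "pmin v k" v k] by simp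

lemma pmax_nonneg: "0 \<le> pmax v k" using pmax_ge[of 0 k v] by simp
lemma pmin_nonpos: "pmin v k \<le> 0" using pmin_le[of 0 k v] by simp

lemma pmax_attained: "\<exists>j\<le>k. pmax v k = psum v j"
  unfolding pmax_def using Max_in[of "psum v ` {..k}"] by (auto simp del: Max_in)

lemma pmin_attained: "\<exists>j\<le>k. pmin v k = psum v j"
  unfolding pmin_def using Min_in[of "psum v ` {..k}"] by (auto simp del: Min_in)

text \<open>Partial sums before a first strict passage lie below the one at the passage. So the
  maximum is attained from there on, where the sums are those of the shifted sequence raised by
  \<open>psum v i\<close>.\<close>

lemma pmax_after_hit:
  assumes "hitup x v i"
  shows "pmax v (i + j) = psum v i + pmax (seq_shift i v) j"
proof (rule antisym)
  show "pmax v (i + j) \<le> psum v i + pmax (seq_shift i v) j"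
    unfolding pmax_le_iff
  proof (intro allI impI)
    fix l assume l: "l \<le> i + j"
    show "psum v l \<le> psum v i + pmax (seq_shift i v) j"
    proof (cases "l < i")
      case True
      then have "psum v l < psum v i" using assms by (auto simp: hitup_def)
      then show ?thesis using pmax_nonneg[of "seq_shift i v" j] by linarith
    next
      case False
      then obtain m where m: "l = i + m" using le_Suc_ex[of i l] by auto
      then show ?thesis using l pmax_ge[of m j "seq_shift i v"] by (simp add: psum_add)
    qed
  qed
  obtain m where "m \<le> j" "pmax (seq_shift i v) j = psum (seq_shift i v) m" using pmax_attained by blast
  then show "psum v i + pmax (seq_shift i v) j \<le> pmax v (i + j)"
    using pmax_ge[of "i + m" "i + j" v] by (simp add: psum_add)
qed

lemma pmin_after_hit:
  assumes "hitdn x v i"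
  shows "pmin v (i + j) = psum v i + pmin (seq_shift i v) j"
proof (rule antisym)
  show "psum v i + pmin (seq_shift i v) j \<le> pmin v (i + j)"
    unfolding le_pmin_iff
  proof (intro allI impI)
    fix l assume l: "l \<le> i + j"
    show "psum v i + pmin (seq_shift i v) j \<le> psum v l"
    proof (cases "l < i")
      case True
      then have "psum v i < psum v l" using assms by (auto simp: hitdn_def)
      then show ?thesis using pmin_nonpos[of "seq_shift i v" j] by linarith
    next
      case False
      then obtain m where m: "l = i + m" using le_Suc_ex[of i l] by auto
      then show ?thesis using l pmin_le[of m j "seq_shift i v"] by (simp add: psum_add)
    qed
  qed
  obtain m where "m \<le> j" "pmin (seq_shift i v) j = psum (seq_shift i v) m" using pmin_attained by blast
  then show "pmin v (i + j) \<le> psum v i + pmin (seq_shift i v) j"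
    using pmin_le[of "i + m" "i + j" v] by (simp add: psum_add)
qed

text \<open>At most one index is the first to satisfy \<open>P\<close>, so at most one term is
  nonzero. A quantity at a random index thus becomes a sum over fixed indices, to which independence
  applies.\<close>

lemma sum_first_index:
  fixes c :: "nat \<Rightarrow> ennreal" and k :: nat
  shows "(\<Sum>i\<le>k. of_bool (P i \<and> (\<forall>j<i. \<not> P j)) * c i) = (if \<exists>j\<le>k. P j then c (LEAST j. P j) else 0)"
proof (cases "\<exists>j\<le>k. P j")
  case True
  define l where "l = (LEAST j. P j)"
  obtain j where j: "j \<le> k" "P j" using True by blast
  have l: "P l" "l \<le> k" "\<And>j. j < l \<Longrightarrow> \<not> P j"
    unfolding l_def by (rule LeastI[of P, OF j(2)], rule order_trans[OF Least_le[of P, OF j(2)] j(1)], erule not_less_Least[of _ P])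
  have *: "(P i \<and> (\<forall>j<i. \<not> P j)) \<longleftrightarrow> i = l" for i
    using l linorder_neqE_nat[of i l] by blast
  have "(\<Sum>i\<le>k. of_bool (i = l) * c i) = (\<Sum>i\<le>k. if l = i then c i else 0)"
    by (intro sum.cong) auto
  also have "\<dots> = c l" using l(2) by simp
  finally show ?thesis using True unfolding * l_def[symmetric] by simp
next
  case False
  then have "of_bool (P i \<and> (\<forall>j<i. \<not> P j)) * c i = 0" if "i \<le> k" for i
    using that by simp
  then have "(\<Sum>i\<le>k. of_bool (P i \<and> (\<forall>j<i. \<not> P j)) * c i) = 0"
    by (intro sum.neutral) blast
  with False show ?thesis by (simp only: if_False)
qed

text \<open>The height reached at the passage enters both the maximum and the endpoint and cancels
  in their difference. No trace of the overshoot is left in the summands.\<close>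

lemma up_decomposition:
  "of_bool (x < pmax v k) * eexp (- \<beta> * (pmax v k - psum v k))
   = (\<Sum>i\<le>k. of_bool (hitup x v i) * eexp (- \<beta> * (pmax (seq_shift i v) (k - i) - psum (seq_shift i v) (k - i))))"
proof -
  have h: "hitup x v i \<longleftrightarrow> x < psum v i \<and> (\<forall>j<i. \<not> x < psum v j)" for i
    by (simp add: hitup_def not_less)
  have main: "pmax v k - psum v k = pmax (seq_shift l v) (k - l) - psum (seq_shift l v) (k - l)"
    if l: "l = (LEAST j. x < psum v j)" and ex: "\<exists>j\<le>k. x < psum v j" for l
  proof -
    have lk: "l \<le> k" using ex unfolding l by (meson Least_le order_trans)
    have "hitup x v l" unfolding h l using ex LeastI not_less_Least by metis
    from pmax_after_hit[OF this, of "k - l"] show ?thesis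
      using psum_add[of v l "k - l"] lk by simp
  qed
  show ?thesis
  proof (cases "\<exists>j\<le>k. x < psum v j")
    case True
    then show ?thesis unfolding h sum_first_index less_pmax_iff using main[OF refl True] by simp
  next
    case False
    then show ?thesis unfolding h sum_first_index less_pmax_iff by (simp only: False if_False of_bool_eq simp_thms mult_zero_left)
  qed
qed

text \<open>Here the height at the passage does not cancel: it adds to the minimum of the remaining
  walk and becomes a factor determined by the first i steps.\<close>

lemma down_decomposition:
  "of_bool (pmin v k < x) * eexp (\<beta> * pmin v k)
   = (\<Sum>i\<le>k. (of_bool (hitdn x v i) * eexp (\<beta> * psum v i)) * eexp (\<beta> * pmin (seq_shift i v) (k - i)))"
proof -
  have h: "hitdn x v i \<longleftrightarrow> psum v i < x \<and> (\<forall>j<i. \<not> psum v j < x)" for i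
    by (simp add: hitdn_def not_less)
  have main: "pmin v k = psum v l + pmin (seq_shift l v) (k - l)"
    if l: "l = (LEAST j. psum v j < x)" and ex: "\<exists>j\<le>k. psum v j < x" for l
  proof -
    have lk: "l \<le> k" using ex unfolding l by (meson Least_le order_trans)
    have "hitdn x v l" unfolding h l using ex LeastI not_less_Least by metis
    from pmin_after_hit[OF this, of "k - l"] show ?thesis using lk by simp
  qed
  show ?thesis
  proof (cases "\<exists>j\<le>k. psum v j < x")
    case True
    then show ?thesis unfolding h mult.assoc sum_first_index pmin_less_iff using main[OF refl True]
      by (simp add: ennreal_mult[symmetric] exp_add[symmetric] distrib_left)
  next
    case False
    then show ?thesis unfolding h mult.assoc sum_first_index pmin_less_iff by (simp only: False if_False of_bool_eq simp_thms mult_zero_left)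
  qed
qed

lemma psum_cong: "(\<And>j. j < i \<Longrightarrow> v j = w j) \<Longrightarrow> psum v i = psum w i"
  unfolding psum_def by (auto intro: sum.cong)

lemma psum_comb_seq: "j \<le> i \<Longrightarrow> psum (comb_seq i v w) j = psum v j"
  by (rule psum_cong) (simp add: comb_seq_less)

lemma pmax_comb_seq: "j \<le> i \<Longrightarrow> pmax (comb_seq i v w) j = pmax v j"
  unfolding pmax_def by (auto simp: psum_comb_seq intro!: arg_cong[where f = Max] image_cong)

lemma hitup_comb_seq: "hitup x (comb_seq i v w) i = hitup x v i"
  by (simp add: hitup_def psum_comb_seq)

lemma hitdn_comb_seq: "hitdn x (comb_seq i v w) i = hitdn x v i"
  by (simp add: hitdn_def psum_comb_seq)

lemma shift_comb_seq: "seq_shift i (comb_seq i v w) = w"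
  by (simp add: comb_seq_def)

section \<open>The walk with independent steps of law \<open>D\<close>\<close>

locale random_walk = sequence_space D for D :: "real measure" +
  assumes sets_D[measurable_cong, simp]: "sets D = sets borel"
begin

lemma space_D[simp]: "space D = UNIV"
  using sets_eq_imp_space_eq[OF sets_D] by simp

lemma space_S[simp]: "space S = UNIV"
  by (simp add: space_PiM)

lemma measurable_component_borel[measurable]: "(\<lambda>v. v i) \<in> borel_measurable S"
  using measurable_component_singleton[of i UNIV "\<lambda>_. D"] sets_D by (simp cong: measurable_cong_sets)

lemma measurable_psum[measurable]: "(\<lambda>v. psum v k) \<in> borel_measurable S"
  unfolding psum_def by measurable

lemma measurable_pmax[measurable]: "(\<lambda>v. pmax v k) \<in> borel_measurable S"
  unfolding pmax_def
  by (induction k) (simp_all add: atMost_Suc)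

lemma measurable_pmin[measurable]: "(\<lambda>v. pmin v k) \<in> borel_measurable S"
  unfolding pmin_def
  by (induction k) (simp_all add: atMost_Suc)

lemma measurable_hitup[measurable]: "Measurable.pred S (\<lambda>v. hitup x v k)"
  unfolding hitup_def by measurable

lemma measurable_hitdn[measurable]: "Measurable.pred S (\<lambda>v. hitdn x v k)"
  unfolding hitdn_def by measurable

lemma measurable_shift: "seq_shift i \<in> measurable S S"
  by (rule measurable_PiM_single') auto

lemma nn_integral_split:
  assumes [measurable]: "f \<in> borel_measurable S"
  shows "(\<integral>\<^sup>+v. f v \<partial>S) = (\<integral>\<^sup>+v. \<integral>\<^sup>+w. f (comb_seq i v w) \<partial>S \<partial>S)"
proof -
  have "(\<integral>\<^sup>+v. f v \<partial>S) = (\<integral>\<^sup>+v. f v \<partial>distr (S \<Otimes>\<^sub>M S) S (\<lambda>(v, w). comb_seq i v w))"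
    by (simp only: PiM_comb_seq)
  also have "\<dots> = (\<integral>\<^sup>+p. f (comb_seq i (fst p) (snd p)) \<partial>(S \<Otimes>\<^sub>M S))"
    by (subst nn_integral_distr) (auto simp: case_prod_beta)
  also have "\<dots> = (\<integral>\<^sup>+v. \<integral>\<^sup>+w. f (comb_seq i v w) \<partial>S \<partial>S)"
    by (subst P.nn_integral_fst[symmetric]) auto
  finally show ?thesis .
qed

text \<open>\<open>comb_seq i v w\<close> follows \<open>v\<close> for i steps and then continues
  with \<open>w\<close>; splicing two independent sequences in this way reproduces \<open>S\<close>.
  The last premise says that \<open>a\<close> depends on the first i coordinates only.\<close>

lemma markov:
  assumes [measurable]: "a \<in> borel_measurable S" "b \<in> borel_measurable S"
    and a: "\<And>v w. a (comb_seq i v w) = a v"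
  shows "(\<integral>\<^sup>+v. a v * b (seq_shift i v) \<partial>S) = (\<integral>\<^sup>+v. a v \<partial>S) * (\<integral>\<^sup>+v. b v \<partial>S)"
proof -
  have [measurable]: "(\<lambda>v. b (seq_shift i v)) \<in> borel_measurable S"
    using measurable_compose[OF measurable_shift assms(2)] .
  have "(\<integral>\<^sup>+v. a v * b (seq_shift i v) \<partial>S) = (\<integral>\<^sup>+v. \<integral>\<^sup>+w. a v * b w \<partial>S \<partial>S)"
    by (subst nn_integral_split[of _ i]) (auto simp: a shift_comb_seq)
  then show ?thesis by (simp add: nn_integral_cmult nn_integral_multc)
qed

text \<open>The Markov property splits each integral at index i, and
  \<open>r ^ k = r ^ i * r ^ (k - i)\<close> turns the generating function into a Cauchy product.
  For a walk killed with probability 1 - r per step this is the strong Markov property at a first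
  passage.\<close>

lemma renewal:
  fixes r :: ennreal
  assumes [measurable]: "\<And>i. a i \<in> borel_measurable S" "\<And>i. b i \<in> borel_measurable S"
    and a: "\<And>i v w. a i (comb_seq i v w) = a i v"
  shows "(\<Sum>k. r ^ k * (\<integral>\<^sup>+v. (\<Sum>i\<le>k. a i v * b (k - i) (seq_shift i v)) \<partial>S))
    = (\<Sum>i. r ^ i * (\<integral>\<^sup>+v. a i v \<partial>S)) * (\<Sum>j. r ^ j * (\<integral>\<^sup>+v. b j v \<partial>S))"
proof -
  have "r ^ k * (\<integral>\<^sup>+v. (\<Sum>i\<le>k. a i v * b (k - i) (seq_shift i v)) \<partial>S)
    = (\<Sum>i\<le>k. (r ^ i * (\<integral>\<^sup>+v. a i v \<partial>S)) * (r ^ (k - i) * (\<integral>\<^sup>+v. b (k - i) v \<partial>S)))" for k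
  proof -
    have "(\<integral>\<^sup>+v. (\<Sum>i\<le>k. a i v * b (k - i) (seq_shift i v)) \<partial>S)
      = (\<Sum>i\<le>k. (\<integral>\<^sup>+v. a i v \<partial>S) * (\<integral>\<^sup>+v. b (k - i) v \<partial>S))"
      using measurable_compose[OF measurable_shift, of "b _"] by (subst nn_integral_sum) (simp_all add: markov a)
    moreover have "r ^ k * (x * y) = (r ^ i * x) * (r ^ (k - i) * y)" if "i \<le> k" for i and x y :: ennreal
    proof -
      have "r ^ k = r ^ i * r ^ (k - i)" using that by (simp add: power_add[symmetric])
      then show ?thesis by (simp only: mult_ac)
    qed
    ultimately show ?thesis by (simp add: sum_distrib_left)
  qed
  then show ?thesis
    using suminf_ennreal_cauchy_product[of "\<lambda>i. r ^ i * (\<integral>\<^sup>+v. a i v \<partial>S)" "\<lambda>j. r ^ j * (\<integral>\<^sup>+v. b j v \<partial>S)"]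
    by (simp only:)
qed

text \<open>Reversing the first k steps preserves the product law and turns the j-th partial sum
  into \<open>psum v k - psum v (k - j)\<close>, hence the maximum minus the endpoint into minus the
  minimum.\<close>

lemma duality:
  fixes h :: "real \<Rightarrow> ennreal"
  assumes [measurable]: "h \<in> borel_measurable borel"
  shows "(\<integral>\<^sup>+v. h (pmax v k - psum v k) \<partial>S) = (\<integral>\<^sup>+v. h (- pmin v k) \<partial>S)"
proof -
  have hm: "(\<lambda>v. h (pmax v k - psum v k)) \<in> borel_measurable S" by measurable
  \<comment> \<open>An involution that reverses the indices below k and fixes the others, so it is a
    reindexing of the whole product.\<close>
  define f where "f j = (if j < k then k - 1 - j else j)" for j
  have ff: "f (f j) = j" for j by (auto simp: f_def)
  have "inj f" by (rule inj_on_inverseI[of _ f]) (rule ff)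
  then have eq: "distr S S (\<lambda>v n. v (f n)) = S"
    using distr_PiM_reindex[of UNIV "\<lambda>_. D" f UNIV] M.prob_space_axioms by (simp add: restrict_def)
  have fm: "(\<lambda>v n. v (f n)) \<in> measurable S S"
    by (rule measurable_PiM_single') auto
  have ps: "psum (\<lambda>n. v (f n)) j = psum v k - psum v (k - j)" if "j \<le> k" for v j
    using that
  proof (induction j)
    case (Suc j)
    have "k - j = Suc (k - Suc j)" using Suc.prems by simp
    then have "psum v (k - j) = psum v (k - Suc j) + v (k - Suc j)"
      by (simp add: psum_def)
    moreover have "psum (\<lambda>n. v (f n)) (Suc j) = psum (\<lambda>n. v (f n)) j + v (k - Suc j)"
      using Suc.prems by (simp add: psum_def f_def)
    ultimately show ?case using Suc by simp
  qed simp
  have mx: "pmax (\<lambda>n. v (f n)) k - psum (\<lambda>n. v (f n)) k = - pmin v k" for v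
  proof -
    have "pmax (\<lambda>n. v (f n)) k = psum v k - pmin v k"
    proof (rule antisym)
      show "pmax (\<lambda>n. v (f n)) k \<le> psum v k - pmin v k"
        unfolding pmax_le_iff
      proof (intro allI impI)
        fix j assume "j \<le> k"
        then show "psum (\<lambda>n. v (f n)) j \<le> psum v k - pmin v k"
          using pmin_le[of "k - j" k v] ps[of j v] by simp
      qed
      obtain m where m: "m \<le> k" "pmin v k = psum v m" using pmin_attained by blast
      then show "psum v k - pmin v k \<le> pmax (\<lambda>n. v (f n)) k"
        using pmax_ge[of "k - m" k "\<lambda>n. v (f n)"] ps[of "k - m" v] by simp
    qed
    then show ?thesis using ps[of k v] by simp
  qed
  have "(\<integral>\<^sup>+v. h (pmax v k - psum v k) \<partial>S) = (\<integral>\<^sup>+v. h (pmax v k - psum v k) \<partial>distr S S (\<lambda>v n. v (f n)))"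
    by (subst eq) (rule refl)
  also have "\<dots> = (\<integral>\<^sup>+v. h (pmax (\<lambda>n. v (f n)) k - psum (\<lambda>n. v (f n)) k) \<partial>S)"
    using nn_integral_distr[OF fm, of "\<lambda>v. h (pmax v k - psum v k)"] hm by simp
  also have "\<dots> = (\<integral>\<^sup>+v. h (- pmin v k) \<partial>S)"
    by (simp only: mx)
  finally show ?thesis .
qed

lemma up_factorization:
  fixes r :: ennreal
  shows "(\<Sum>k. r ^ k * (\<integral>\<^sup>+v. of_bool (x < pmax v k) * eexp (- \<beta> * (pmax v k - psum v k)) \<partial>S))
    = (\<Sum>k. r ^ k * (\<integral>\<^sup>+v. of_bool (hitup x v k) \<partial>S))
      * (\<Sum>k. r ^ k * (\<integral>\<^sup>+v. eexp (- \<beta> * (pmax v k - psum v k)) \<partial>S))"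
  unfolding up_decomposition
  by (rule renewal[of "\<lambda>i v. of_bool (hitup x v i)" "\<lambda>j v. eexp (- \<beta> * (pmax v j - psum v j))"])
    (auto simp: hitup_comb_seq)

lemma down_factorization:
  fixes r :: ennreal
  shows "(\<Sum>k. r ^ k * (\<integral>\<^sup>+v. of_bool (pmin v k < x) * eexp (\<beta> * pmin v k) \<partial>S))
    = (\<Sum>k. r ^ k * (\<integral>\<^sup>+v. of_bool (hitdn x v k) * eexp (\<beta> * psum v k) \<partial>S))
      * (\<Sum>k. r ^ k * (\<integral>\<^sup>+v. eexp (\<beta> * pmin v k) \<partial>S))"
  unfolding down_decomposition
  by (rule renewal[of "\<lambda>i v. of_bool (hitdn x v i) * eexp (\<beta> * psum v i)" "\<lambda>j v. eexp (\<beta> * pmin v j)"])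
    (auto simp: hitdn_comb_seq psum_comb_seq)

text \<open>A walk still at or below x either passes x at its next step or stays there. Independence
  of that step gives a one-step recursion, and summing it with weights gives the identity.
  \<open>A\<close> stands on both sides because it may be infinite.\<close>

lemma optional_stopping:
  fixes r :: ennreal
  assumes x: "0 \<le> x" and \<rho>: "(\<integral>\<^sup>+z. eexp (\<beta> * z) \<partial>D) = \<rho>"
  defines "A \<equiv> (\<Sum>k. r ^ k * (\<integral>\<^sup>+v. of_bool (pmax v k \<le> x) * eexp (\<beta> * psum v k) \<partial>S))"
  shows "(\<Sum>k. r ^ k * (\<integral>\<^sup>+v. of_bool (hitup x v k) * eexp (\<beta> * psum v k) \<partial>S)) + A
    = 1 + r * \<rho> * A"
proof -
  define a where "a k = (\<integral>\<^sup>+v. of_bool (pmax v k \<le> x) * eexp (\<beta> * psum v k) \<partial>S)" for k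
  define t where "t k = (\<integral>\<^sup>+v. of_bool (hitup x v k) * eexp (\<beta> * psum v k) \<partial>S)" for k
  have step: "t (Suc k) + a (Suc k) = \<rho> * a k" for k
  proof -
    have dec: "hitup x v (Suc k) \<longleftrightarrow> pmax v k \<le> x \<and> x < psum v (Suc k)" for v
      by (auto simp: hitup_def pmax_le_iff less_Suc_eq_le)
    have dec': "pmax v (Suc k) \<le> x \<longleftrightarrow> pmax v k \<le> x \<and> psum v (Suc k) \<le> x" for v
      by (auto simp: pmax_le_iff le_Suc_eq)
    have "t (Suc k) + a (Suc k) = (\<integral>\<^sup>+v. of_bool (pmax v k \<le> x) * eexp (\<beta> * psum v (Suc k)) \<partial>S)"
      unfolding t_def a_def
      by (subst nn_integral_add[symmetric]) (auto simp: dec dec' intro!: nn_integral_cong)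
    also have "\<dots> = (\<integral>\<^sup>+v. (of_bool (pmax v k \<le> x) * eexp (\<beta> * psum v k)) * eexp (\<beta> * seq_shift k v 0) \<partial>S)"
      by (intro nn_integral_cong) (simp add: psum_def distrib_left exp_add ennreal_mult mult.assoc)
    also have "\<dots> = a k * (\<integral>\<^sup>+v. eexp (\<beta> * v 0) \<partial>S)"
      unfolding a_def
      by (rule markov[of "\<lambda>v. of_bool (pmax v k \<le> x) * eexp (\<beta> * psum v k)" "\<lambda>v. eexp (\<beta> * v 0)" k])
        (auto simp: pmax_comb_seq psum_comb_seq)
    also have "(\<integral>\<^sup>+v. eexp (\<beta> * v 0) \<partial>S) = \<rho>"
    proof -
      have "(\<integral>\<^sup>+v. eexp (\<beta> * v 0) \<partial>S) = (\<integral>\<^sup>+z. eexp (\<beta> * z) \<partial>distr S D (\<lambda>v. v 0))"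
        by (subst nn_integral_distr) (auto simp: measurable_cong_sets[OF sets_D refl])
      also have "distr S D (\<lambda>v. v 0) = D"
        using distr_PiM_component[of UNIV "\<lambda>_. D" 0] M.prob_space_axioms by simp
      finally show ?thesis using \<rho> by simp
    qed
    finally show ?thesis by (simp add: mult.commute)
  qed
  have t0: "t 0 = 0" using x by (simp add: t_def hitup_def)
  have a0: "a 0 = 1" using x P.emeasure_space_1 by (simp add: a_def pmax_def)
  have sh: "suminf f = f 0 + (\<Sum>k. f (Suc k))" for f :: "nat \<Rightarrow> ennreal"
    using sums_Suc[of f "\<Sum>k. f (Suc k)"] by (simp add: sums_iff summable_sums add.commute)
  have "(\<Sum>k. r ^ k * t k) + (\<Sum>k. r ^ k * a k)
      = (\<Sum>k. r ^ Suc k * t (Suc k)) + (1 + (\<Sum>k. r ^ Suc k * a (Suc k)))"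
    using sh[of "\<lambda>k. r ^ k * t k"] sh[of "\<lambda>k. r ^ k * a k"] by (simp add: t0 a0)
  also have "\<dots> = 1 + ((\<Sum>k. r ^ Suc k * t (Suc k)) + (\<Sum>k. r ^ Suc k * a (Suc k)))"
    by (simp add: add_ac)
  also have "(\<Sum>k. r ^ Suc k * t (Suc k)) + (\<Sum>k. r ^ Suc k * a (Suc k)) = (\<Sum>k. r ^ Suc k * (t (Suc k) + a (Suc k)))"
    by (subst suminf_add) (auto simp: distrib_left)
  also have "\<dots> = (\<Sum>k. (r * \<rho>) * (r ^ k * a k))"
    by (simp add: step mult_ac)
  also have "\<dots> = r * \<rho> * (\<Sum>k. r ^ k * a k)" by simp
  finally show ?thesis unfolding A_def a_def t_def .
qed

end

section \<open>Paths without upward jumps on dyadic grids\<close>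

definition dy :: "nat \<Rightarrow> nat \<Rightarrow> real" where "dy n k = real k / 2 ^ n"

definition incr :: "nat \<Rightarrow> (real \<Rightarrow> real) \<Rightarrow> nat \<Rightarrow> real" where
  "incr n f i = f (dy n (Suc i)) - f (dy n i)"

definition kap :: "nat \<Rightarrow> real \<Rightarrow> nat" where "kap n t = nat \<lfloor>t * 2 ^ n\<rfloor>"

definition gsup :: "nat \<Rightarrow> (real \<Rightarrow> real) \<Rightarrow> real \<Rightarrow> real" where
  "gsup n f t = pmax (incr n f) (kap n t)"

definition ginf :: "nat \<Rightarrow> (real \<Rightarrow> real) \<Rightarrow> real \<Rightarrow> real" where
  "ginf n f t = pmin (incr n f) (kap n t)"

text \<open>Extrema of \<open>f - f 0\<close> over the dyadic times in [0, t] only, which makes them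
  limits of functionals of walks. The value at a non-dyadic t itself does not enter.\<close>

definition run_sup :: "(real \<Rightarrow> real) \<Rightarrow> real \<Rightarrow> real" where
  "run_sup f t = (SUP n. gsup n f t)"

definition run_inf :: "(real \<Rightarrow> real) \<Rightarrow> real \<Rightarrow> real" where
  "run_inf f t = (INF n. ginf n f t)"

text \<open>Meaningful only if the set is nonempty; its uses come with a visit to \<open>P\<close>
  or with an indicator of one.\<close>

definition entry_time :: "real set \<Rightarrow> (real \<Rightarrow> real) \<Rightarrow> real" where
  "entry_time P f = Inf {s. 0 \<le> s \<and> f s \<in> P}"

lemma dy_nonneg[simp]: "0 \<le> dy n k" by (simp add: dy_def)
lemma dy_0[simp]: "dy n 0 = 0" by (simp add: dy_def)
lemma dy_Suc_double: "dy (Suc n) (2 * k) = dy n k" by (simp add: dy_def)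

lemma le_kap_iff: "0 \<le> t \<Longrightarrow> j \<le> kap n t \<longleftrightarrow> dy n j \<le> t"
  by (simp add: kap_def dy_def le_nat_iff le_floor_iff pos_divide_le_eq)

lemma dyadic_between:
  assumes "0 \<le> s" "s < u"
  shows "\<forall>\<^sub>F n in sequentially. \<exists>k. s < dy n k \<and> dy n k < u"
proof -
  have "(\<lambda>n. (1/2::real) ^ n) \<longlonglongrightarrow> 0" by (rule LIMSEQ_power_zero) simp
  then have "\<forall>\<^sub>F n in sequentially. (1/2::real) ^ n < u - s"
    using assms by (intro order_tendstoD) auto
  then show ?thesis
  proof eventually_elim
    case (elim n)
    have fl: "of_int \<lfloor>s * 2 ^ n\<rfloor> \<le> s * 2 ^ n" "s * 2 ^ n < of_int \<lfloor>s * 2 ^ n\<rfloor> + 1" by linarith+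
    have "0 \<le> \<lfloor>s * 2 ^ n\<rfloor>" using assms by simp
    then have k: "real (nat \<lfloor>s * 2 ^ n\<rfloor> + 1) = of_int \<lfloor>s * 2 ^ n\<rfloor> + 1" by simp
    have "s < dy n (nat \<lfloor>s * 2 ^ n\<rfloor> + 1)"
      unfolding dy_def k using fl by (simp add: pos_less_divide_eq)
    moreover have "dy n (nat \<lfloor>s * 2 ^ n\<rfloor> + 1) < u"
    proof -
      have "(of_int \<lfloor>s * 2 ^ n\<rfloor> + 1) / 2 ^ n \<le> s + (1/2) ^ n"
        using fl by (simp add: pos_divide_le_eq algebra_simps power_one_over)
      then show ?thesis unfolding dy_def k using elim by linarith
    qed
    ultimately show ?case by blast
  qed
qed

section \<open>Deterministic paths: extrema over grids and entry times\<close>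

locale snpath =
  fixes f :: "real \<Rightarrow> real"
  assumes f0: "f 0 = 0"
    and rc: "\<And>t. 0 \<le> t \<Longrightarrow> (f \<longlongrightarrow> f t) (at_right t)"
    and ll: "\<And>t. 0 < t \<Longrightarrow> \<exists>l. (f \<longlongrightarrow> l) (at_left t) \<and> f t \<le> l"
begin

lemma psum_incr: "psum (incr n f) k = f (dy n k)"
  unfolding psum_def incr_def using sum_lessThan_telescope[of "\<lambda>i. f (dy n i)" k] by (simp add: f0)

lemma less_gsup_iff: "0 \<le> t \<Longrightarrow> x < gsup n f t \<longleftrightarrow> (\<exists>j. dy n j \<le> t \<and> x < f (dy n j))"
  by (simp add: gsup_def less_pmax_iff psum_incr le_kap_iff)

lemma ginf_less_iff: "0 \<le> t \<Longrightarrow> ginf n f t < x \<longleftrightarrow> (\<exists>j. dy n j \<le> t \<and> f (dy n j) < x)"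
  by (simp add: ginf_def pmin_less_iff psum_incr le_kap_iff)

lemma incseq_gsup: "0 \<le> t \<Longrightarrow> incseq (\<lambda>n. gsup n f t)"
proof (rule incseq_SucI)
  fix n assume t: "0 \<le> t"
  show "gsup n f t \<le> gsup (Suc n) f t"
  proof (rule ccontr)
    assume "\<not> gsup n f t \<le> gsup (Suc n) f t"
    then have "gsup (Suc n) f t < gsup n f t" by simp
    then obtain j where "dy n j \<le> t" "gsup (Suc n) f t < f (dy n j)" using less_gsup_iff[OF t] by blast
    then have "gsup (Suc n) f t < gsup (Suc n) f t"
      using less_gsup_iff[OF t, of "gsup (Suc n) f t" "Suc n"] dy_Suc_double by metis
    then show False by simp
  qed
qed

lemma decseq_ginf: "0 \<le> t \<Longrightarrow> decseq (\<lambda>n. ginf n f t)"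
proof (rule decseq_SucI)
  fix n assume t: "0 \<le> t"
  show "ginf (Suc n) f t \<le> ginf n f t"
  proof (rule ccontr)
    assume "\<not> ginf (Suc n) f t \<le> ginf n f t"
    then have "ginf n f t < ginf (Suc n) f t" by simp
    then obtain j where "dy n j \<le> t" "f (dy n j) < ginf (Suc n) f t" using ginf_less_iff[OF t] by blast
    then have "ginf (Suc n) f t < ginf (Suc n) f t"
      using ginf_less_iff[OF t, of "Suc n" "ginf (Suc n) f t"] dy_Suc_double by metis
    then show False by simp
  qed
qed

text \<open>The one-sided limits bound the path near each time, and finitely many of these
  neighbourhoods cover [0, t].\<close>

lemma path_bounded: "\<exists>B. \<forall>s. 0 \<le> s \<and> s \<le> t \<longrightarrow> \<bar>f s\<bar> \<le> B"
proof -
  have loc: "\<exists>U B. open U \<and> s \<in> U \<and> (\<forall>y\<in>U. 0 \<le> y \<longrightarrow> \<bar>f y\<bar> \<le> B)" if s: "0 \<le> s" for s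
  proof -
    have "\<forall>\<^sub>F y in at_right s. dist (f y) (f s) < 1" by (rule tendstoD[OF rc[OF s]]) simp
    then obtain b where b: "b > s" "\<And>y. s < y \<Longrightarrow> y < b \<Longrightarrow> dist (f y) (f s) < 1"
      by (auto simp: eventually_at_right_field)
    have "\<exists>a<s. \<exists>C. \<forall>y. 0 \<le> y \<longrightarrow> a < y \<longrightarrow> y < s \<longrightarrow> \<bar>f y\<bar> \<le> C"
    proof (cases "s = 0")
      case True then show ?thesis by (intro exI[of _ "-1"]) auto
    next
      case False
      then obtain l where "(f \<longlongrightarrow> l) (at_left s)" using ll[of s] s by auto
      then have "\<forall>\<^sub>F y in at_left s. dist (f y) l < 1" by (rule tendstoD) simp
      then obtain a where a: "a < s" "\<And>y. a < y \<Longrightarrow> y < s \<Longrightarrow> dist (f y) l < 1"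
        by (auto simp: eventually_at_left_field)
      have "\<bar>f y\<bar> \<le> \<bar>l\<bar> + 1" if "a < y" "y < s" for y
        using a(2)[OF that] by (auto simp: dist_real_def)
      then show ?thesis using a(1) by blast
    qed
    then obtain a C where a: "a < s" "\<And>y. 0 \<le> y \<Longrightarrow> a < y \<Longrightarrow> y < s \<Longrightarrow> \<bar>f y\<bar> \<le> C" by blast
    have "\<bar>f y\<bar> \<le> max C (\<bar>f s\<bar> + 1)" if "a < y" "y < b" "0 \<le> y" for y
    proof -
      consider "y < s" | "y = s" | "s < y" by linarith
      then show ?thesis
      proof cases
        case 1 then show ?thesis using a(2)[of y] that by simp
      next
        case 2 then show ?thesis by simp
      next
        case 3 then show ?thesis using b(2)[of y] that by (auto simp: dist_real_def)
      qed
    qed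
    then show ?thesis using a(1) b(1)
      by (intro exI[of _ "{a<..<b}"] exI[of _ "max C (\<bar>f s\<bar> + 1)"]) auto
  qed
  then obtain U B where UB: "\<And>s. 0 \<le> s \<Longrightarrow> open (U s)" "\<And>s. 0 \<le> s \<Longrightarrow> s \<in> U s"
    "\<And>s y. 0 \<le> s \<Longrightarrow> y \<in> U s \<Longrightarrow> 0 \<le> y \<Longrightarrow> \<bar>f y\<bar> \<le> B s" by metis
  obtain C where C: "C \<subseteq> {0..t}" "finite C" "{0..t} \<subseteq> (\<Union>c\<in>C. U c)"
    by (rule compactE_image[of "{0..t}" "{0..t}" U]) (use UB in auto)
  have "\<bar>f s\<bar> \<le> (\<Sum>c\<in>C. \<bar>B c\<bar>)" if s: "0 \<le> s" "s \<le> t" for s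
  proof -
    have "s \<in> (\<Union>c\<in>C. U c)" by (rule subsetD[OF C(3)]) (simp add: s)
    then obtain c where c: "c \<in> C" "s \<in> U c" by (rule UN_E)
    then have "\<bar>f s\<bar> \<le> B c" using UB(3)[of c s] C(1) s by auto
    also have "\<dots> \<le> \<bar>B c\<bar>" by simp
    also have "\<dots> \<le> (\<Sum>c\<in>C. \<bar>B c\<bar>)" using c C(2) by (intro member_le_sum) auto
    finally show ?thesis .
  qed
  then show ?thesis by blast
qed

lemma gsup_bounded: assumes "0 \<le> t" shows "bdd_above (range (\<lambda>n. gsup n f t))"
proof -
  obtain B where B: "\<And>s. 0 \<le> s \<Longrightarrow> s \<le> t \<Longrightarrow> \<bar>f s\<bar> \<le> B" using path_bounded by blast
  have "gsup n f t \<le> B" for n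
  proof (rule ccontr)
    assume "\<not> gsup n f t \<le> B"
    then obtain j where "dy n j \<le> t" "B < f (dy n j)" using less_gsup_iff[OF assms, of B n] by auto
    then show False using B[of "dy n j"] by simp
  qed
  then show ?thesis by (intro bdd_aboveI2)
qed

lemma ginf_bounded: assumes "0 \<le> t" shows "bdd_below (range (\<lambda>n. ginf n f t))"
proof -
  obtain B where B: "\<And>s. 0 \<le> s \<Longrightarrow> s \<le> t \<Longrightarrow> \<bar>f s\<bar> \<le> B" using path_bounded by blast
  have "- B \<le> ginf n f t" for n
  proof (rule ccontr)
    assume "\<not> - B \<le> ginf n f t"
    then obtain j where "dy n j \<le> t" "f (dy n j) < - B" using ginf_less_iff[OF assms, of n "-B"] by auto
    then show False using B[of "dy n j"] by simp
  qed
  then show ?thesis by (intro bdd_belowI2)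
qed

lemma gsup_tendsto: "0 \<le> t \<Longrightarrow> (\<lambda>n. gsup n f t) \<longlonglongrightarrow> run_sup f t"
  unfolding run_sup_def by (intro LIMSEQ_incseq_SUP gsup_bounded incseq_gsup)

lemma ginf_tendsto: "0 \<le> t \<Longrightarrow> (\<lambda>n. ginf n f t) \<longlonglongrightarrow> run_inf f t"
  unfolding run_inf_def by (intro LIMSEQ_decseq_INF ginf_bounded decseq_ginf)

lemma run_inf_less_iff: "0 \<le> t \<Longrightarrow> run_inf f t < x \<longleftrightarrow> (\<exists>n. ginf n f t < x)"
  unfolding run_inf_def by (subst cINF_less_iff) (auto intro: ginf_bounded)

lemma gsup_le_run_sup: "0 \<le> t \<Longrightarrow> gsup n f t \<le> run_sup f t"
  unfolding run_sup_def by (intro cSUP_upper gsup_bounded) auto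

lemma run_inf_le_ginf: "0 \<le> t \<Longrightarrow> run_inf f t \<le> ginf n f t"
  unfolding run_inf_def by (intro cINF_lower ginf_bounded) auto

lemma run_inf_le: "0 \<le> t \<Longrightarrow> dy n j \<le> t \<Longrightarrow> run_inf f t \<le> f (dy n j)"
  using run_inf_le_ginf[of t n] ginf_less_iff[of t n "ginf n f t"] by fastforce

lemma entry_bdd: "bdd_below {s. 0 \<le> s \<and> f s \<in> P}"
  by (intro bdd_belowI[of _ 0]) auto

context
  fixes P :: "real set" and s0 :: real
  assumes P: "open P" and s0: "0 \<le> s0" "f s0 \<in> P"
begin

lemma entry_time_nonneg: "0 \<le> entry_time P f"
  unfolding entry_time_def using s0 by (intro cInf_greatest) auto

lemma entry_time_before: "0 \<le> s \<Longrightarrow> s < entry_time P f \<Longrightarrow> f s \<notin> P"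
  unfolding entry_time_def using cInf_lower[OF _ entry_bdd, of s P] by force

lemma entry_time_grid_ge: "f (dy n k) \<in> P \<Longrightarrow> entry_time P f \<le> dy n k"
  using entry_time_before[of "dy n k"] by force

text \<open>Since \<open>P\<close> is open and the path right continuous, a visit to
  \<open>P\<close> lasts for an interval to the right, and a fine grid meets this interval.\<close>

lemma entry_time_grid_below:
  assumes "entry_time P f < u"
  shows "\<forall>\<^sub>F n in sequentially. \<exists>k. f (dy n k) \<in> P \<and> dy n k < u"
proof -
  obtain s where s: "0 \<le> s" "f s \<in> P" "s < u"
    using assms s0 cInf_lessD[of "{s. 0 \<le> s \<and> f s \<in> P}" u] unfolding entry_time_def by auto
  have "\<forall>\<^sub>F y in at_right s. f y \<in> P" using rc[OF s(1)] P s(2) by (rule topological_tendstoD)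
  then obtain b where b: "b > s" "\<And>y. s < y \<Longrightarrow> y < b \<Longrightarrow> f y \<in> P"
    by (auto simp: eventually_at_right_field)
  have "\<forall>\<^sub>F n in sequentially. \<exists>k. s < dy n k \<and> dy n k < min b u"
    using s b by (intro dyadic_between) auto
  then show ?thesis by eventually_elim (use b in auto)
qed

lemma entry_grid_ex: "\<forall>\<^sub>F n in sequentially. \<exists>k. f (dy n k) \<in> P"
  using entry_time_grid_below[of "entry_time P f + 1"] by (auto elim: eventually_mono)

lemma entry_grid_tendsto: "(\<lambda>n. dy n (LEAST k. f (dy n k) \<in> P)) \<longlonglongrightarrow> entry_time P f"
proof (rule order_tendstoI)
  fix a assume a: "a < entry_time P f"
  show "\<forall>\<^sub>F n in sequentially. a < dy n (LEAST k. f (dy n k) \<in> P)"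
    using entry_grid_ex
  proof eventually_elim
    case (elim n)
    then have "f (dy n (LEAST k. f (dy n k) \<in> P)) \<in> P" by (rule LeastI_ex)
    then show ?case using entry_time_grid_ge a by fastforce
  qed
next
  fix a assume "entry_time P f < a"
  from entry_time_grid_below[OF this] show "\<forall>\<^sub>F n in sequentially. dy n (LEAST k. f (dy n k) \<in> P) < a"
  proof eventually_elim
    case (elim n)
    then obtain k where k: "f (dy n k) \<in> P" "dy n k < a" by blast
    then have "(LEAST k. f (dy n k) \<in> P) \<le> k" by (intro Least_le)
    then have "dy n (LEAST k. f (dy n k) \<in> P) \<le> dy n k" by (simp add: dy_def divide_right_mono)
    then show ?case using k by simp
  qed
qed

text \<open>Grid entries never precede the true entry. They therefore approach it from the right or
  coincide with it, and right continuity carries the values along.\<close>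

lemma entry_grid_value_tendsto:
  "(\<lambda>n. f (dy n (LEAST k. f (dy n k) \<in> P))) \<longlonglongrightarrow> f (entry_time P f)"
proof (rule topological_tendstoI)
  fix S assume S: "open S" "f (entry_time P f) \<in> S"
  have "\<forall>\<^sub>F y in at_right (entry_time P f). f y \<in> S"
    using rc[OF entry_time_nonneg] S by (rule topological_tendstoD)
  then obtain b where b: "b > entry_time P f" "\<And>y. entry_time P f < y \<Longrightarrow> y < b \<Longrightarrow> f y \<in> S"
    by (auto simp: eventually_at_right_field)
  have "\<forall>\<^sub>F n in sequentially. dy n (LEAST k. f (dy n k) \<in> P) < b"
    using entry_grid_tendsto b(1) by (rule order_tendstoD)
  then show "\<forall>\<^sub>F n in sequentially. f (dy n (LEAST k. f (dy n k) \<in> P)) \<in> S"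
    using entry_grid_ex
  proof eventually_elim
    case (elim n)
    from elim(2) have "f (dy n (LEAST k. f (dy n k) \<in> P)) \<in> P" by (rule LeastI_ex)
    then have le: "entry_time P f \<le> dy n (LEAST k. f (dy n k) \<in> P)" by (rule entry_time_grid_ge)
    show ?case
    proof (cases "entry_time P f = dy n (LEAST k. f (dy n k) \<in> P)")
      case True
      show ?thesis using S(2) unfolding True .
    next
      case False
      with le have "entry_time P f < dy n (LEAST k. f (dy n k) \<in> P)" by simp
      from b(2)[OF this elim(1)] show ?thesis .
    qed
  qed
qed

end

text \<open>A level is crossed upwards continuously. The values at grid entries exceed x, so their
  limit is at least x; before the entry the path is at most x, hence so is its left limit, which the
  path cannot jump above.\<close>

lemma entry_time_above_value:
  assumes x: "0 \<le> x" and s: "0 \<le> s" "x < f s"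
  shows "f (entry_time {x<..} f) = x"
proof (rule antisym)
  let ?T = "entry_time {x<..} f"
  have s': "f s \<in> {x<..}" using s by simp
  note T0 = entry_time_nonneg[OF open_greaterThan s(1) s']
    and before = entry_time_before[OF open_greaterThan s(1) s']
  show "x \<le> f ?T"
  proof (rule tendsto_lowerbound)
    show "(\<lambda>n. f (dy n (LEAST k. f (dy n k) \<in> {x<..}))) \<longlonglongrightarrow> f ?T"
      by (rule entry_grid_value_tendsto[OF open_greaterThan s(1) s'])
    show "\<forall>\<^sub>F n in sequentially. x \<le> f (dy n (LEAST k. f (dy n k) \<in> {x<..}))"
      using entry_grid_ex[OF open_greaterThan s(1) s']
    proof eventually_elim
      case (elim n)
      then have "f (dy n (LEAST k. f (dy n k) \<in> {x<..})) \<in> {x<..}" by (rule LeastI_ex)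
      then show ?case by simp
    qed
  qed simp
  show "f ?T \<le> x"
  proof (cases "?T = 0")
    case True then show ?thesis using f0 x by simp
  next
    case False
    then have pos: "0 < ?T" using T0 by simp
    then obtain l where l: "(f \<longlongrightarrow> l) (at_left ?T)" "f ?T \<le> l" using ll by blast
    have "\<forall>\<^sub>F y in at_left ?T. 0 < y \<and> y < ?T"
      using pos by (auto simp: eventually_at_left_field)
    then have "\<forall>\<^sub>F y in at_left ?T. f y \<le> x"
      by eventually_elim (metis before greaterThan_iff less_imp_le not_less)
    then have "l \<le> x" by (rule tendsto_upperbound[OF l(1)]) simp
    then show ?thesis using l(2) by simp
  qed
qed

end

section \<open>Discounted sums over the first grid hit and their limits\<close>

lemma suminf_first_index:
  fixes c :: "nat \<Rightarrow> ennreal"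
  shows "(\<Sum>i. of_bool (P i \<and> (\<forall>j<i. \<not> P j)) * c i) = (if \<exists>j. P j then c (LEAST j. P j) else 0)"
proof (cases "\<exists>j. P j")
  case True
  then obtain j where j: "P j" by blast
  have "(\<lambda>i. of_bool (P i \<and> (\<forall>j<i. \<not> P j)) * c i) sums (\<Sum>i\<le>j. of_bool (P i \<and> (\<forall>j<i. \<not> P j)) * c i)"
  proof (rule sums_finite)
    fix i assume "i \<notin> {..j}"
    then have "j < i" by simp
    then have "\<not> (P i \<and> (\<forall>j<i. \<not> P j))" using j by blast
    then show "of_bool (P i \<and> (\<forall>j<i. \<not> P j)) * c i = 0" by (simp only: of_bool_eq mult_zero_left)
  qed simp
  then show ?thesis using sum_first_index[of P c j] j by (auto simp: sums_iff)
qed simp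

context snpath
begin

lemma suminf_hitup:
  "(\<Sum>k. of_bool (hitup x (incr n f) k) * c k)
    = (if \<exists>k. f (dy n k) \<in> {x<..} then c (LEAST k. f (dy n k) \<in> {x<..}) else (0::ennreal))"
  using suminf_first_index[of "\<lambda>k. f (dy n k) \<in> {x<..}" c]
  by (simp add: hitup_def psum_incr not_less)

lemma suminf_hitdn:
  "(\<Sum>k. of_bool (hitdn x (incr n f) k) * c k)
    = (if \<exists>k. f (dy n k) \<in> {..<x} then c (LEAST k. f (dy n k) \<in> {..<x}) else (0::ennreal))"
  using suminf_first_index[of "\<lambda>k. f (dy n k) \<in> {..<x}" c]
  by (simp add: hitdn_def psum_incr not_less)

text \<open>Only the term at the grid passage survives in the sum, and its position tends to x
  because levels are crossed upwards continuously.\<close>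

lemma hitup_overshoot_tendsto:
  assumes x: "0 \<le> x"
  shows "(\<lambda>n. \<Sum>k. of_bool (hitup x (incr n f) k) * ennreal (exp (- q * dy n k) * (exp (\<beta> * f (dy n k)) - exp (\<beta> * x)))) \<longlonglongrightarrow> 0"
proof (cases "\<exists>s\<ge>0. x < f s")
  case True
  then obtain s where s: "0 \<le> s" "f s \<in> {x<..}" by auto
  define K where "K n = (LEAST k. f (dy n k) \<in> {x<..})" for n
  have "(\<lambda>n. exp (- q * dy n (K n)) * (exp (\<beta> * f (dy n (K n))) - exp (\<beta> * x)))
    \<longlonglongrightarrow> exp (- q * entry_time {x<..} f) * (exp (\<beta> * f (entry_time {x<..} f)) - exp (\<beta> * x))"
    unfolding K_def
    by (intro tendsto_intros entry_grid_tendsto[OF open_greaterThan s] entry_grid_value_tendsto[OF open_greaterThan s])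
  also have "f (entry_time {x<..} f) = x" using entry_time_above_value[OF x s(1)] s(2) by simp
  finally have "(\<lambda>n. ennreal (exp (- q * dy n (K n)) * (exp (\<beta> * f (dy n (K n))) - exp (\<beta> * x)))) \<longlonglongrightarrow> 0"
    by (auto dest: tendsto_ennrealI)
  moreover have "\<forall>\<^sub>F n in sequentially. ennreal (exp (- q * dy n (K n)) * (exp (\<beta> * f (dy n (K n))) - exp (\<beta> * x)))
     = (\<Sum>k. of_bool (hitup x (incr n f) k) * ennreal (exp (- q * dy n k) * (exp (\<beta> * f (dy n k)) - exp (\<beta> * x))))"
    using entry_grid_ex[OF open_greaterThan s]
    by eventually_elim (simp only: suminf_hitup K_def if_True)
  ultimately show ?thesis by (rule Lim_transform_eventually)
next
  case False
  then have "\<not> (\<exists>k. f (dy n k) \<in> {x<..})" for n by auto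
  then show ?thesis by (simp only: suminf_hitup if_False tendsto_const)
qed

text \<open>Downwards the position at entry may lie strictly below x, so it stays in the limit. On a
  path that never goes below x all terms are 0, which the indicator records.\<close>

lemma hitdn_tendsto:
  "(\<lambda>n. \<Sum>k. of_bool (hitdn x (incr n f) k) * ennreal (exp (- q * dy n k) * exp (\<beta> * f (dy n k))))
    \<longlonglongrightarrow> of_bool (\<exists>s\<ge>0. f s < x) * ennreal (exp (- q * entry_time {..<x} f) * exp (\<beta> * f (entry_time {..<x} f)))"
proof (cases "\<exists>s\<ge>0. f s < x")
  case True
  then obtain s where s: "0 \<le> s" "f s \<in> {..<x}" by auto
  define K where "K n = (LEAST k. f (dy n k) \<in> {..<x})" for n
  have "(\<lambda>n. ennreal (exp (- q * dy n (K n)) * exp (\<beta> * f (dy n (K n)))))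
    \<longlonglongrightarrow> ennreal (exp (- q * entry_time {..<x} f) * exp (\<beta> * f (entry_time {..<x} f)))"
    unfolding K_def
    by (intro tendsto_ennrealI tendsto_intros entry_grid_tendsto[OF open_lessThan s] entry_grid_value_tendsto[OF open_lessThan s])
  moreover have "\<forall>\<^sub>F n in sequentially. ennreal (exp (- q * dy n (K n)) * exp (\<beta> * f (dy n (K n))))
     = (\<Sum>k. of_bool (hitdn x (incr n f) k) * ennreal (exp (- q * dy n k) * exp (\<beta> * f (dy n k))))"
    using entry_grid_ex[OF open_lessThan s]
    by eventually_elim (simp only: suminf_hitdn K_def if_True)
  ultimately have "(\<lambda>n. \<Sum>k. of_bool (hitdn x (incr n f) k) * ennreal (exp (- q * dy n k) * exp (\<beta> * f (dy n k))))
    \<longlonglongrightarrow> ennreal (exp (- q * entry_time {..<x} f) * exp (\<beta> * f (entry_time {..<x} f)))"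
    by (rule Lim_transform_eventually)
  with True show ?thesis by (simp only: of_bool_eq mult_1_left simp_thms)
next
  case False
  then have "\<not> (\<exists>k. f (dy n k) \<in> {..<x})" for n by auto
  with False show ?thesis by (simp only: suminf_hitdn if_False of_bool_eq mult_zero_left tendsto_const)
qed

end

text \<open>Extends the grid limits to negative arguments, so that integration over an exponential
  time, whose law lives on the whole real line, needs no sign condition.\<close>

lemma kap_max: "kap n (max 0 t) = kap n t"
proof (cases "0 \<le> t")
  case False
  then have "t * 2 ^ n \<le> 0" by (intro mult_nonpos_nonneg) auto
  then have "\<lfloor>t * 2 ^ n\<rfloor> \<le> 0" by linarith
  then show ?thesis using False by (simp add: kap_def)
qed simp

lemma gsup_max: "gsup n f (max 0 t) = gsup n f t" by (simp add: gsup_def kap_max)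
lemma ginf_max: "ginf n f (max 0 t) = ginf n f t" by (simp add: ginf_def kap_max)
lemma run_sup_max: "run_sup f (max 0 t) = run_sup f t" by (simp add: run_sup_def gsup_max)
lemma run_inf_max: "run_inf f (max 0 t) = run_inf f t" by (simp add: run_inf_def ginf_max)

lemma ginf_nonpos: "ginf n f t \<le> 0" by (simp add: ginf_def pmin_nonpos)

lemma (in snpath) gsup_tendsto': "(\<lambda>n. gsup n f t) \<longlonglongrightarrow> run_sup f t"
  using gsup_tendsto[of "max 0 t"] by (simp only: gsup_max run_sup_max max.cobounded1 simp_thms)

lemma (in snpath) ginf_tendsto': "(\<lambda>n. ginf n f t) \<longlonglongrightarrow> run_inf f t"
  using ginf_tendsto[of "max 0 t"] by (simp only: ginf_max run_inf_max max.cobounded1 simp_thms)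

lemma (in snpath) gsup_le_run_sup': "gsup n f t \<le> run_sup f t"
  using gsup_le_run_sup[of "max 0 t" n] by (simp only: gsup_max run_sup_max max.cobounded1 simp_thms)

lemma (in snpath) run_inf_le_ginf': "run_inf f t \<le> ginf n f t"
  using run_inf_le_ginf[of "max 0 t" n] by (simp only: ginf_max run_inf_max max.cobounded1 simp_thms)

lemma measurable_kap[measurable]: "kap n \<in> measurable borel (count_space UNIV)"
  unfolding kap_def by measurable

section \<open>Convergence of integrals on a probability space\<close>

lemma nn_integral_convergence:
  fixes u :: "nat \<Rightarrow> 'a \<Rightarrow> ennreal"
  assumes "prob_space N" and [measurable]: "\<And>i. u i \<in> borel_measurable N"
    and lim: "\<And>x. x \<in> space N \<Longrightarrow> (\<lambda>i. u i x) \<longlonglongrightarrow> u' x"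
    and bound: "\<And>i x. x \<in> space N \<Longrightarrow> u i x \<le> ennreal B"
  shows "(\<lambda>i. \<integral>\<^sup>+x. u i x \<partial>N) \<longlonglongrightarrow> (\<integral>\<^sup>+x. u' x \<partial>N)" "u' \<in> borel_measurable N"
proof -
  interpret prob_space N by fact
  show m[measurable]: "u' \<in> borel_measurable N"
    using assms(2) lim by (rule borel_measurable_LIMSEQ_order[rotated])
  have w: "(\<integral>\<^sup>+x. ennreal B \<partial>N) < \<infinity>" by (simp add: emeasure_space_1)
  show "(\<lambda>i. \<integral>\<^sup>+x. u i x \<partial>N) \<longlonglongrightarrow> (\<integral>\<^sup>+x. u' x \<partial>N)"
    by (rule nn_integral_dominated_convergence[OF assms(2) m _ _ w]) (auto simp: bound lim)
qed

text \<open>A uniform second moment gives uniform integrability: v is at most min v c + v * v / c,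
  where the first part converges boundedly and the second integrates to at most C / c.\<close>

lemma nn_integral_tendsto_zero_square_bounded:
  fixes V :: "nat \<Rightarrow> 'a \<Rightarrow> ennreal"
  assumes N: "prob_space N" and V[measurable]: "\<And>i. V i \<in> borel_measurable N"
    and lim: "\<And>x. x \<in> space N \<Longrightarrow> (\<lambda>i. V i x) \<longlonglongrightarrow> 0"
    and C: "\<And>i. (\<integral>\<^sup>+x. V i x * V i x \<partial>N) \<le> ennreal C"
  shows "(\<lambda>i. \<integral>\<^sup>+x. V i x \<partial>N) \<longlonglongrightarrow> 0"
proof -
  have split: "v \<le> min v (ennreal c) + ennreal (1 / c) * (v * v)" if "0 < c" for v :: ennreal and c :: real
  proof (cases "v \<le> ennreal c")
    case True then show ?thesis by (simp add: min_absorb1)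
  next
    case False
    have "v = ennreal (1 / c) * (ennreal c * v)"
      using that by (simp add: mult.assoc[symmetric] ennreal_mult[symmetric])
    also have "\<dots> \<le> ennreal (1 / c) * (v * v)"
      using False by (intro mult_mono) auto
    finally show ?thesis by (simp add: add_increasing)
  qed
  have m0: "(\<lambda>i. \<integral>\<^sup>+x. min (V i x) (ennreal c) \<partial>N) \<longlonglongrightarrow> 0" if "0 < c" for c
  proof -
    have "(\<lambda>i. \<integral>\<^sup>+x. min (V i x) (ennreal c) \<partial>N) \<longlonglongrightarrow> (\<integral>\<^sup>+x. min 0 (ennreal c) \<partial>N)"
    proof (rule nn_integral_convergence[OF N, where B = c])
      show "(\<lambda>i. min (V i x) (ennreal c)) \<longlonglongrightarrow> min 0 (ennreal c)" if "x \<in> space N" for x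
        by (intro tendsto_min lim that tendsto_const)
    qed simp_all
    then show ?thesis by simp
  qed
  show ?thesis
  proof (rule order_tendstoI)
    fix a :: ennreal assume a: "0 < a"
    \<comment> \<open>A positive real number below \<open>a\<close>, which may be infinite.\<close>
    define b where "b = enn2real (min a 1)"
    have b: "0 < b" "ennreal b \<le> a" using a
      by (auto simp: b_def enn2real_positive_iff min_def ennreal_enn2real_if less_top[symmetric] top_unique)
    \<comment> \<open>Makes C / c at most b / 2; the form of the numerator keeps \<open>c\<close>
      positive for every \<open>C\<close>.\<close>
    define c where "c = 2 * (\<bar>C\<bar> + 1) / b"
    have c: "0 < c" using b by (simp add: c_def)
    have "1 / c * C \<le> b / 2"
    proof -
      have "1 / c * C = b * C / (2 * (\<bar>C\<bar> + 1))" by (simp add: c_def)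
      also have "\<dots> \<le> b / 2"
      proof (subst pos_divide_le_eq)
        have "b * C \<le> b * (\<bar>C\<bar> + 1)" using b by (intro mult_left_mono) auto
        then show "b * C \<le> b / 2 * (2 * (\<bar>C\<bar> + 1))" by (simp add: algebra_simps)
      qed simp
      finally show ?thesis .
    qed
    have "\<forall>\<^sub>F i in sequentially. (\<integral>\<^sup>+x. min (V i x) (ennreal c) \<partial>N) < ennreal (b / 2)"
      using m0[OF c] b by (intro order_tendstoD) auto
    then show "\<forall>\<^sub>F i in sequentially. (\<integral>\<^sup>+x. V i x \<partial>N) < a"
    proof eventually_elim
      case (elim i)
      have "(\<integral>\<^sup>+x. V i x \<partial>N) \<le> (\<integral>\<^sup>+x. min (V i x) (ennreal c) + ennreal (1 / c) * (V i x * V i x) \<partial>N)"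
        by (intro nn_integral_mono split c)
      also have "\<dots> = (\<integral>\<^sup>+x. min (V i x) (ennreal c) \<partial>N) + ennreal (1 / c) * (\<integral>\<^sup>+x. V i x * V i x \<partial>N)"
        by (subst nn_integral_add) (auto simp: nn_integral_cmult)
      also have "\<dots> \<le> (\<integral>\<^sup>+x. min (V i x) (ennreal c) \<partial>N) + ennreal (1 / c) * ennreal C"
        by (intro add_left_mono mult_left_mono C) simp
      also have "\<dots> \<le> (\<integral>\<^sup>+x. min (V i x) (ennreal c) \<partial>N) + ennreal (b / 2)"
        using \<open>1 / c * C \<le> b / 2\<close> c by (intro add_left_mono) (simp add: ennreal_mult'[symmetric] ennreal_leI)
      also have "\<dots> < ennreal (b / 2) + ennreal (b / 2)"
        using elim ennreal_add_left_cancel_less[of "ennreal (b / 2)" "\<integral>\<^sup>+x. min (V i x) (ennreal c) \<partial>N" "ennreal (b / 2)"]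
        by (simp add: add.commute)
      also have "\<dots> = ennreal b" using b by (simp flip: ennreal_plus)
      also have "\<dots> \<le> a" by fact
      finally show ?case .
    qed
  qed simp
qed

section \<open>Extrema at an exponential time\<close>

text \<open>\<open>walk\<close> condenses independence and stationarity of the increments into one
  equation of laws for each dyadic grid, the form in which the random walk results apply. That Y
  starts at 0 is part of \<open>snpath\<close>.\<close>

locale snl = prob_space M for M :: "'a measure" +
  fixes Y :: "real \<Rightarrow> 'a \<Rightarrow> real" and \<psi> :: "real \<Rightarrow> real" and q :: real
  assumes Ym: "\<And>t. 0 \<le> t \<Longrightarrow> Y t \<in> borel_measurable M"
    and path: "\<And>\<omega>. \<omega> \<in> space M \<Longrightarrow> snpath (\<lambda>t. Y t \<omega>)"
    and walk: "\<And>n. distr M (\<Pi>\<^sub>M i\<in>(UNIV::nat set). borel) (\<lambda>\<omega>. incr n (\<lambda>t. Y t \<omega>))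
       = (\<Pi>\<^sub>M i\<in>(UNIV::nat set). distr M borel (Y (dy n 1)))"
    and mgf: "\<And>\<beta> t. 0 \<le> \<beta> \<Longrightarrow> 0 \<le> t \<Longrightarrow> (\<integral>\<^sup>+\<omega>. eexp (\<beta> * Y t \<omega>) \<partial>M) = eexp (t * \<psi> \<beta>)"
    and q: "0 < q"
begin

text \<open>\<open>SB\<close> serves for measurability on sequences; the laws \<open>SS n\<close> of
  the increments on the n-th grid live on the same sets.\<close>

abbreviation "SB \<equiv> (\<Pi>\<^sub>M i\<in>(UNIV::nat set). (borel::real measure))"
abbreviation "D n \<equiv> distr M borel (Y (dy n 1))"
abbreviation "SS n \<equiv> (\<Pi>\<^sub>M i\<in>(UNIV::nat set). D n)"
abbreviation yp :: "'a \<Rightarrow> real \<Rightarrow> real" where "yp \<omega> \<equiv> (\<lambda>t. Y t \<omega>)"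
abbreviation "GS n p \<equiv> gsup n (yp (snd p)) (fst p)"
abbreviation "GI n p \<equiv> ginf n (yp (snd p)) (fst p)"
abbreviation "LS p \<equiv> run_sup (yp (snd p)) (fst p)"
abbreviation "LI p \<equiv> run_inf (yp (snd p)) (fst p)"

text \<open>The probability that the exponential time outlasts one step of the n-th grid.\<close>

definition "r n = exp (- q / 2 ^ n)"
text \<open>\<open>MM\<close> adjoins the independent exponential time as first component.\<close>

definition "TX = density lborel (\<lambda>t. ennreal (exponential_density q t))"
definition "MM = TX \<Otimes>\<^sub>M M"

lemma r: "0 < r n" "r n < 1" using q by (auto simp: r_def)

lemma rw: "random_walk (D n)"
proof -
  interpret D: prob_space "D n" by (rule prob_space_distr) (simp add: Ym)
  show ?thesis by unfold_locales simp
qed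

interpretation R: random_walk "D n" for n by (rule rw)

lemma borel_SS: "borel_measurable (SS n) = borel_measurable SB"
  by (intro measurable_cong_sets sets_PiM_cong) auto

lemma sets_TX[measurable_cong, simp]: "sets TX = sets borel" by (simp add: TX_def)
lemma space_TX[simp]: "space TX = UNIV" by (simp add: TX_def)

lemma prob_TX: "prob_space TX" unfolding TX_def using q by (rule prob_space_exponential_density)

lemma prob_MM: "prob_space MM"
proof -
  interpret TX: prob_space TX by (rule prob_TX)
  interpret pair_prob_space TX M ..
  show ?thesis unfolding MM_def by unfold_locales
qed

lemma space_MM: "space MM = UNIV \<times> space M" by (simp add: MM_def space_pair_measure)

lemma snd_space: "p \<in> space MM \<Longrightarrow> snd p \<in> space M" by (auto simp: space_MM)

lemma measurable_incr: "(\<lambda>\<omega>. incr n (yp \<omega>)) \<in> measurable M SB"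
  by (rule measurable_PiM_single') (auto simp: incr_def intro!: borel_measurable_diff Ym)

lemma measurable_MM:
  assumes "\<And>k. \<phi> k \<in> borel_measurable SB"
  shows "(\<lambda>p. \<phi> (kap n (fst p)) (incr n (yp (snd p)))) \<in> borel_measurable MM"
proof (rule measurable_compose_countable[of "\<lambda>k p. \<phi> k (incr n (yp (snd p)))" MM borel "\<lambda>p. kap n (fst p)"])
  show "(\<lambda>p. \<phi> k (incr n (yp (snd p)))) \<in> borel_measurable MM" for k
    unfolding MM_def
    by (rule measurable_compose[OF measurable_snd measurable_compose[OF measurable_incr assms]])
  show "(\<lambda>p. kap n (fst p)) \<in> measurable MM (count_space UNIV)"
    unfolding MM_def by (rule measurable_compose[OF measurable_fst]) (simp add: measurable_kap measurable_cong_sets[OF sets_TX refl])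
qed

lemma nn_walk:
  assumes "\<phi> \<in> borel_measurable SB"
  shows "(\<integral>\<^sup>+\<omega>. \<phi> (incr n (yp \<omega>)) \<partial>M) = (\<integral>\<^sup>+v. \<phi> v \<partial>SS n)"
  unfolding walk[symmetric] using assms measurable_incr by (subst nn_integral_distr) auto

text \<open>The exponential tail at \<open>dy n k\<close> is \<open>r n ^ k\<close>, so the number
  of completed steps is geometric. Grid points are null, which allows the change from one kind of
  half-open interval to the other.\<close>

lemma emeasure_kap: "emeasure TX {t. kap n t = k} = ennreal ((1 - r n) * r n ^ k)"
proof -
  interpret TX: prob_space TX by (rule prob_TX)
  have dist: "distributed TX lborel (\<lambda>t. t) (exponential_density q)"
    unfolding distributed_def TX_def using exponential_density_nonneg[OF q] by (auto simp: distr_id2)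
  have gt: "measure TX {a<..} = exp (- a * q)" if "0 \<le> a" for a
    using TX.exponential_distributedD_gt[OF dist that q] by (simp add: greaterThan_def)
  have "measure TX {dy n k<..dy n (Suc k)} = measure TX {dy n k<..} - measure TX {dy n (Suc k)<..}"
    by (subst TX.finite_measure_Diff[symmetric]) (auto intro!: arg_cong[where f = "measure TX"] simp: dy_def divide_right_mono)
  also have "\<dots> = (1 - r n) * r n ^ k"
  proof -
    have "exp (- dy n (Suc k) * q) = r n * exp (- dy n k * q)"
      by (simp add: r_def dy_def exp_add[symmetric] add_divide_distrib algebra_simps)
    moreover have "exp (- dy n k * q) = r n ^ k"
      by (simp add: r_def dy_def exp_of_nat_mult[symmetric] algebra_simps)
    ultimately show ?thesis by (simp add: gt algebra_simps)
  qed
  finally have *: "emeasure TX {dy n k<..dy n (Suc k)} = ennreal ((1 - r n) * r n ^ k)"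
    by (simp add: TX.emeasure_eq_measure)
  have "emeasure TX {t. kap n t = k} = emeasure TX {dy n k<..dy n (Suc k)}"
  proof (rule emeasure_eq_AE)
    have "AE t in lborel. t \<noteq> dy n k \<and> t \<noteq> dy n (Suc k)"
      using AE_lborel_singleton[of "dy n k"] AE_lborel_singleton[of "dy n (Suc k)"] by auto
    then show "AE t in TX. (t \<in> {t. kap n t = k}) = (t \<in> {dy n k<..dy n (Suc k)})"
      unfolding TX_def
    proof (subst AE_density)
      show "AE t in lborel. t \<noteq> dy n k \<and> t \<noteq> dy n (Suc k) \<Longrightarrow>
        AE t in lborel. 0 < ennreal (exponential_density q t) \<longrightarrow> (t \<in> {t. kap n t = k}) = (t \<in> {dy n k<..dy n (Suc k)})"
      proof (erule eventually_mono, intro impI)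
        fix t assume t: "t \<noteq> dy n k \<and> t \<noteq> dy n (Suc k)" and "0 < ennreal (exponential_density q t)"
        then have t0: "0 \<le> t" by (auto simp: exponential_density_def split: if_splits)
        have "kap n t = k \<longleftrightarrow> k \<le> kap n t \<and> \<not> Suc k \<le> kap n t" by auto
        then show "(t \<in> {t. kap n t = k}) = (t \<in> {dy n k<..dy n (Suc k)})"
          unfolding le_kap_iff[OF t0] using t by auto
      qed
    qed simp
  qed (use measurable_sets[OF measurable_kap, of "{k}" n] in \<open>simp_all add: vimage_def\<close>)
  then show ?thesis using * by simp
qed

text \<open>The integrand depends on the independent time only through the number of completed
  steps, so by Fubini the expectation is a geometric mixture of expectations over the walk.\<close>

lemma nn_transfer:
  assumes \<phi>: "\<And>k. \<phi> k \<in> borel_measurable SB"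
  shows "(\<integral>\<^sup>+p. \<phi> (kap n (fst p)) (incr n (yp (snd p))) \<partial>MM)
    = ennreal (1 - r n) * (\<Sum>k. ennreal (r n) ^ k * (\<integral>\<^sup>+v. \<phi> k v \<partial>SS n))"
proof -
  define G where "G k = (\<integral>\<^sup>+v. \<phi> k v \<partial>SS n)" for k
  have "(\<integral>\<^sup>+p. \<phi> (kap n (fst p)) (incr n (yp (snd p))) \<partial>MM)
     = (\<integral>\<^sup>+t. \<integral>\<^sup>+\<omega>. \<phi> (kap n t) (incr n (yp \<omega>)) \<partial>M \<partial>TX)"
    using measurable_MM[of \<phi> n, OF \<phi>] unfolding MM_def by (subst nn_integral_fst[symmetric]) simp_all
  also have "\<dots> = (\<integral>\<^sup>+t. G (kap n t) \<partial>TX)"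
    using \<phi> by (intro nn_integral_cong) (simp add: nn_walk G_def)
  also have "\<dots> = (\<integral>\<^sup>+t. (\<Sum>k. G k * indicator {t. kap n t = k} t) \<partial>TX)"
  proof (intro nn_integral_cong)
    fix t
    have "(\<lambda>k. if k = kap n t then G k else 0) sums G (kap n t)" by (rule sums_single)
    moreover have "(\<lambda>k. if k = kap n t then G k else 0) = (\<lambda>k. G k * indicator {t. kap n t = k} t)"
      by (auto simp: indicator_def)
    ultimately show "G (kap n t) = (\<Sum>k. G k * indicator {t. kap n t = k} t)" by (simp add: sums_iff)
  qed
  also have "\<dots> = (\<Sum>k. G k * emeasure TX {t. kap n t = k})"
  proof -
    have [measurable]: "{t. kap n t = k} \<in> sets TX" for k
      using measurable_sets[OF measurable_kap, of "{k}" n] by (simp add: vimage_def)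
    show ?thesis by (subst nn_integral_suminf) (auto simp: nn_integral_cmult_indicator)
  qed
  also have "\<dots> = (\<Sum>k. ennreal (1 - r n) * (ennreal (r n) ^ k * G k))"
    using r[of n] by (simp add: emeasure_kap ennreal_mult ennreal_power mult_ac)
  finally show ?thesis by (simp add: G_def)
qed

lemma gs_meas[measurable]: "(\<lambda>p. GS n p) \<in> borel_measurable MM"
  unfolding gsup_def using measurable_MM[of "\<lambda>k v. pmax v k" n] R.measurable_pmax[of _ n]
  by (simp add: borel_SS)

lemma gi_meas[measurable]: "(\<lambda>p. GI n p) \<in> borel_measurable MM"
  unfolding ginf_def using measurable_MM[of "\<lambda>k v. pmin v k" n] R.measurable_pmin[of _ n]
  by (simp add: borel_SS)

definition "gend n p = psum (incr n (yp (snd p))) (kap n (fst p))"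

lemma ge_meas[measurable]: "gend n \<in> borel_measurable MM"
  unfolding gend_def using measurable_MM[of "\<lambda>k v. psum v k" n] R.measurable_psum[of _ n]
  by (simp add: borel_SS)

lemma rs_meas[measurable]: "(\<lambda>p. LS p) \<in> borel_measurable MM"
  by (rule borel_measurable_LIMSEQ_real[OF snpath.gsup_tendsto'[OF path[OF snd_space]] gs_meas])

lemma ri_meas[measurable]: "(\<lambda>p. LI p) \<in> borel_measurable MM"
  by (rule borel_measurable_LIMSEQ_real[OF snpath.ginf_tendsto'[OF path[OF snd_space]] gi_meas])

definition "grid_inf_lt n \<beta> = (\<integral>\<^sup>+p. eexp (\<beta> * GI n p) \<partial>MM)"
definition "inf_lt \<beta> = (\<integral>\<^sup>+p. eexp (\<beta> * LI p) \<partial>MM)"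

text \<open>Duality of the walk for each fixed number of steps, mixed over the geometric number of
  steps.\<close>

lemma dual: "(\<integral>\<^sup>+p. eexp (- \<beta> * (GS n p - gend n p)) \<partial>MM) = grid_inf_lt n \<beta>"
proof -
  have [measurable]: "(\<lambda>v. pmax v k - psum v k) \<in> borel_measurable SB" "(\<lambda>v. pmin v k) \<in> borel_measurable SB" for k
    using R.measurable_pmax[of k n] R.measurable_psum[of k n] R.measurable_pmin[of k n]
    by (simp_all add: borel_SS)
  have "(\<integral>\<^sup>+p. eexp (- \<beta> * (GS n p - gend n p)) \<partial>MM)
    = ennreal (1 - r n) * (\<Sum>k. ennreal (r n) ^ k * (\<integral>\<^sup>+v. eexp (- \<beta> * (pmax v k - psum v k)) \<partial>SS n))"
    unfolding gsup_def gend_def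
    by (rule nn_transfer[of "\<lambda>k v. eexp (- \<beta> * (pmax v k - psum v k))"]) measurable
  also have "\<dots> = ennreal (1 - r n) * (\<Sum>k. ennreal (r n) ^ k * (\<integral>\<^sup>+v. eexp (\<beta> * pmin v k) \<partial>SS n))"
    using R.duality[of "\<lambda>z. eexp (- \<beta> * z)" n] by simp
  also have "\<dots> = grid_inf_lt n \<beta>"
    unfolding grid_inf_lt_def ginf_def
    by (rule nn_transfer[of "\<lambda>k v. eexp (\<beta> * pmin v k)", symmetric]) measurable
  finally show ?thesis .
qed

lemma grid_inf_lt_0: "grid_inf_lt n 0 = 1"
  using prob_space.emeasure_space_1[OF prob_MM] by (simp add: grid_inf_lt_def)

definition "hup n x = (\<Sum>k. ennreal (r n) ^ k * (\<integral>\<^sup>+v. of_bool (hitup x v k) \<partial>SS n))"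

lemma up_factor: "(\<integral>\<^sup>+p. of_bool (x < GS n p) * eexp (- \<beta> * (GS n p - gend n p)) \<partial>MM)
   = hup n x * grid_inf_lt n \<beta>"
proof -
  have [measurable]: "(\<lambda>v. pmax v k) \<in> borel_measurable SB" "(\<lambda>v. psum v k) \<in> borel_measurable SB" for k
    using R.measurable_pmax[of k n] R.measurable_psum[of k n] by (simp_all add: borel_SS)
  have "(\<integral>\<^sup>+p. of_bool (x < GS n p) * eexp (- \<beta> * (GS n p - gend n p)) \<partial>MM)
    = ennreal (1 - r n) * (\<Sum>k. ennreal (r n) ^ k * (\<integral>\<^sup>+v. of_bool (x < pmax v k) * eexp (- \<beta> * (pmax v k - psum v k)) \<partial>SS n))"
    unfolding gsup_def gend_def
    by (rule nn_transfer[of "\<lambda>k v. of_bool (x < pmax v k) * eexp (- \<beta> * (pmax v k - psum v k))"]) measurable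
  also have "\<dots> = hup n x * (ennreal (1 - r n) * (\<Sum>k. ennreal (r n) ^ k * (\<integral>\<^sup>+v. eexp (- \<beta> * (pmax v k - psum v k)) \<partial>SS n)))"
    unfolding R.up_factorization hup_def by (simp only: mult_ac)
  also have "ennreal (1 - r n) * (\<Sum>k. ennreal (r n) ^ k * (\<integral>\<^sup>+v. eexp (- \<beta> * (pmax v k - psum v k)) \<partial>SS n)) = grid_inf_lt n \<beta>"
    unfolding dual[symmetric] gsup_def gend_def
    by (rule nn_transfer[of "\<lambda>k v. eexp (- \<beta> * (pmax v k - psum v k))", symmetric]) measurable
  finally show ?thesis .
qed

text \<open>The case of exponent 0: the maximum of the killed walk exceeds x exactly if x is passed
  before killing.\<close>

lemma hup_eq: "hup n x = (\<integral>\<^sup>+p. of_bool (x < GS n p) \<partial>MM)"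
  using up_factor[of x n 0] by (simp add: grid_inf_lt_0)

text \<open>\<open>up_factor\<close> and \<open>hup_eq\<close> give the claim for indicators of
  half-lines, and these determine the measures \<open>A\<close> and \<open>B\<close>. In
  probabilistic terms, the maximum and the distance of the endpoint below it are independent: the
  Wiener-Hopf factorization of the killed walk.\<close>

lemma gsup_independence:
  assumes \<beta>: "0 \<le> \<beta>" and h[measurable]: "h \<in> borel_measurable borel"
  shows "(\<integral>\<^sup>+p. h (GS n p) * eexp (- \<beta> * (GS n p - gend n p)) \<partial>MM)
    = grid_inf_lt n \<beta> * (\<integral>\<^sup>+p. h (GS n p) \<partial>MM)"
proof -
  interpret MM: prob_space MM by (rule prob_MM)
  define A where "A = distr (density MM (\<lambda>p. eexp (- \<beta> * (GS n p - gend n p)))) borel (\<lambda>p. GS n p)"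
  define B where "B = density (distr MM borel (\<lambda>p. GS n p)) (\<lambda>_. grid_inf_lt n \<beta>)"
  have IA: "(\<integral>\<^sup>+s. h s \<partial>A) = (\<integral>\<^sup>+p. h (GS n p) * eexp (- \<beta> * (GS n p - gend n p)) \<partial>MM)"
    if [measurable]: "h \<in> borel_measurable borel" for h
    unfolding A_def by (subst nn_integral_distr; simp?; subst nn_integral_density; simp add: mult.commute)
  have IB: "(\<integral>\<^sup>+s. h s \<partial>B) = grid_inf_lt n \<beta> * (\<integral>\<^sup>+p. h (GS n p) \<partial>MM)"
    if [measurable]: "h \<in> borel_measurable borel" for h
    unfolding B_def by (simp add: nn_integral_density nn_integral_cmult nn_integral_distr)
  have k1: "grid_inf_lt n \<beta> \<le> 1"
  proof -
    have "grid_inf_lt n \<beta> \<le> (\<integral>\<^sup>+p. 1 \<partial>MM)"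
      unfolding grid_inf_lt_def using \<beta> ginf_nonpos by (intro nn_integral_mono) (simp add: mult_nonneg_nonpos)
    then show ?thesis by (simp add: MM.emeasure_space_1)
  qed
  have ob: "(\<lambda>s. of_bool (x < s) :: ennreal) = indicator {x<..}" for x :: real
    by (auto simp: indicator_def fun_eq_iff)
  have EA: "emeasure A {x<..} = (\<integral>\<^sup>+p. of_bool (x < GS n p) * eexp (- \<beta> * (GS n p - gend n p)) \<partial>MM)" for x
  proof -
    have "emeasure A {x<..} = (\<integral>\<^sup>+s. of_bool (x < s) \<partial>A)"
      unfolding ob by (subst nn_integral_indicator) (simp_all add: A_def)
    then show ?thesis by (simp add: IA)
  qed
  have EB: "emeasure B {x<..} = grid_inf_lt n \<beta> * (\<integral>\<^sup>+p. of_bool (x < GS n p) \<partial>MM)" for x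
  proof -
    have "emeasure B {x<..} = (\<integral>\<^sup>+s. of_bool (x < s) \<partial>B)"
      unfolding ob by (subst nn_integral_indicator) (simp_all add: B_def)
    then show ?thesis by (simp add: IB)
  qed
  have "A = B"
  proof (rule measure_eqI_lessThan)
    fix x
    show "emeasure A {x<..} = emeasure B {x<..}"
      unfolding EA EB up_factor hup_eq by (rule mult.commute)
    then have "emeasure A {x<..} = grid_inf_lt n \<beta> * (\<integral>\<^sup>+p. of_bool (x < GS n p) \<partial>MM)" by (simp add: EB)
    also have "\<dots> \<le> 1 * (\<integral>\<^sup>+p. 1 \<partial>MM)"
      by (intro mult_mono k1 nn_integral_mono) auto
    also have "\<dots> < \<infinity>" by (simp add: MM.emeasure_space_1)
    finally show "emeasure A {x<..} < \<infinity>" .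
  qed (simp_all add: A_def B_def)
  then show ?thesis using IA[OF h] IB[OF h] by simp
qed

end

text \<open>Divided by the mesh 1 / 2 ^ n, numerator and denominator become difference quotients of
  exponentials at 0.\<close>

lemma exp_quotient_tendsto:
  fixes a q :: real
  assumes "q \<noteq> 0"
  shows "(\<lambda>n. (exp (a / 2 ^ n) - 1) / (1 - exp (- q / 2 ^ n))) \<longlonglongrightarrow> a / q"
proof -
  have e: "((\<lambda>h. (exp (b * h) - 1) / h) \<longlongrightarrow> b) (at 0)" for b :: real
  proof -
    have "((\<lambda>h. exp (b * h)) has_real_derivative b) (at 0)"
      by (auto intro!: derivative_eq_intros)
    then show ?thesis unfolding DERIV_def by simp
  qed
  have "((\<lambda>h. ((exp (a * h) - 1) / h) / (- ((exp (- q * h) - 1) / h))) \<longlongrightarrow> a / (- (- q))) (at 0)"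
    using assms by (intro tendsto_intros e) auto
  moreover have "filterlim (\<lambda>n. 1 / 2 ^ n :: real) (at 0) sequentially"
  proof -
    have "(\<lambda>n. (1/2::real) ^ n) \<longlonglongrightarrow> 0" by (rule LIMSEQ_power_zero) simp
    then show ?thesis unfolding filterlim_at by (auto simp: power_one_over)
  qed
  ultimately have "(\<lambda>n. ((exp (a * (1 / 2 ^ n)) - 1) / (1 / 2 ^ n)) / (- ((exp (- q * (1 / 2 ^ n)) - 1) / (1 / 2 ^ n)))) \<longlonglongrightarrow> a / (- (- q))"
    by (rule filterlim_compose)
  moreover have "((exp (a * (1 / 2 ^ n)) - 1) / (1 / 2 ^ n)) / (- ((exp (- q * (1 / 2 ^ n)) - 1) / (1 / 2 ^ n)))
    = (exp (a / 2 ^ n) - 1) / (1 - exp (- q / 2 ^ n))" for n :: nat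
    by (simp add: divide_simps) (auto simp: algebra_simps)?
  ultimately show ?thesis by simp
qed

section \<open>Passage identities in the limit of fine grids\<close>

context snl
begin

interpretation R: random_walk "D n" for n by (rule rw)

text \<open>Transforms of the supremum restricted to values at most x; the restriction bounds them
  by exp (\<beta> x) for \<beta> \<ge> 0.\<close>

definition "Gn n \<beta> x = (\<integral>\<^sup>+p. of_bool (GS n p \<le> x) * eexp (\<beta> * GS n p) \<partial>MM)"
definition "GG \<beta> x = (\<integral>\<^sup>+p. of_bool (LS p \<le> x) * eexp (\<beta> * LS p) \<partial>MM)"
definition "sup_tail x = (\<integral>\<^sup>+p. of_bool (x < LS p) \<partial>MM)"
text \<open>\<open>tm\<close> and \<open>td\<close> are the discounted transforms of the position at
  grid passage above and below x. On each path at most one term of the series is nonzero.\<close>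

definition "tm n \<beta> x = (\<integral>\<^sup>+\<omega>. (\<Sum>k. of_bool (hitup x (incr n (yp \<omega>)) k) * ennreal (exp (- q * dy n k) * exp (\<beta> * Y (dy n k) \<omega>))) \<partial>M)"
definition "td n \<beta> x = (\<integral>\<^sup>+\<omega>. (\<Sum>k. of_bool (hitdn x (incr n (yp \<omega>)) k) * ennreal (exp (- q * dy n k) * exp (\<beta> * Y (dy n k) \<omega>))) \<partial>M)"

lemma const_bound: "(\<And>p. p \<in> space MM \<Longrightarrow> u p \<le> c) \<Longrightarrow> (\<integral>\<^sup>+p. u p \<partial>MM) \<le> c"
  using nn_integral_mono[of MM u "\<lambda>_. c"] prob_space.emeasure_space_1[OF prob_MM] by simp

lemma Gn_le: "0 \<le> \<beta> \<Longrightarrow> Gn n \<beta> x \<le> eexp (\<beta> * x)"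
  unfolding Gn_def by (intro const_bound) (auto intro!: ennreal_leI mult_left_mono)

lemma grid_inf_lt_le: "0 \<le> \<beta> \<Longrightarrow> grid_inf_lt n \<beta> \<le> 1"
  unfolding grid_inf_lt_def using ginf_nonpos by (intro const_bound) (simp add: mult_nonneg_nonpos)

text \<open>The endpoint is the maximum minus the distance below it, and these two are
  independent.\<close>

lemma walk_end_factorization: "0 \<le> \<beta> \<Longrightarrow> (\<integral>\<^sup>+p. of_bool (GS n p \<le> x) * eexp (\<beta> * gend n p) \<partial>MM) = grid_inf_lt n \<beta> * Gn n \<beta> x"
proof -
  assume \<beta>: "0 \<le> \<beta>"
  have "(\<integral>\<^sup>+p. of_bool (GS n p \<le> x) * eexp (\<beta> * gend n p) \<partial>MM)
    = (\<integral>\<^sup>+p. (of_bool (GS n p \<le> x) * eexp (\<beta> * GS n p))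
        * eexp (- \<beta> * (GS n p - gend n p)) \<partial>MM)"
    by (intro nn_integral_cong) (simp add: mult.assoc ennreal_mult[symmetric] exp_add[symmetric] algebra_simps)
  also have "\<dots> = grid_inf_lt n \<beta> * Gn n \<beta> x"
    unfolding Gn_def by (rule gsup_independence[OF \<beta>, of "\<lambda>s. of_bool (s \<le> x) * eexp (\<beta> * s)"]) measurable
  finally show ?thesis .
qed

lemma psum_yp: "\<omega> \<in> space M \<Longrightarrow> psum (incr n (yp \<omega>)) k = Y (dy n k) \<omega>"
  using snpath.psum_incr[OF path] by simp

lemma r_power: "ennreal (r n) ^ k = eexp (- q * dy n k)"
  using r[of n] by (simp add: ennreal_power r_def dy_def exp_of_nat_mult[symmetric] algebra_simps)

lemma SB_meas[measurable]:
  "(\<lambda>v. pmax v k) \<in> borel_measurable SB" "(\<lambda>v. pmin v k) \<in> borel_measurable SB" "(\<lambda>v. psum v k) \<in> borel_measurable SB"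
  "Measurable.pred SB (\<lambda>v. hitup x v k)" "Measurable.pred SB (\<lambda>v. hitdn x v k)"
proof -
  show 1: "(\<lambda>v. pmax v k) \<in> borel_measurable SB" "(\<lambda>v. pmin v k) \<in> borel_measurable SB"
    using R.measurable_pmax[of k 0] R.measurable_pmin[of k 0] by (simp_all add: borel_SS)
  show [measurable]: "(\<lambda>v. psum v k) \<in> borel_measurable SB" for k
    using R.measurable_psum[of k 0] by (simp_all add: borel_SS)
  show "Measurable.pred SB (\<lambda>v. hitup x v k)" "Measurable.pred SB (\<lambda>v. hitdn x v k)"
    unfolding hitup_def hitdn_def by measurable
qed

lemma hit_meas:
  assumes "\<And>k. \<phi> k \<in> borel_measurable SB"
  shows "(\<lambda>\<omega>. \<Sum>k. \<phi> k (incr n (yp \<omega>)) :: ennreal) \<in> borel_measurable M"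
proof -
  have [measurable]: "(\<lambda>\<omega>. \<phi> k (incr n (yp \<omega>))) \<in> borel_measurable M" for k
    by (rule measurable_compose[OF measurable_incr assms])
  show ?thesis by measurable
qed

lemma sum_walk:
  assumes "\<And>k. \<phi> k \<in> borel_measurable SB"
  shows "(\<integral>\<^sup>+\<omega>. (\<Sum>k. \<phi> k (incr n (yp \<omega>))) \<partial>M) = (\<Sum>k. \<integral>\<^sup>+v. \<phi> k v \<partial>SS n)"
  by (subst nn_integral_suminf) (auto intro!: measurable_compose[OF measurable_incr assms] simp: nn_walk assms)

lemma tm_sum: "tm n \<beta> x = (\<Sum>k. ennreal (r n) ^ k * (\<integral>\<^sup>+v. of_bool (hitup x v k) * eexp (\<beta> * psum v k) \<partial>SS n))"
proof -
  have [measurable]: "(\<lambda>v. of_bool (hitup x v k) * eexp (\<beta> * psum v k)) \<in> borel_measurable SB" for k by measurable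
  have "tm n \<beta> x = (\<integral>\<^sup>+\<omega>. (\<Sum>k. ennreal (r n) ^ k * (of_bool (hitup x (incr n (yp \<omega>)) k) * eexp (\<beta> * psum (incr n (yp \<omega>)) k))) \<partial>M)"
    unfolding tm_def by (intro nn_integral_cong) (simp add: psum_yp r_power ennreal_mult mult_ac)
  also have "\<dots> = (\<Sum>k. \<integral>\<^sup>+v. ennreal (r n) ^ k * (of_bool (hitup x v k) * eexp (\<beta> * psum v k)) \<partial>SS n)"
    by (rule sum_walk) measurable
  also have "\<dots> = (\<Sum>k. ennreal (r n) ^ k * (\<integral>\<^sup>+v. of_bool (hitup x v k) * eexp (\<beta> * psum v k) \<partial>SS n))"
    by (subst nn_integral_cmult) (simp_all add: borel_SS)
  finally show ?thesis .
qed

lemma td_sum: "td n \<beta> x = (\<Sum>k. ennreal (r n) ^ k * (\<integral>\<^sup>+v. of_bool (hitdn x v k) * eexp (\<beta> * psum v k) \<partial>SS n))"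
proof -
  have [measurable]: "(\<lambda>v. of_bool (hitdn x v k) * eexp (\<beta> * psum v k)) \<in> borel_measurable SB" for k by measurable
  have "td n \<beta> x = (\<integral>\<^sup>+\<omega>. (\<Sum>k. ennreal (r n) ^ k * (of_bool (hitdn x (incr n (yp \<omega>)) k) * eexp (\<beta> * psum (incr n (yp \<omega>)) k))) \<partial>M)"
    unfolding td_def by (intro nn_integral_cong) (simp add: psum_yp r_power ennreal_mult mult_ac)
  also have "\<dots> = (\<Sum>k. \<integral>\<^sup>+v. ennreal (r n) ^ k * (of_bool (hitdn x v k) * eexp (\<beta> * psum v k)) \<partial>SS n)"
    by (rule sum_walk) measurable
  also have "\<dots> = (\<Sum>k. ennreal (r n) ^ k * (\<integral>\<^sup>+v. of_bool (hitdn x v k) * eexp (\<beta> * psum v k) \<partial>SS n))"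
    by (subst nn_integral_cmult) (simp_all add: borel_SS)
  finally show ?thesis .
qed

lemma hup_tm: "hup n x = tm n 0 x"
  unfolding hup_def tm_sum by simp

text \<open>The coefficient \<open>r n * exp (\<psi> \<beta> / 2 ^ n) - 1\<close> produced by
  optional stopping, divided by the weight \<open>1 - r n\<close> of the geometric mixture.\<close>

definition "cn n \<beta> = (exp ((\<psi> \<beta> - q) / 2 ^ n) - 1) / (1 - exp (- q / 2 ^ n))"

text \<open>Optional stopping on the grid, solved for \<open>tm\<close>. The sum \<open>A\<close>
  times \<open>1 - r n\<close> is \<open>grid_inf_lt n \<beta> * Gn n \<beta> x\<close>, hence
  finite, and the equation may be read in the reals.\<close>

lemma tm_real:
  assumes \<beta>: "0 \<le> \<beta>" and x: "0 \<le> x"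
  shows "tm n \<beta> x = ennreal (1 + cn n \<beta> * enn2real (grid_inf_lt n \<beta> * Gn n \<beta> x))"
    and "0 \<le> 1 + cn n \<beta> * enn2real (grid_inf_lt n \<beta> * Gn n \<beta> x)"
proof -
  define A where "A = (\<Sum>k. ennreal (r n) ^ k * (\<integral>\<^sup>+v. of_bool (pmax v k \<le> x) * eexp (\<beta> * psum v k) \<partial>SS n))"
  have \<rho>: "(\<integral>\<^sup>+z. eexp (\<beta> * z) \<partial>D n) = eexp (\<psi> \<beta> / 2 ^ n)"
    using mgf[OF \<beta>, of "dy n 1"] by (subst nn_integral_distr) (auto simp: Ym dy_def)
  have eq: "tm n \<beta> x + A = 1 + ennreal (r n) * eexp (\<psi> \<beta> / 2 ^ n) * A"
    unfolding tm_sum A_def by (rule R.optional_stopping[OF x \<rho>])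
  have A': "ennreal (1 - r n) * A = grid_inf_lt n \<beta> * Gn n \<beta> x"
    unfolding walk_end_factorization[OF \<beta>, symmetric] A_def gsup_def gend_def
    by (rule nn_transfer[of "\<lambda>k v. of_bool (pmax v k \<le> x) * eexp (\<beta> * psum v k)", symmetric]) measurable
  have "grid_inf_lt n \<beta> * Gn n \<beta> x \<le> 1 * eexp (\<beta> * x)"
    by (intro mult_mono grid_inf_lt_le Gn_le \<beta>) auto
  then have fin: "grid_inf_lt n \<beta> * Gn n \<beta> x < top" by (simp add: le_less_trans)
  obtain a where a: "A = ennreal a" "0 \<le> a"
  proof (cases A)
    case top
    then have "ennreal (1 - r n) * A = top" using r(2)[of n] by (simp add: ennreal_mult_top)
    then show ?thesis using fin A' by simp
  qed (rule that)
  have a': "(1 - r n) * a = enn2real (grid_inf_lt n \<beta> * Gn n \<beta> x)"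
    using A'[symmetric] a r(2)[of n] by (simp add: ennreal_mult[symmetric])
  have eq': "tm n \<beta> x + ennreal a = ennreal (1 + r n * exp (\<psi> \<beta> / 2 ^ n) * a)"
    using eq a r[of n] by (simp add: ennreal_mult[symmetric] ennreal_plus[symmetric] del: ennreal_plus flip: ennreal_1)
  obtain t where t: "tm n \<beta> x = ennreal t" "0 \<le> t" using eq' by (cases "tm n \<beta> x") auto
  have "t + a = 1 + r n * exp (\<psi> \<beta> / 2 ^ n) * a"
    using eq' t a r[of n] by (simp flip: ennreal_plus)
  then have "t = 1 + (r n * exp (\<psi> \<beta> / 2 ^ n) - 1) * a" by (simp add: algebra_simps)
  also have "r n * exp (\<psi> \<beta> / 2 ^ n) - 1 = cn n \<beta> * (1 - r n)"
  proof -
    have nz: "1 - exp (- q / 2 ^ n) \<noteq> 0" using r(2)[of n] q by (simp add: r_def)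
    have "r n * exp (\<psi> \<beta> / 2 ^ n) - 1 = exp ((\<psi> \<beta> - q) / 2 ^ n) - 1"
      by (simp add: r_def exp_add[symmetric] diff_divide_distrib add.commute)
    also have "\<dots> = cn n \<beta> * (1 - r n)"
      unfolding cn_def r_def by (rule nonzero_divide_eq_eq[THEN iffD1, OF nz refl])
    finally show ?thesis .
  qed
  finally have "t = 1 + cn n \<beta> * enn2real (grid_inf_lt n \<beta> * Gn n \<beta> x)"
    by (simp add: a'[symmetric])
  then show "tm n \<beta> x = ennreal (1 + cn n \<beta> * enn2real (grid_inf_lt n \<beta> * Gn n \<beta> x))"
    "0 \<le> 1 + cn n \<beta> * enn2real (grid_inf_lt n \<beta> * Gn n \<beta> x)" using t by simp_all
qed

lemma cn_tendsto: "(\<lambda>n. cn n \<beta>) \<longlonglongrightarrow> (\<psi> \<beta> - q) / q"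
  unfolding cn_def using q by (intro exp_quotient_tendsto) simp

text \<open>The bound is uniform in n because \<open>cn\<close> converges. Applied at
  \<open>2 * \<beta>\<close> it controls second moments at \<open>\<beta>\<close>.\<close>

lemma tm_bounded:
  assumes \<beta>: "0 \<le> \<beta>" and x: "0 \<le> x"
  shows "\<exists>C. \<forall>n. tm n \<beta> x \<le> ennreal C"
proof -
  have "Bseq (\<lambda>n. cn n \<beta>)" using cn_tendsto convergentI convergent_imp_Bseq by blast
  then obtain B where B: "\<And>n. \<bar>cn n \<beta>\<bar> \<le> B" "0 < B" by (auto simp: Bseq_def)
  have "tm n \<beta> x \<le> ennreal (1 + B * exp (\<beta> * x))" for n
  proof -
    have "grid_inf_lt n \<beta> * Gn n \<beta> x \<le> 1 * eexp (\<beta> * x)"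
      by (intro mult_mono grid_inf_lt_le Gn_le \<beta>) auto
    then have le: "enn2real (grid_inf_lt n \<beta> * Gn n \<beta> x) \<le> exp (\<beta> * x)" by (intro enn2real_leI) auto
    have "cn n \<beta> * enn2real (grid_inf_lt n \<beta> * Gn n \<beta> x) \<le> B * exp (\<beta> * x)"
      using B(1)[of n] B(2) by (intro mult_mono le) auto
    then show ?thesis unfolding tm_real(1)[OF \<beta> x] by (intro ennreal_leI) simp
  qed
  then show ?thesis by blast
qed

text \<open>\<open>V n\<close> is the contribution of the grid position exceeding x. It tends to 0
  on each path, and its square is at most the integrand of \<open>tm\<close> at
  \<open>2 * \<beta>\<close>, so its integral tends to 0 as well.\<close>

lemma overshoot_vanishes:
  assumes \<beta>: "0 \<le> \<beta>" and x: "0 \<le> x"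
  defines "V n \<omega> \<equiv> (\<Sum>k. of_bool (hitup x (incr n (yp \<omega>)) k) * ennreal (exp (- q * dy n k) * (exp (\<beta> * Y (dy n k) \<omega>) - exp (\<beta> * x))))"
  shows "(\<lambda>n. \<integral>\<^sup>+\<omega>. V n \<omega> \<partial>M) \<longlonglongrightarrow> 0"
    and "tm n \<beta> x = (\<integral>\<^sup>+\<omega>. V n \<omega> \<partial>M) + eexp (\<beta> * x) * hup n x"
proof -
  have Vm[measurable]: "V n \<in> borel_measurable M" for n
  proof -
    have "(\<lambda>\<omega>. \<Sum>k. of_bool (hitup x (incr n (yp \<omega>)) k) * ennreal (exp (- q * dy n k) * (exp (\<beta> * psum (incr n (yp \<omega>)) k) - exp (\<beta> * x)))) \<in> borel_measurable M"
      by (rule hit_meas[of "\<lambda>k v. of_bool (hitup x v k) * ennreal (exp (- q * dy n k) * (exp (\<beta> * psum v k) - exp (\<beta> * x)))"]) measurable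
    then show ?thesis unfolding V_def by (rule measurable_cong[THEN iffD1, rotated]) (simp add: psum_yp)
  qed
  have Tm[measurable]: "(\<lambda>\<omega>. \<Sum>k. of_bool (hitup x (incr n (yp \<omega>)) k) * ennreal (exp (- q * dy n k) * exp (\<beta> * Y (dy n k) \<omega>))) \<in> borel_measurable M" for n \<beta>
  proof -
    have "(\<lambda>\<omega>. \<Sum>k. of_bool (hitup x (incr n (yp \<omega>)) k) * ennreal (exp (- q * dy n k) * exp (\<beta> * psum (incr n (yp \<omega>)) k))) \<in> borel_measurable M"
      by (rule hit_meas[of "\<lambda>k v. of_bool (hitup x v k) * ennreal (exp (- q * dy n k) * exp (\<beta> * psum v k))"]) measurable
    then show ?thesis by (rule measurable_cong[THEN iffD1, rotated]) (simp add: psum_yp)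
  qed
  obtain C where C: "\<And>n. tm n (2 * \<beta>) x \<le> ennreal C" using tm_bounded[of "2 * \<beta>" x] \<beta> x by auto
  show "(\<lambda>n. \<integral>\<^sup>+\<omega>. V n \<omega> \<partial>M) \<longlonglongrightarrow> 0"
  proof (rule nn_integral_tendsto_zero_square_bounded[OF prob_space_axioms Vm])
    show "(\<lambda>n. V n \<omega>) \<longlonglongrightarrow> 0" if "\<omega> \<in> space M" for \<omega>
      unfolding V_def using snpath.hitup_overshoot_tendsto[OF path[OF that] x] .
    fix n
    have "V n \<omega> * V n \<omega> \<le> (\<Sum>k. of_bool (hitup x (incr n (yp \<omega>)) k) * ennreal (exp (- q * dy n k) * exp (2 * \<beta> * Y (dy n k) \<omega>)))"
      if "\<omega> \<in> space M" for \<omega>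
    proof (cases "\<exists>k. Y (dy n k) \<omega> \<in> {x<..}")
      case True
      define K where "K = (LEAST k. Y (dy n k) \<omega> \<in> {x<..})"
      have "Y (dy n K) \<omega> \<in> {x<..}" using LeastI_ex[OF True] unfolding K_def .
      then have le: "exp (\<beta> * x) \<le> exp (\<beta> * Y (dy n K) \<omega>)" using \<beta> by (simp add: mult_left_mono)
      have *: "(exp (- q * dy n K) * (exp (\<beta> * Y (dy n K) \<omega>) - exp (\<beta> * x))) * (exp (- q * dy n K) * (exp (\<beta> * Y (dy n K) \<omega>) - exp (\<beta> * x)))
        \<le> (exp (- q * dy n K) * exp (\<beta> * Y (dy n K) \<omega>)) * (1 * exp (\<beta> * Y (dy n K) \<omega>))"
        using le q by (intro mult_mono) auto
      also have "\<dots> = exp (- q * dy n K) * exp (2 * \<beta> * Y (dy n K) \<omega>)"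
        by (simp add: exp_add[symmetric])
      finally show ?thesis
        unfolding V_def snpath.suminf_hitup[OF path[OF that]] if_P[OF True] K_def[symmetric]
        using le by (subst ennreal_mult[symmetric]) (auto intro!: ennreal_leI)
    next
      case False
      show ?thesis
        unfolding V_def snpath.suminf_hitup[OF path[OF that]] if_not_P[OF False] by simp
    qed
    then have "(\<integral>\<^sup>+\<omega>. V n \<omega> * V n \<omega> \<partial>M) \<le> tm n (2 * \<beta>) x"
      unfolding tm_def by (rule nn_integral_mono)
    then show "(\<integral>\<^sup>+\<omega>. V n \<omega> * V n \<omega> \<partial>M) \<le> ennreal C" using C order_trans by blast
  qed
  have "tm n \<beta> x = (\<integral>\<^sup>+\<omega>. V n \<omega> + eexp (\<beta> * x) * (\<Sum>k. of_bool (hitup x (incr n (yp \<omega>)) k) * ennreal (exp (- q * dy n k) * exp (0 * Y (dy n k) \<omega>))) \<partial>M)"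
    unfolding tm_def
  proof (rule nn_integral_cong)
    fix \<omega> assume \<omega>: "\<omega> \<in> space M"
    show "(\<Sum>k. of_bool (hitup x (incr n (yp \<omega>)) k) * ennreal (exp (- q * dy n k) * exp (\<beta> * Y (dy n k) \<omega>)))
      = V n \<omega> + eexp (\<beta> * x) * (\<Sum>k. of_bool (hitup x (incr n (yp \<omega>)) k) * ennreal (exp (- q * dy n k) * exp (0 * Y (dy n k) \<omega>)))"
    proof (cases "\<exists>k. Y (dy n k) \<omega> \<in> {x<..}")
      case True
      define K where "K = (LEAST k. Y (dy n k) \<omega> \<in> {x<..})"
      have "Y (dy n K) \<omega> \<in> {x<..}" using LeastI_ex[OF True] unfolding K_def .
      then have le: "exp (\<beta> * x) \<le> exp (\<beta> * Y (dy n K) \<omega>)" using \<beta> by (simp add: mult_left_mono)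
      show ?thesis
        unfolding V_def snpath.suminf_hitup[OF path[OF \<omega>]] if_P[OF True] K_def[symmetric]
        using le by (simp add: ennreal_mult[symmetric] ennreal_plus[symmetric] del: ennreal_plus) (simp add: algebra_simps)
    next
      case False
      show ?thesis
        unfolding V_def snpath.suminf_hitup[OF path[OF \<omega>]] if_not_P[OF False] by simp
    qed
  qed
  also have "\<dots> = (\<integral>\<^sup>+\<omega>. V n \<omega> \<partial>M) + eexp (\<beta> * x) * tm n 0 x"
    using Tm[of n 0] unfolding tm_def by (subst nn_integral_add) (auto simp: nn_integral_cmult)
  finally show "tm n \<beta> x = (\<integral>\<^sup>+\<omega>. V n \<omega> \<partial>M) + eexp (\<beta> * x) * hup n x"
    by (simp add: hup_tm)
qed

lemma grid_inf_lt_tendsto: "0 \<le> \<beta> \<Longrightarrow> (\<lambda>n. grid_inf_lt n \<beta>) \<longlonglongrightarrow> inf_lt \<beta>"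
  unfolding grid_inf_lt_def inf_lt_def
proof (rule nn_integral_convergence[OF prob_MM, where B = 1])
  assume \<beta>: "0 \<le> \<beta>"
  show "eexp (\<beta> * GI i p) \<le> ennreal 1" for i p
    using \<beta> ginf_nonpos by (intro ennreal_leI) (simp add: mult_nonneg_nonpos)
  show "(\<lambda>i. eexp (\<beta> * GI i p)) \<longlonglongrightarrow> eexp (\<beta> * LI p)"
    if "p \<in> space MM" for p
    by (intro tendsto_ennrealI tendsto_intros snpath.ginf_tendsto'[OF path[OF snd_space[OF that]]])
qed measurable

lemma Gn_tendsto: "0 \<le> \<beta> \<Longrightarrow> (\<lambda>n. Gn n \<beta> x) \<longlonglongrightarrow> GG \<beta> x"
  unfolding Gn_def GG_def
proof (rule nn_integral_convergence[OF prob_MM, where B = "exp (\<beta> * x)"])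
  assume \<beta>: "0 \<le> \<beta>"
  show "of_bool (GS i p \<le> x) * eexp (\<beta> * GS i p) \<le> eexp (\<beta> * x)" for i p
    using \<beta> by (auto intro!: ennreal_leI mult_left_mono)
  fix p assume p: "p \<in> space MM"
  note t = snpath.gsup_tendsto'[OF path[OF snd_space[OF p]], of "fst p"]
    and le = snpath.gsup_le_run_sup'[OF path[OF snd_space[OF p]], of _ "fst p"]
  show "(\<lambda>i. of_bool (GS i p \<le> x) * eexp (\<beta> * GS i p))
    \<longlonglongrightarrow> of_bool (LS p \<le> x) * eexp (\<beta> * LS p)"
  proof (cases "LS p \<le> x")
    case True
    then have "GS i p \<le> x" for i using le[of i] by linarith
    with True show ?thesis by (simp only: of_bool_eq mult_1_left simp_thms) (intro tendsto_ennrealI tendsto_intros t)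
  next
    case False
    then have "\<forall>\<^sub>F i in sequentially. x < GS i p"
      using t by (intro order_tendstoD) auto
    then have "\<forall>\<^sub>F i in sequentially. 0 = of_bool (GS i p \<le> x) * eexp (\<beta> * GS i p)"
      by eventually_elim simp
    then show ?thesis using False by (intro Lim_transform_eventually[OF tendsto_const]) simp_all
  qed
qed measurable

lemma hup_tendsto: "(\<lambda>n. hup n x) \<longlonglongrightarrow> sup_tail x"
  unfolding hup_eq sup_tail_def
proof (rule nn_integral_convergence[OF prob_MM, where B = 1])
  show "of_bool (x < GS i p) \<le> ennreal 1" for i p by simp
  fix p assume p: "p \<in> space MM"
  note t = snpath.gsup_tendsto'[OF path[OF snd_space[OF p]], of "fst p"]
    and le = snpath.gsup_le_run_sup'[OF path[OF snd_space[OF p]], of _ "fst p"]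
  show "(\<lambda>i. of_bool (x < GS i p)) \<longlonglongrightarrow> (of_bool (x < LS p) :: ennreal)"
  proof (cases "x < LS p")
    case False
    then have "\<not> x < GS i p" for i using le[of i] by linarith
    with False show ?thesis by simp
  next
    case True
    then have "\<forall>\<^sub>F i in sequentially. x < GS i p"
      using t by (intro order_tendstoD) auto
    then show ?thesis using True by (intro tendsto_eventually) (auto elim: eventually_mono)
  qed
qed measurable

text \<open>Two expressions for the limit of \<open>tm\<close>: the left side since the overshoot
  vanishes, the right side by optional stopping.\<close>

lemma sup_tail_identity:
  assumes \<beta>: "0 \<le> \<beta>" and x: "0 \<le> x"
  shows "exp (\<beta> * x) * enn2real (sup_tail x) = 1 + (\<psi> \<beta> - q) / q * (enn2real (inf_lt \<beta>) * enn2real (GG \<beta> x))"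
proof -
  have Nfin: "sup_tail x \<noteq> top"
  proof -
    have "sup_tail x \<le> 1" unfolding sup_tail_def by (rule const_bound) simp
    then show ?thesis by (auto simp: top_unique)
  qed
  have kfin: "inf_lt \<beta> \<noteq> top"
    using LIMSEQ_le_const2[OF grid_inf_lt_tendsto[OF \<beta>], of 1] grid_inf_lt_le[OF \<beta>] by (auto simp: top_unique)
  have Gfin: "GG \<beta> x \<noteq> top"
    using LIMSEQ_le_const2[OF Gn_tendsto[OF \<beta>, of x], of "eexp (\<beta> * x)"] Gn_le[OF \<beta>] by (auto simp: top_unique)
  have l1: "(\<lambda>n. tm n \<beta> x) \<longlonglongrightarrow> 0 + eexp (\<beta> * x) * sup_tail x"
    unfolding overshoot_vanishes(2)[OF \<beta> x]
    by (intro tendsto_add overshoot_vanishes(1)[OF \<beta> x] ennreal_tendsto_cmult hup_tendsto) simp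
  have "(\<lambda>n. enn2real (grid_inf_lt n \<beta>) * enn2real (Gn n \<beta> x)) \<longlonglongrightarrow> enn2real (inf_lt \<beta>) * enn2real (GG \<beta> x)"
    using grid_inf_lt_tendsto[OF \<beta>] Gn_tendsto[OF \<beta>, of x] kfin Gfin by (intro tendsto_mult tendsto_enn2real) (simp_all add: ennreal_enn2real_if)
  then have l2: "(\<lambda>n. 1 + cn n \<beta> * enn2real (grid_inf_lt n \<beta> * Gn n \<beta> x)) \<longlonglongrightarrow> 1 + (\<psi> \<beta> - q) / q * (enn2real (inf_lt \<beta>) * enn2real (GG \<beta> x))"
    unfolding enn2real_mult by (rule tendsto_add[OF tendsto_const tendsto_mult[OF cn_tendsto]])
  have nn: "0 \<le> 1 + (\<psi> \<beta> - q) / q * (enn2real (inf_lt \<beta>) * enn2real (GG \<beta> x))"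
    by (rule LIMSEQ_le_const[OF l2]) (use tm_real(2)[OF \<beta> x] in blast)
  have "(\<lambda>n. tm n \<beta> x) \<longlonglongrightarrow> ennreal (1 + (\<psi> \<beta> - q) / q * (enn2real (inf_lt \<beta>) * enn2real (GG \<beta> x)))"
    unfolding tm_real(1)[OF \<beta> x] by (intro tendsto_ennrealI l2)
  from LIMSEQ_unique[OF this l1]
  have "ennreal (1 + (\<psi> \<beta> - q) / q * (enn2real (inf_lt \<beta>) * enn2real (GG \<beta> x))) = eexp (\<beta> * x) * sup_tail x" by simp
  then have "enn2real (eexp (\<beta> * x) * sup_tail x) = 1 + (\<psi> \<beta> - q) / q * (enn2real (inf_lt \<beta>) * enn2real (GG \<beta> x))"
    using nn by (metis enn2real_ennreal)
  then show ?thesis by (simp add: enn2real_mult)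
qed

text \<open>Entry into the open half-line below x, which is what grids detect. The indicator guards
  \<open>entry_time\<close> against the empty set.\<close>

definition "passage_lt \<beta> x = (\<integral>\<^sup>+\<omega>. of_bool (\<exists>s\<ge>0. Y s \<omega> < x) * ennreal (exp (- q * entry_time {..<x} (yp \<omega>)) * exp (\<beta> * Y (entry_time {..<x} (yp \<omega>)) \<omega>)) \<partial>M)"

lemma td_tendsto:
  assumes \<beta>: "0 \<le> \<beta>" and x: "x \<le> 0"
  shows "(\<lambda>n. td n \<beta> x) \<longlonglongrightarrow> passage_lt \<beta> x"
    and "(\<lambda>\<omega>. of_bool (\<exists>s\<ge>0. Y s \<omega> < x) * ennreal (exp (- q * entry_time {..<x} (yp \<omega>)) * exp (\<beta> * Y (entry_time {..<x} (yp \<omega>)) \<omega>))) \<in> borel_measurable M"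
proof -
  define u where "u n \<omega> = (\<Sum>k. of_bool (hitdn x (incr n (yp \<omega>)) k) * ennreal (exp (- q * dy n k) * exp (\<beta> * Y (dy n k) \<omega>)))" for n \<omega>
  have um: "u n \<in> borel_measurable M" for n
  proof -
    have "(\<lambda>\<omega>. \<Sum>k. of_bool (hitdn x (incr n (yp \<omega>)) k) * ennreal (exp (- q * dy n k) * exp (\<beta> * psum (incr n (yp \<omega>)) k))) \<in> borel_measurable M"
      by (rule hit_meas[of "\<lambda>k v. of_bool (hitdn x v k) * ennreal (exp (- q * dy n k) * exp (\<beta> * psum v k))"]) measurable
    then show ?thesis unfolding u_def by (rule measurable_cong[THEN iffD1, rotated]) (simp add: psum_yp)
  qed
  have lim: "(\<lambda>n. u n \<omega>) \<longlonglongrightarrow> of_bool (\<exists>s\<ge>0. Y s \<omega> < x) * ennreal (exp (- q * entry_time {..<x} (yp \<omega>)) * exp (\<beta> * Y (entry_time {..<x} (yp \<omega>)) \<omega>))"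
    if "\<omega> \<in> space M" for \<omega>
    unfolding u_def using snpath.hitdn_tendsto[OF path[OF that]] .
  have bd: "u n \<omega> \<le> ennreal 1" if "\<omega> \<in> space M" for n \<omega>
  proof (cases "\<exists>k. Y (dy n k) \<omega> \<in> {..<x}")
    case True
    define K where "K = (LEAST k. Y (dy n k) \<omega> \<in> {..<x})"
    have "Y (dy n K) \<omega> \<in> {..<x}" using LeastI_ex[OF True] unfolding K_def .
    then have "exp (- q * dy n K) * exp (\<beta> * Y (dy n K) \<omega>) \<le> 1 * 1"
      using \<beta> x q by (intro mult_mono) (auto simp: mult_nonneg_nonpos)
    then show ?thesis
      unfolding u_def snpath.suminf_hitdn[OF path[OF that]] if_P[OF True] K_def[symmetric]
      by (intro ennreal_leI) simp
  next
    case False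
    show ?thesis
      unfolding u_def snpath.suminf_hitdn[OF path[OF that]] if_not_P[OF False] by simp
  qed
  show "(\<lambda>n. td n \<beta> x) \<longlonglongrightarrow> passage_lt \<beta> x"
    unfolding td_def passage_lt_def u_def[symmetric]
    by (rule nn_integral_convergence(1)[OF prob_space_axioms um lim bd])
  show "(\<lambda>\<omega>. of_bool (\<exists>s\<ge>0. Y s \<omega> < x) * ennreal (exp (- q * entry_time {..<x} (yp \<omega>)) * exp (\<beta> * Y (entry_time {..<x} (yp \<omega>)) \<omega>))) \<in> borel_measurable M"
    by (rule nn_integral_convergence(2)[OF prob_space_axioms um lim bd])
qed

text \<open>If the infimum is below x, it is the position at the entry plus the infimum of the
  continuation, which by lack of memory is an independent copy. The grid form of this is the
  downward factorization.\<close>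

lemma down_identity:
  assumes \<beta>: "0 \<le> \<beta>" and x: "x \<le> 0"
  shows "(\<integral>\<^sup>+p. of_bool (LI p < x) * eexp (\<beta> * LI p) \<partial>MM) = passage_lt \<beta> x * inf_lt \<beta>"
proof -
  have eq: "(\<integral>\<^sup>+p. of_bool (GI n p < x) * eexp (\<beta> * GI n p) \<partial>MM) = td n \<beta> x * grid_inf_lt n \<beta>" for n
  proof -
    have "(\<integral>\<^sup>+p. of_bool (GI n p < x) * eexp (\<beta> * GI n p) \<partial>MM)
      = ennreal (1 - r n) * (\<Sum>k. ennreal (r n) ^ k * (\<integral>\<^sup>+v. of_bool (pmin v k < x) * eexp (\<beta> * pmin v k) \<partial>SS n))"
      unfolding ginf_def
      by (rule nn_transfer[of "\<lambda>k v. of_bool (pmin v k < x) * eexp (\<beta> * pmin v k)"]) measurable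
    also have "\<dots> = td n \<beta> x * (ennreal (1 - r n) * (\<Sum>k. ennreal (r n) ^ k * (\<integral>\<^sup>+v. eexp (\<beta> * pmin v k) \<partial>SS n)))"
      unfolding R.down_factorization td_sum by (simp only: mult_ac)
    also have "ennreal (1 - r n) * (\<Sum>k. ennreal (r n) ^ k * (\<integral>\<^sup>+v. eexp (\<beta> * pmin v k) \<partial>SS n)) = grid_inf_lt n \<beta>"
      unfolding grid_inf_lt_def ginf_def
      by (rule nn_transfer[of "\<lambda>k v. eexp (\<beta> * pmin v k)", symmetric]) measurable
    finally show ?thesis .
  qed
  have "(\<lambda>n. \<integral>\<^sup>+p. of_bool (GI n p < x) * eexp (\<beta> * GI n p) \<partial>MM)
    \<longlonglongrightarrow> (\<integral>\<^sup>+p. of_bool (LI p < x) * eexp (\<beta> * LI p) \<partial>MM)"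
  proof (rule nn_integral_convergence[OF prob_MM, where B = 1])
    show "of_bool (GI i p < x) * eexp (\<beta> * GI i p) \<le> ennreal 1" for i p
      using \<beta> ginf_nonpos by (auto intro!: ennreal_leI simp: mult_nonneg_nonpos)
    fix p assume p: "p \<in> space MM"
    note t = snpath.ginf_tendsto'[OF path[OF snd_space[OF p]], of "fst p"]
      and le = snpath.run_inf_le_ginf'[OF path[OF snd_space[OF p]], of "fst p"]
    show "(\<lambda>i. of_bool (GI i p < x) * eexp (\<beta> * GI i p))
      \<longlonglongrightarrow> of_bool (LI p < x) * eexp (\<beta> * LI p)"
    proof (cases "LI p < x")
      case False
      then have "\<not> GI i p < x" for i using le[of i] by linarith
      with False show ?thesis by simp
    next
      case True
      have "(\<lambda>i. of_bool (GI i p < x)) \<longlonglongrightarrow> (1::ennreal)"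
      proof (rule tendsto_eventually)
        have "\<forall>\<^sub>F i in sequentially. GI i p < x"
          using t True by (intro order_tendstoD)
        then show "\<forall>\<^sub>F i in sequentially. of_bool (GI i p < x) = (1::ennreal)"
          by eventually_elim simp
      qed
      then have "(\<lambda>i. of_bool (GI i p < x) * eexp (\<beta> * GI i p))
        \<longlonglongrightarrow> 1 * eexp (\<beta> * LI p)"
        by (intro tendsto_mult_ennreal tendsto_ennrealI tendsto_intros t) auto
      then show ?thesis using True by simp
    qed
  qed measurable
  then have "(\<lambda>n. td n \<beta> x * grid_inf_lt n \<beta>) \<longlonglongrightarrow> (\<integral>\<^sup>+p. of_bool (LI p < x) * eexp (\<beta> * LI p) \<partial>MM)"
    by (simp only: eq)
  moreover have "(\<lambda>n. td n \<beta> x * grid_inf_lt n \<beta>) \<longlonglongrightarrow> passage_lt \<beta> x * inf_lt \<beta>"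
  proof -
    have kfin: "inf_lt \<beta> \<noteq> top"
      using LIMSEQ_le_const2[OF grid_inf_lt_tendsto[OF \<beta>], of 1] grid_inf_lt_le[OF \<beta>] by (auto simp: top_unique)
    \<comment> \<open>Together with finiteness this keeps the limit of the product from being of the
      form 0 times infinity.\<close>
    have "inf_lt \<beta> \<noteq> 0"
    proof
      assume "inf_lt \<beta> = 0"
      then have "AE p in MM. eexp (\<beta> * LI p) = 0"
        unfolding inf_lt_def by (subst (asm) nn_integral_0_iff_AE) auto
      then have "AE p in MM. False" by eventually_elim simp
      then show False by (simp add: prob_space.AE_False[OF prob_MM])
    qed
    with kfin show ?thesis
      by (intro tendsto_mult_ennreal[OF td_tendsto(1)[OF \<beta> x] grid_inf_lt_tendsto[OF \<beta>]]) auto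
  qed
  ultimately show ?thesis by (rule LIMSEQ_unique)
qed

end

lemma nn_integral_exp_Icc:
  fixes a b c :: real
  assumes "c \<noteq> 0" "a \<le> b"
  shows "(\<integral>\<^sup>+s. of_bool (a \<le> s \<and> s \<le> b) * eexp (c * s) \<partial>lborel) = ennreal ((exp (c * b) - exp (c * a)) / c)"
proof -
  have "(\<integral>\<^sup>+s. of_bool (a \<le> s \<and> s \<le> b) * eexp (c * s) \<partial>lborel) = (\<integral>\<^sup>+s. eexp (c * s) * indicator {a..b} s \<partial>lborel)"
    by (intro nn_integral_cong) (auto simp: indicator_def)
  also have "\<dots> = ennreal (exp (c * b) / c - exp (c * a) / c)"
    by (rule nn_integral_FTC_Icc) (use assms in \<open>auto intro!: derivative_eq_intros\<close>)
  finally show ?thesis by (simp add: diff_divide_distrib)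
qed

lemma nn_integral_exp_Ici:
  fixes a c :: real
  assumes "c > 0"
  shows "(\<integral>\<^sup>+s. of_bool (a \<le> s) * eexp (- c * s) \<partial>lborel) = ennreal (exp (- c * a) / c)"
proof -
  have "(\<integral>\<^sup>+s. of_bool (a \<le> s) * eexp (- c * s) \<partial>lborel) = (\<integral>\<^sup>+s. eexp (- c * s) * indicator {a..} s \<partial>lborel)"
    by (intro nn_integral_cong) (auto simp: indicator_def)
  also have "\<dots> = ennreal (0 - (- exp (- c * a) / c))"
  proof (rule nn_integral_FTC_atLeast)
    have "((\<lambda>s. exp (- c * s)) \<longlongrightarrow> 0) at_top"
      using assms by (intro filterlim_compose[OF exp_at_bot])
        (auto simp: filterlim_uminus_at_bot intro!: filterlim_tendsto_pos_mult_at_top[OF tendsto_const _ filterlim_ident])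
    then show "((\<lambda>s. - exp (- c * s) / c) \<longlongrightarrow> 0) at_top"
      using tendsto_divide[OF tendsto_minus, of "\<lambda>s. exp (- c * s)" 0 at_top "\<lambda>_. c" c] assms by simp
  qed (use assms in \<open>auto intro!: derivative_eq_intros\<close>)
  finally show ?thesis by simp
qed

lemma nn_integral_of_bool:
  assumes [measurable]: "Measurable.pred N P"
  shows "(\<integral>\<^sup>+x. of_bool (P x) \<partial>N) = emeasure N {x\<in>space N. P x}"
proof -
  have "(\<integral>\<^sup>+x. of_bool (P x) \<partial>N) = (\<integral>\<^sup>+x. indicator {x\<in>space N. P x} x \<partial>N)"
    by (intro nn_integral_cong) (auto simp: indicator_def)
  then show ?thesis by simp
qed

section \<open>The scale function\<close>

text \<open>Here \<Phi> is merely some positive root of \<psi> = q; that it is the supremum in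
  \<open>Phi\<close> follows from the uniqueness of such a root.\<close>

locale snl_scale = snl M Y \<psi> q for M :: "'a measure" and Y \<psi> q +
  fixes \<Phi> :: real and W :: "real \<Rightarrow> real"
  assumes \<Phi>0: "0 < \<Phi>" and \<psi>\<Phi>: "\<psi> \<Phi> = q"
    and W0: "\<And>x. x < 0 \<Longrightarrow> W x = 0"
    and Wc: "continuous_on {0..} W"
    and Wm: "strict_mono_on {0..} W"
    and Wi: "\<And>\<beta>. \<Phi> < \<beta> \<Longrightarrow> set_integrable lborel {0..} (\<lambda>x. exp (- \<beta> * x) * W x)"
    and WL: "\<And>\<beta>. \<Phi> < \<beta> \<Longrightarrow> (LINT x:{0..}|lborel. exp (- \<beta> * x) * W x) = 1 / (\<psi> \<beta> - q)"
begin

sublocale MM: prob_space MM by (rule prob_MM)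

definition "RS p = LS p"
definition "RI p = LI p"

lemma RS_meas[measurable]: "RS \<in> borel_measurable MM" unfolding RS_def by (rule rs_meas)
lemma RI_meas[measurable]: "RI \<in> borel_measurable MM" unfolding RI_def by (rule ri_meas)

lemma RI_nonpos: "p \<in> space MM \<Longrightarrow> RI p \<le> 0"
  using snpath.run_inf_le_ginf'[OF path[OF snd_space], of p "fst p" 0] ginf_nonpos order_trans unfolding RI_def by blast

lemma sup_tail_eq: assumes "0 \<le> x" shows "sup_tail x = eexp (- \<Phi> * x)"
proof -
  have "exp (\<Phi> * x) * enn2real (sup_tail x) = 1" using sup_tail_identity[of \<Phi> x] \<Phi>0 \<psi>\<Phi> assms by simp
  then have "enn2real (sup_tail x) = exp (- \<Phi> * x)" by (simp add: exp_minus field_simps)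
  moreover have "sup_tail x \<le> 1" unfolding sup_tail_def by (rule const_bound) simp
  ultimately show ?thesis by (metis ennreal_enn2real ennreal_one_less_top le_less_trans)
qed

lemma RS_exponential: "distributed MM lborel RS (exponential_density \<Phi>)"
proof (rule exponential_distributedI[OF RS_meas \<Phi>0])
  fix a :: real assume a: "0 \<le> a"
  have "sup_tail a = emeasure MM {p\<in>space MM. a < RS p}"
    unfolding sup_tail_def RS_def[symmetric]
    by (rule nn_integral_of_bool) measurable
  then have "MM.prob {p\<in>space MM. a < RS p} = exp (- \<Phi> * a)"
    using sup_tail_eq[OF a] by (simp add: MM.emeasure_eq_measure)
  moreover have "MM.prob {p\<in>space MM. RS p \<le> a} = 1 - MM.prob {p\<in>space MM. a < RS p}"
    by (subst MM.prob_compl[symmetric]) (auto intro!: arg_cong[where f = MM.prob])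
  ultimately show "emeasure MM {p\<in>space MM. RS p \<le> a} = 1 - eexp (- a * \<Phi>)"
    by (simp add: MM.emeasure_eq_measure mult.commute ennreal_minus flip: ennreal_1)
qed

lemma GG_eq: assumes "\<beta> \<noteq> \<Phi>" "0 \<le> x" shows "GG \<beta> x = ennreal (\<Phi> * (exp ((\<beta> - \<Phi>) * x) - 1) / (\<beta> - \<Phi>))"
proof -
  have "GG \<beta> x = (\<integral>\<^sup>+s. ennreal (exponential_density \<Phi> s) * (of_bool (s \<le> x) * eexp (\<beta> * s)) \<partial>lborel)"
    unfolding GG_def RS_def[symmetric] by (subst distributed_nn_integral[OF RS_exponential]) auto
  also have "\<dots> = (\<integral>\<^sup>+s. ennreal \<Phi> * (of_bool (0 \<le> s \<and> s \<le> x) * eexp ((\<beta> - \<Phi>) * s)) \<partial>lborel)"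
    using \<Phi>0 by (intro nn_integral_cong)
      (auto simp: exponential_density_def ennreal_mult[symmetric] exp_add[symmetric] algebra_simps)
  also have "\<dots> = ennreal \<Phi> * ennreal ((exp ((\<beta> - \<Phi>) * x) - 1) / (\<beta> - \<Phi>))"
    using nn_integral_exp_Icc[of "\<beta> - \<Phi>" 0 x] assms by (simp add: nn_integral_cmult)
  also have "\<dots> = ennreal (\<Phi> * (exp ((\<beta> - \<Phi>) * x) - 1) / (\<beta> - \<Phi>))"
    using \<Phi>0 by (simp add: ennreal_mult'[symmetric])
  finally show ?thesis .
qed

text \<open>\<open>sup_tail_identity\<close> at level 1, with the two terms for the supremum made
  explicit. The product form avoids a division by \<open>\<psi> \<beta> - q\<close>, not yet known
  to be nonzero.\<close>

lemma inf_lt_product: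
  assumes "0 \<le> \<beta>" "\<beta> \<noteq> \<Phi>"
  shows "enn2real (inf_lt \<beta>) * (\<Phi> * (\<psi> \<beta> - q)) = q * (\<beta> - \<Phi>)"
proof -
  \<comment> \<open>\<open>\<Phi> * e\<close> is the value of \<open>GG \<beta> 1\<close>. Numerator
    and denominator have the same sign, so \<open>e\<close> is positive and cancels.\<close>
  define e where "e = (exp (\<beta> - \<Phi>) - 1) / (\<beta> - \<Phi>)"
  have e: "0 < e"
    unfolding e_def using assms(2) by (cases "\<beta> > \<Phi>") (auto intro!: divide_pos_pos divide_neg_neg)
  have "exp \<beta> * exp (- \<Phi>) = 1 + (\<psi> \<beta> - q) / q * (enn2real (inf_lt \<beta>) * (\<Phi> * e))"
  proof -
    have "GG \<beta> 1 = ennreal (\<Phi> * e)" using GG_eq[OF assms(2), of 1] by (simp add: e_def)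
    then have G: "enn2real (GG \<beta> 1) = \<Phi> * e" using e \<Phi>0 by simp
    have N: "enn2real (sup_tail 1) = exp (- \<Phi>)" using sup_tail_eq[of 1] by simp
    show ?thesis using sup_tail_identity[OF assms(1), of 1] unfolding G N by simp
  qed
  moreover have "exp \<beta> * exp (- \<Phi>) = 1 + e * (\<beta> - \<Phi>)"
    using assms(2) by (simp add: e_def exp_diff exp_minus divide_inverse mult.assoc)
  ultimately have "e * (\<beta> - \<Phi>) = e * ((\<psi> \<beta> - q) / q * (enn2real (inf_lt \<beta>) * \<Phi>))" by simp
  then have "\<beta> - \<Phi> = (\<psi> \<beta> - q) / q * (enn2real (inf_lt \<beta>) * \<Phi>)"
    by (rule mult_left_cancel[THEN iffD1, rotated]) (use e in simp)
  then show ?thesis using q by (simp add: field_simps)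
qed

text \<open>Read off from \<open>inf_lt_product\<close>: its right side is positive beyond \<Phi>,
  and the transform on the left is nonnegative.\<close>

lemma \<psi>_gt: assumes "\<Phi> < \<beta>" shows "q < \<psi> \<beta>"
proof -
  have "0 < q * (\<beta> - \<Phi>)" using assms q by simp
  then have "0 < enn2real (inf_lt \<beta>) * (\<Phi> * (\<psi> \<beta> - q))" using inf_lt_product[of \<beta>] assms \<Phi>0 by simp
  then have "0 < \<Phi> * (\<psi> \<beta> - q)" using enn2real_nonneg[of "inf_lt \<beta>"] by (auto simp: zero_less_mult_iff)
  then show ?thesis using \<Phi>0 by (simp add: zero_less_mult_iff)
qed

lemma inf_lt_le: "0 \<le> \<beta> \<Longrightarrow> inf_lt \<beta> \<le> 1"
  using LIMSEQ_le_const2[OF grid_inf_lt_tendsto, of \<beta> 1] grid_inf_lt_le[of \<beta>] by auto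

text \<open>The downward Wiener-Hopf factor: the value of \<open>inf_lt\<close> beyond
  \<Phi>.\<close>

definition "kr \<beta> = q * (\<beta> - \<Phi>) / (\<Phi> * (\<psi> \<beta> - q))"

lemma kr_pos: "\<Phi> < \<beta> \<Longrightarrow> 0 < kr \<beta>"
  using \<psi>_gt[of \<beta>] q \<Phi>0 by (simp add: kr_def)

lemma inf_lt_eq: assumes "\<Phi> < \<beta>" shows "inf_lt \<beta> = ennreal (kr \<beta>)"
proof -
  have "enn2real (inf_lt \<beta>) = kr \<beta>"
    using inf_lt_product[of \<beta>] assms \<Phi>0 \<psi>_gt[OF assms] by (simp add: kr_def eq_divide_eq)
  moreover have "inf_lt \<beta> \<le> 1" using assms \<Phi>0 by (intro inf_lt_le) simp
  ultimately show ?thesis by (metis ennreal_enn2real ennreal_one_less_top le_less_trans)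
qed

section \<open>The law of minus the infimum, its exponential tilts, and \<open>W\<close>\<close>

definition "F = distr MM borel (\<lambda>p. - RI p)"

lemma sets_F[measurable_cong, simp]: "sets F = sets borel" by (simp add: F_def)
lemma space_F[simp]: "space F = UNIV" by (simp add: F_def)

lemma prob_F: "prob_space F" unfolding F_def by (rule MM.prob_space_distr) measurable
sublocale F: prob_space F by (rule prob_F)

lemma AE_F_nonneg: "AE s in F. 0 \<le> s"
  unfolding F_def by (subst AE_distr_iff) (auto simp: RI_nonpos)

lemma nn_integral_F: "h \<in> borel_measurable borel \<Longrightarrow> (\<integral>\<^sup>+s. h s \<partial>F) = (\<integral>\<^sup>+p. h (- RI p) \<partial>MM)"
  unfolding F_def by (subst nn_integral_distr) auto

lemma F_laplace: "(\<integral>\<^sup>+s. eexp (- \<beta> * s) \<partial>F) = inf_lt \<beta>"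
  by (subst nn_integral_F) (auto simp: inf_lt_def RI_def)

text \<open>The tilt at \<Phi> represents \<open>W\<close>; tilts at larger \<beta> represent the
  overshoot transforms. Both use the distribution function.\<close>

definition "Qm \<beta> = density F (\<lambda>s. eexp (- \<beta> * s))"

lemma sets_Qm[measurable_cong, simp]: "sets (Qm \<beta>) = sets borel" by (simp add: Qm_def)

lemma finite_Qm: "0 \<le> \<beta> \<Longrightarrow> finite_borel_measure (Qm \<beta>)"
  using inf_lt_le[of \<beta>] F_laplace[of \<beta>]
  by (intro finite_borel_measure.intro finite_measureI finite_borel_measure_axioms.intro)
    (auto simp: Qm_def emeasure_density top_unique)

text \<open>Origin: \<open>1 / (\<psi> \<beta> - q)\<close> is \<open>kr \<beta>\<close>, the
  transform of \<open>F\<close>, times \<open>\<Phi> / (q * (\<beta> - \<Phi>))\<close>, the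
  transform of \<open>\<Phi> / q * exp (\<Phi> * x)\<close>. \<open>Wt\<close> is the convolution of
  the two.\<close>

definition "Wt x = \<Phi> / q * exp (\<Phi> * x) * cdf (Qm \<Phi>) x"

lemma Wt_nonneg: "0 \<le> Wt x"
  unfolding Wt_def using \<Phi>0 q by (simp add: cdf_def)

lemma Wt_ennreal: "ennreal (Wt x) = ennreal (\<Phi> / q * exp (\<Phi> * x)) * (\<integral>\<^sup>+s. of_bool (s \<le> x) * eexp (- \<Phi> * s) \<partial>F)"
proof -
  interpret finite_borel_measure "Qm \<Phi>" using finite_Qm \<Phi>0 by simp
  have "ennreal (cdf (Qm \<Phi>) x) = emeasure (Qm \<Phi>) {..x}" by (simp add: cdf_def emeasure_eq_measure)
  also have "\<dots> = (\<integral>\<^sup>+s. of_bool (s \<le> x) * eexp (- \<Phi> * s) \<partial>F)"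
    unfolding Qm_def by (subst emeasure_density) (auto intro!: nn_integral_cong simp: indicator_def)
  finally have c: "ennreal (cdf (Qm \<Phi>) x) = (\<integral>\<^sup>+s. of_bool (s \<le> x) * eexp (- \<Phi> * s) \<partial>F)" .
  have "ennreal (Wt x) = ennreal (\<Phi> / q * exp (\<Phi> * x)) * ennreal (cdf (Qm \<Phi>) x)"
    unfolding Wt_def by (rule ennreal_mult') (use \<Phi>0 q in simp)
  then show ?thesis by (simp only: c)
qed

lemma Wt_right_cont: "(Wt \<longlongrightarrow> Wt y) (at_right y)"
proof -
  interpret finite_borel_measure "Qm \<Phi>" using finite_Qm \<Phi>0 by simp
  have "(cdf (Qm \<Phi>) \<longlongrightarrow> cdf (Qm \<Phi>) y) (at_right y)"
    using cdf_is_right_cont[of y] by (simp add: continuous_within)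
  then show ?thesis unfolding Wt_def by (intro tendsto_mult[OF tendsto_mult[OF tendsto_const]] tendsto_intros)
qed

lemma Wt_meas[measurable]: "Wt \<in> borel_measurable borel"
proof -
  interpret finite_borel_measure "Qm \<Phi>" using finite_Qm \<Phi>0 by simp
  have [measurable]: "cdf (Qm \<Phi>) \<in> borel_measurable borel"
    by (intro borel_measurable_mono monoI cdf_nondecreasing)
  show ?thesis unfolding Wt_def by measurable
qed

lemma Wt_laplace:
  assumes \<beta>: "\<Phi> < \<beta>"
  shows "(\<integral>\<^sup>+x\<in>{0..}. eexp (- \<beta> * x) * ennreal (Wt x) \<partial>lborel) = ennreal (1 / (\<psi> \<beta> - q))"
proof -
  interpret pair_sigma_finite lborel F ..
  have "(\<integral>\<^sup>+x\<in>{0..}. eexp (- \<beta> * x) * ennreal (Wt x) \<partial>lborel)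
    = (\<integral>\<^sup>+x. (\<integral>\<^sup>+s. ennreal (\<Phi> / q) * (of_bool (0 \<le> x \<and> s \<le> x) * eexp (- (\<beta> - \<Phi>) * x) * eexp (- \<Phi> * s)) \<partial>F) \<partial>lborel)"
  proof (rule nn_integral_cong)
    fix x :: real
    have "eexp (- \<beta> * x) * ennreal (Wt x) * indicator {0..} x
      = (eexp (- \<beta> * x) * ennreal (\<Phi> / q * exp (\<Phi> * x)) * indicator {0..} x) * (\<integral>\<^sup>+s. of_bool (s \<le> x) * eexp (- \<Phi> * s) \<partial>F)"
      unfolding Wt_ennreal by (simp only: mult_ac)
    also have "\<dots> = (\<integral>\<^sup>+s. (eexp (- \<beta> * x) * ennreal (\<Phi> / q * exp (\<Phi> * x)) * indicator {0..} x) * (of_bool (s \<le> x) * eexp (- \<Phi> * s)) \<partial>F)"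
      by (rule nn_integral_cmult[symmetric]) measurable
    also have "\<dots> = (\<integral>\<^sup>+s. ennreal (\<Phi> / q) * (of_bool (0 \<le> x \<and> s \<le> x) * eexp (- (\<beta> - \<Phi>) * x) * eexp (- \<Phi> * s)) \<partial>F)"
      using \<Phi>0 q by (intro nn_integral_cong)
        (auto simp: indicator_def ennreal_mult[symmetric] exp_add[symmetric] algebra_simps)
    finally show "eexp (- \<beta> * x) * ennreal (Wt x) * indicator {0..} x
      = (\<integral>\<^sup>+s. ennreal (\<Phi> / q) * (of_bool (0 \<le> x \<and> s \<le> x) * eexp (- (\<beta> - \<Phi>) * x) * eexp (- \<Phi> * s)) \<partial>F)" .
  qed
  also have "\<dots> = (\<integral>\<^sup>+s. (\<integral>\<^sup>+x. ennreal (\<Phi> / q) * (of_bool (0 \<le> x \<and> s \<le> x) * eexp (- (\<beta> - \<Phi>) * x) * eexp (- \<Phi> * s)) \<partial>lborel) \<partial>F)"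
    by (rule Fubini'[symmetric]) measurable
  also have "\<dots> = (\<integral>\<^sup>+s. ennreal (\<Phi> / (q * (\<beta> - \<Phi>))) * eexp (- \<beta> * s) \<partial>F)"
  proof (rule nn_integral_cong_AE)
    show "AE s in F. (\<integral>\<^sup>+x. ennreal (\<Phi> / q) * (of_bool (0 \<le> x \<and> s \<le> x) * eexp (- (\<beta> - \<Phi>) * x) * eexp (- \<Phi> * s)) \<partial>lborel)
      = ennreal (\<Phi> / (q * (\<beta> - \<Phi>))) * eexp (- \<beta> * s)"
      using AE_F_nonneg
    proof eventually_elim
      case (elim s)
      have "(\<integral>\<^sup>+x. ennreal (\<Phi> / q) * (of_bool (0 \<le> x \<and> s \<le> x) * eexp (- (\<beta> - \<Phi>) * x) * eexp (- \<Phi> * s)) \<partial>lborel)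
        = (\<integral>\<^sup>+x. (ennreal (\<Phi> / q) * eexp (- \<Phi> * s)) * (of_bool (s \<le> x) * eexp (- (\<beta> - \<Phi>) * x)) \<partial>lborel)"
        using elim by (intro nn_integral_cong) (auto simp: mult_ac)
      also have "\<dots> = (ennreal (\<Phi> / q) * eexp (- \<Phi> * s)) * ennreal (exp (- (\<beta> - \<Phi>) * s) / (\<beta> - \<Phi>))"
        using nn_integral_exp_Ici[of "\<beta> - \<Phi>" s] \<beta> by (subst nn_integral_cmult) auto
      also have "\<dots> = ennreal (\<Phi> / (q * (\<beta> - \<Phi>))) * eexp (- \<beta> * s)"
      proof -
        have "\<Phi> / q * exp (- \<Phi> * s) * (exp (- (\<beta> - \<Phi>) * s) / (\<beta> - \<Phi>)) = \<Phi> / (q * (\<beta> - \<Phi>)) * exp (- \<beta> * s)"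
          by (simp add: exp_add[symmetric] algebra_simps)
        then show ?thesis using \<beta> \<Phi>0 q by (simp add: ennreal_mult[symmetric])
      qed
      finally show ?case .
    qed
  qed
  also have "\<dots> = ennreal (\<Phi> / (q * (\<beta> - \<Phi>))) * ennreal (kr \<beta>)"
  proof (subst nn_integral_cmult)
    show "ennreal (\<Phi> / (q * (\<beta> - \<Phi>))) * (\<integral>\<^sup>+s. eexp (- \<beta> * s) \<partial>F) = ennreal (\<Phi> / (q * (\<beta> - \<Phi>))) * ennreal (kr \<beta>)"
      by (simp only: F_laplace inf_lt_eq[OF \<beta>])
  qed measurable
  also have "\<dots> = ennreal (1 / (\<psi> \<beta> - q))"
    using \<beta> \<Phi>0 q kr_pos[OF \<beta>] \<psi>_gt[OF \<beta>] by (simp add: ennreal_mult[symmetric] kr_def)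
  finally show ?thesis .
qed

lemma W_mono: "0 \<le> x \<Longrightarrow> x \<le> y \<Longrightarrow> W x \<le> W y"
  using strict_mono_onD[OF Wm, of x y] by (cases "x = y") auto

lemma W_right_cont_nonneg: assumes "0 \<le> y" shows "(W \<longlongrightarrow> W y) (at_right y)"
proof -
  have "(W \<longlongrightarrow> W y) (at y within {0..})" using Wc assms by (auto simp: continuous_on_def)
  then show ?thesis by (rule tendsto_within_subset) (use assms in auto)
qed

text \<open>Equal transforms beyond \<Phi> give equality almost everywhere, and both functions are
  right continuous.\<close>

lemma W_eq_Wt: assumes x: "0 \<le> x" shows "W x = Wt x"
proof -
  \<comment> \<open>Monotonicity gives W \<ge> W 0 only. Adding the constant makes \<open>W\<close>
    nonnegative on [0, \<infinity>), as uniqueness for nonnegative integrals requires.\<close>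
  define c where "c = \<bar>W 0\<bar>"
  have cnn: "0 \<le> c" by (simp add: c_def)
  have Wpos: "0 \<le> W y + c" if "0 \<le> y" for y using W_mono[of 0 y] that by (simp add: c_def)
  have mW: "(\<lambda>x. indicator {0..} x * (W x + c)) \<in> borel_measurable borel"
    using borel_measurable_continuous_on_indicator[OF _ Wc] by (simp add: distrib_left)
  have cL: "(\<integral>\<^sup>+x. of_bool (0 \<le> x) * eexp (- l * x) * ennreal c \<partial>lborel) = ennreal (c / l)" if "0 < l" for l
    using nn_integral_exp_Ici[OF that, of 0] that by (subst nn_integral_multc) (auto simp: ennreal_mult'[symmetric] c_def)
  have gL: "(\<integral>\<^sup>+x\<in>{0..}. eexp (- l * x) * ennreal (Wt x + c) \<partial>lborel) = ennreal (1 / (\<psi> l - q) + c / l)" if l: "\<Phi> < l" for l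
  proof -
    have "(\<integral>\<^sup>+x\<in>{0..}. eexp (- l * x) * ennreal (Wt x + c) \<partial>lborel)
      = (\<integral>\<^sup>+x. (eexp (- l * x) * ennreal (Wt x)) * indicator {0..} x + of_bool (0 \<le> x) * eexp (- l * x) * ennreal c \<partial>lborel)"
      using Wt_nonneg by (intro nn_integral_cong) (auto simp: indicator_def c_def distrib_left)
    also have "\<dots> = (\<integral>\<^sup>+x\<in>{0..}. eexp (- l * x) * ennreal (Wt x) \<partial>lborel)
        + (\<integral>\<^sup>+x. of_bool (0 \<le> x) * eexp (- l * x) * ennreal c \<partial>lborel)"
      by (rule nn_integral_add) measurable
    also have "\<dots> = ennreal (1 / (\<psi> l - q)) + ennreal (c / l)"
      unfolding Wt_laplace[OF l] using cL[of l] l \<Phi>0 by simp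
    finally show ?thesis using \<psi>_gt[OF l] l \<Phi>0 by (simp add: c_def)
  qed
  have fL: "(\<integral>\<^sup>+x\<in>{0..}. eexp (- l * x) * ennreal (indicator {0..} x * (W x + c)) \<partial>lborel) = ennreal (1 / (\<psi> l - q) + c / l)" if l: "\<Phi> < l" for l
  proof -
    have i1: "integrable lborel (\<lambda>x. indicator {0..} x *\<^sub>R (exp (- l * x) * W x))"
      using Wi[OF l] by (simp add: set_integrable_def)
    have nnc: "(\<integral>\<^sup>+x. ennreal (indicator {0..} x * exp (- l * x) * c) \<partial>lborel) = ennreal (c / l)"
      using l \<Phi>0 by (subst cL[symmetric]) (auto intro!: nn_integral_cong simp: indicator_def c_def ennreal_mult)
    have i2: "integrable lborel (\<lambda>x. indicator {0..} x * exp (- l * x) * c)"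
    proof (rule integrableI_nonneg)
      show "(\<integral>\<^sup>+x. ennreal (indicator {0..} x * exp (- l * x) * c) \<partial>lborel) < \<infinity>" unfolding nnc by simp
    qed (use cnn in auto)
    have v2: "(\<integral>x. indicator {0..} x * exp (- l * x) * c \<partial>lborel) = c / l"
    proof -
      have "(\<integral>x. indicator {0..} x * exp (- l * x) * c \<partial>lborel) = enn2real (\<integral>\<^sup>+x. ennreal (indicator {0..} x * exp (- l * x) * c) \<partial>lborel)"
        by (rule integral_eq_nn_integral) (use cnn in auto)
      then show ?thesis unfolding nnc using l \<Phi>0 cnn by simp
    qed
    have "(\<integral>\<^sup>+x\<in>{0..}. eexp (- l * x) * ennreal (indicator {0..} x * (W x + c)) \<partial>lborel)
      = (\<integral>\<^sup>+x. ennreal (indicator {0..} x *\<^sub>R (exp (- l * x) * W x) + indicator {0..} x * exp (- l * x) * c) \<partial>lborel)"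
      using Wpos by (intro nn_integral_cong) (auto simp: indicator_def ennreal_mult[symmetric] algebra_simps)
    also have "\<dots> = ennreal (\<integral>x. indicator {0..} x *\<^sub>R (exp (- l * x) * W x) + indicator {0..} x * exp (- l * x) * c \<partial>lborel)"
    proof (rule nn_integral_eq_integral)
      have "0 \<le> exp (- l * x) * W x + exp (- l * x) * c" if "0 \<le> x" for x
        using Wpos[OF that] by (simp flip: distrib_left)
      then show "AE x in lborel. 0 \<le> indicator {0..} x *\<^sub>R (exp (- l * x) * W x) + indicator {0..} x * exp (- l * x) * c"
        by (auto simp: indicator_def)
    qed (intro Bochner_Integration.integrable_add i1 i2)
    also have "\<dots> = ennreal (1 / (\<psi> l - q) + c / l)"
      using i1 i2 v2 WL[OF l] by (simp add: set_lebesgue_integral_def)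
    finally show ?thesis .
  qed
  have "AE x in lborel. 0 \<le> x \<longrightarrow> ennreal (indicator {0..} x * (W x + c)) = ennreal (Wt x + c)"
  proof (rule AE_eq_laplace[of _ _ \<Phi>])
    show "(\<lambda>x. ennreal (indicator {0..} x * (W x + c))) \<in> borel_measurable borel"
      using mW by (rule measurable_compose) simp
    show "(\<lambda>x. ennreal (Wt x + c)) \<in> borel_measurable borel" by measurable
    show "(\<integral>\<^sup>+x\<in>{0..}. eexp (- l * x) * ennreal (indicator {0..} x * (W x + c)) \<partial>lborel)
      = (\<integral>\<^sup>+x\<in>{0..}. eexp (- l * x) * ennreal (Wt x + c) \<partial>lborel)" if "\<Phi> < l" for l
      unfolding fL[OF that] gL[OF that] ..
    show "(\<integral>\<^sup>+x\<in>{0..}. eexp (- l * x) * ennreal (indicator {0..} x * (W x + c)) \<partial>lborel) < \<infinity>" if "\<Phi> < l" for l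
      unfolding fL[OF that] by simp
  qed
  then have "AE x in lborel. 0 \<le> x \<longrightarrow> W x = Wt x"
  proof eventually_elim
    case (elim x)
    show ?case
    proof
      assume x: "0 \<le> x"
      then have "ennreal (W x + c) = ennreal (Wt x + c)" using elim by simp
      then have "W x + c = Wt x + c"
        by (subst (asm) ennreal_inj) (use Wpos[OF x] Wt_nonneg[of x] cnn in simp_all)
      then show "W x = Wt x" by simp
    qed
  qed
  then show ?thesis
    by (rule AE_lborel_right_continuous_eq[OF _ x W_right_cont_nonneg[OF x] Wt_right_cont])
qed

lemma W_nonneg: "0 \<le> W x"
  using W_eq_Wt[of x] Wt_nonneg[of x] W0[of x] by (cases "0 \<le> x") auto

lemma W_meas[measurable]: "W \<in> borel_measurable borel"
proof -
  have "W = (\<lambda>x. if 0 \<le> x then Wt x else 0)" using W_eq_Wt W0 by (auto simp: fun_eq_iff)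
  moreover have "(\<lambda>x. if 0 \<le> x then Wt x else 0) \<in> borel_measurable borel" by measurable
  ultimately show ?thesis by simp
qed

lemma W_mono': "x \<le> y \<Longrightarrow> W x \<le> W y"
  using W_mono[of x y] W0[of x] W_nonneg[of y] by (cases "0 \<le> x") auto

lemma W_right_cont: "(W \<longlongrightarrow> W y) (at_right y)"
proof (cases "0 \<le> y")
  case False
  then have "\<forall>\<^sub>F x in at_right y. x < 0" by (intro eventually_at_rightI[of y 0]) auto
  then have "\<forall>\<^sub>F x in at_right y. W x = W y" by eventually_elim (use False W0 in simp)
  then show ?thesis by (rule tendsto_eventually)
qed (rule W_right_cont_nonneg)

text \<open>The q-resolvent density at height z of the process started at y and killed on passing
  below 0.\<close>

definition "ww y z = W y * exp (- \<Phi> * z) - W (y - z)"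

text \<open>In the representation by \<open>Wt\<close>, the factor exp (- \<Phi> z) is exactly the
  ratio of the exponential prefactors; what remains is monotonicity of
  \<open>cdf (Qm \<Phi>)\<close>.\<close>

lemma ww_nonneg: assumes "0 \<le> z" shows "0 \<le> ww y z"
proof (cases "z \<le> y")
  case True
  interpret finite_borel_measure "Qm \<Phi>" using finite_Qm \<Phi>0 by simp
  have "cdf (Qm \<Phi>) (y - z) \<le> cdf (Qm \<Phi>) y" using assms by (intro cdf_nondecreasing) simp
  then have "\<Phi> / q * exp (\<Phi> * (y - z)) * cdf (Qm \<Phi>) (y - z) \<le> \<Phi> / q * exp (\<Phi> * (y - z)) * cdf (Qm \<Phi>) y"
    using \<Phi>0 q by (intro mult_left_mono) auto
  also have "\<dots> = Wt y * exp (- \<Phi> * z)"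
    unfolding Wt_def by (simp add: right_diff_distrib exp_diff exp_minus divide_inverse)
  finally show ?thesis using W_eq_Wt[of y] W_eq_Wt[of "y - z"] True assms by (simp add: ww_def Wt_def)
next
  case False
  then show ?thesis using W0[of "y - z"] W_nonneg[of y] by (simp add: ww_def)
qed

lemma ww_le: "0 \<le> z \<Longrightarrow> ww y z \<le> W y"
  using W_nonneg[of "y - z"] mult_left_mono[of "exp (- \<Phi> * z)" 1 "W y"] W_nonneg[of y] \<Phi>0 by (simp add: ww_def)

text \<open>An atom of \<open>F\<close> at y would be a jump of \<open>cdf (Qm \<Phi>)\<close>,
  which near y is a continuous function times \<open>W\<close>.\<close>

lemma F_no_atom: assumes y: "0 < y" shows "emeasure F {y} = 0"
proof -
  interpret finite_borel_measure "Qm \<Phi>" using finite_Qm \<Phi>0 by simp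
  have W': "isCont W y"
    using Wc y by (auto intro: continuous_on_interior)
  have cd: "cdf (Qm \<Phi>) x = q / \<Phi> * exp (- \<Phi> * x) * W x" if "0 \<le> x" for x
    unfolding W_eq_Wt[OF that] Wt_def using \<Phi>0 q by (simp add: exp_minus)
  have "isCont (\<lambda>x. q / \<Phi> * exp (- \<Phi> * x) * W x) y"
    by (intro continuous_intros W')
  moreover have "\<forall>\<^sub>F x in nhds y. cdf (Qm \<Phi>) x = q / \<Phi> * exp (- \<Phi> * x) * W x"
  proof -
    have "\<forall>\<^sub>F x in nhds y. x \<in> {0<..}" using y by (intro eventually_nhds_in_open) auto
    then show ?thesis by eventually_elim (rule cd, simp)
  qed
  ultimately have "isCont (cdf (Qm \<Phi>)) y" using isCont_cong by fast
  then have "measure (Qm \<Phi>) {y} = 0" by (simp add: isCont_cdf)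
  then have "emeasure (Qm \<Phi>) {y} = 0" by (simp add: emeasure_eq_measure)
  then have "{y} \<in> null_sets (Qm \<Phi>)" by auto
  then have "AE s in F. s \<in> {y} \<longrightarrow> eexp (- \<Phi> * s) = 0"
    unfolding Qm_def by (subst (asm) null_sets_density_iff) auto
  then have "AE s in F. s \<notin> {y}" by eventually_elim auto
  then have "{y} \<in> null_sets F" by (subst (asm) AE_iff_null_sets[symmetric]) auto
  then show ?thesis by auto
qed

text \<open>Laplace transform of the overshoot below \<open>- y\<close>, discounted at the passage time.\<close>

definition "overshoot_lt \<beta> y = eexp (\<beta> * y) * passage_lt \<beta> (- y)"

text \<open>\<open>down_identity\<close> divided by \<open>inf_lt \<beta>\<close>. The integral form
  is made for Fubini, the form with \<open>cdf\<close> for right continuity in y.\<close>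

lemma overshoot_lt_eq:
  assumes \<beta>: "\<Phi> < \<beta>" and y: "0 \<le> y"
  shows "overshoot_lt \<beta> y = (\<integral>\<^sup>+s. of_bool (y < s) * ennreal (exp (- \<beta> * (s - y)) / kr \<beta>) \<partial>F)"
    and "overshoot_lt \<beta> y = ennreal (exp (\<beta> * y) / kr \<beta> * (kr \<beta> - cdf (Qm \<beta>) y))"
proof -
  have \<beta>0: "0 \<le> \<beta>" using \<beta> \<Phi>0 by simp
  have k: "0 < kr \<beta>" by (rule kr_pos[OF \<beta>])
  have "(\<integral>\<^sup>+s. of_bool (y < s) * eexp (- \<beta> * s) \<partial>F) = (\<integral>\<^sup>+p. of_bool (RI p < - y) * eexp (\<beta> * RI p) \<partial>MM)"
    by (subst nn_integral_F) (auto intro!: nn_integral_cong simp: less_minus_iff)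
  also have "\<dots> = passage_lt \<beta> (- y) * ennreal (kr \<beta>)"
    unfolding RI_def using down_identity[OF \<beta>0, of "- y"] y by (simp add: inf_lt_eq[OF \<beta>])
  finally have e: "(\<integral>\<^sup>+s. of_bool (y < s) * eexp (- \<beta> * s) \<partial>F) = passage_lt \<beta> (- y) * ennreal (kr \<beta>)" .
  have "overshoot_lt \<beta> y = ennreal (exp (\<beta> * y) / kr \<beta>) * (passage_lt \<beta> (- y) * ennreal (kr \<beta>))"
  proof -
    have "ennreal (exp (\<beta> * y) / kr \<beta>) * (passage_lt \<beta> (- y) * ennreal (kr \<beta>)) = passage_lt \<beta> (- y) * (ennreal (exp (\<beta> * y) / kr \<beta>) * ennreal (kr \<beta>))"
      by (simp only: mult_ac)
    also have "ennreal (exp (\<beta> * y) / kr \<beta>) * ennreal (kr \<beta>) = eexp (\<beta> * y)"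
      using k by (simp add: ennreal_mult[symmetric])
    finally show ?thesis by (simp add: overshoot_lt_def mult.commute)
  qed
  then have o: "overshoot_lt \<beta> y = ennreal (exp (\<beta> * y) / kr \<beta>) * (\<integral>\<^sup>+s. of_bool (y < s) * eexp (- \<beta> * s) \<partial>F)"
    by (simp only: e)
  also have "\<dots> = (\<integral>\<^sup>+s. ennreal (exp (\<beta> * y) / kr \<beta>) * (of_bool (y < s) * eexp (- \<beta> * s)) \<partial>F)"
    by (rule nn_integral_cmult[symmetric]) measurable
  also have "\<dots> = (\<integral>\<^sup>+s. of_bool (y < s) * ennreal (exp (- \<beta> * (s - y)) / kr \<beta>) \<partial>F)"
    using k by (intro nn_integral_cong) (simp add: ennreal_mult[symmetric] exp_add[symmetric] algebra_simps)
  finally show "overshoot_lt \<beta> y = (\<integral>\<^sup>+s. of_bool (y < s) * ennreal (exp (- \<beta> * (s - y)) / kr \<beta>) \<partial>F)" .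
  interpret finite_borel_measure "Qm \<beta>" using finite_Qm[OF \<beta>0] .
  have "(\<integral>\<^sup>+s. of_bool (y < s) * eexp (- \<beta> * s) \<partial>F) = emeasure (Qm \<beta>) {y<..}"
    unfolding Qm_def by (subst emeasure_density) (auto intro!: nn_integral_cong simp: indicator_def)
  also have "\<dots> = ennreal (kr \<beta> - cdf (Qm \<beta>) y)"
  proof -
    have "emeasure (Qm \<beta>) UNIV = ennreal (kr \<beta>)"
      using F_laplace[of \<beta>] inf_lt_eq[OF \<beta>] by (simp add: Qm_def emeasure_density)
    then have "measure (Qm \<beta>) UNIV = kr \<beta>" using k by (simp add: emeasure_eq_measure)
    moreover have "measure (Qm \<beta>) {y<..} = measure (Qm \<beta>) UNIV - measure (Qm \<beta>) {..y}"
      by (subst finite_measure_Diff[symmetric]) (auto intro!: arg_cong[where f = "measure (Qm \<beta>)"])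
    ultimately show ?thesis by (simp add: emeasure_eq_measure cdf_def)
  qed
  finally show "overshoot_lt \<beta> y = ennreal (exp (\<beta> * y) / kr \<beta> * (kr \<beta> - cdf (Qm \<beta>) y))"
    using k o by (simp add: ennreal_mult'[symmetric])
qed

text \<open>By Fubini the integral over 0 \<le> y < s comes first. It leaves a difference of two
  exponentials in s, whose integrals against \<open>F\<close> are \<open>kr \<beta>\<close> and
  \<open>kr l\<close>.\<close>

lemma overshoot_lt_laplace:
  assumes \<beta>: "\<Phi> < \<beta>" and l: "\<beta> < l"
  shows "(\<integral>\<^sup>+y\<in>{0..}. eexp (- l * y) * overshoot_lt \<beta> y \<partial>lborel) = ennreal ((kr \<beta> - kr l) / (kr \<beta> * (l - \<beta>)))"
    and "kr l \<le> kr \<beta>"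
proof -
  interpret pair_sigma_finite lborel F ..
  have k: "0 < kr \<beta>" by (rule kr_pos[OF \<beta>])
  have "inf_lt l \<le> inf_lt \<beta>"
    unfolding F_laplace[symmetric]
    by (intro nn_integral_mono_AE, use AE_F_nonneg in eventually_elim) (use l in \<open>auto intro!: ennreal_leI mult_right_mono\<close>)
  then show kl: "kr l \<le> kr \<beta>" using inf_lt_eq[OF \<beta>] inf_lt_eq[of l] \<beta> l k by simp
  have "(\<integral>\<^sup>+y\<in>{0..}. eexp (- l * y) * overshoot_lt \<beta> y \<partial>lborel)
    = (\<integral>\<^sup>+y. \<integral>\<^sup>+s. of_bool (0 \<le> y \<and> y < s) * ennreal (exp (- l * y) * (exp (- \<beta> * (s - y)) / kr \<beta>)) \<partial>F \<partial>lborel)"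
  proof (rule nn_integral_cong)
    fix y :: real
    show "eexp (- l * y) * overshoot_lt \<beta> y * indicator {0..} y = (\<integral>\<^sup>+s. of_bool (0 \<le> y \<and> y < s) * ennreal (exp (- l * y) * (exp (- \<beta> * (s - y)) / kr \<beta>)) \<partial>F)"
    proof (cases "0 \<le> y")
      case True
      then show ?thesis unfolding overshoot_lt_eq(1)[OF \<beta> True]
        using k by (subst nn_integral_cmult[symmetric]) (auto intro!: nn_integral_cong simp: ennreal_mult[symmetric])
    qed simp
  qed
  also have "\<dots> = (\<integral>\<^sup>+s. \<integral>\<^sup>+y. of_bool (0 \<le> y \<and> y < s) * ennreal (exp (- l * y) * (exp (- \<beta> * (s - y)) / kr \<beta>)) \<partial>lborel \<partial>F)"
    by (rule Fubini'[symmetric]) measurable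
  also have "\<dots> = (\<integral>\<^sup>+s. ennreal (1 / (kr \<beta> * (l - \<beta>))) * (eexp (- \<beta> * s) - eexp (- l * s)) \<partial>F)"
  proof (rule nn_integral_cong_AE)
    show "AE s in F. (\<integral>\<^sup>+y. of_bool (0 \<le> y \<and> y < s) * ennreal (exp (- l * y) * (exp (- \<beta> * (s - y)) / kr \<beta>)) \<partial>lborel)
      = ennreal (1 / (kr \<beta> * (l - \<beta>))) * (eexp (- \<beta> * s) - eexp (- l * s))"
      using AE_F_nonneg
    proof eventually_elim
      case (elim s)
      have "(\<integral>\<^sup>+y. of_bool (0 \<le> y \<and> y < s) * ennreal (exp (- l * y) * (exp (- \<beta> * (s - y)) / kr \<beta>)) \<partial>lborel)
        = (\<integral>\<^sup>+y. ennreal (exp (- \<beta> * s) / kr \<beta>) * (of_bool (0 \<le> y \<and> y \<le> s) * eexp ((\<beta> - l) * y)) \<partial>lborel)"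
      proof (rule nn_integral_cong_AE)
        show "AE y in lborel. of_bool (0 \<le> y \<and> y < s) * ennreal (exp (- l * y) * (exp (- \<beta> * (s - y)) / kr \<beta>))
          = ennreal (exp (- \<beta> * s) / kr \<beta>) * (of_bool (0 \<le> y \<and> y \<le> s) * eexp ((\<beta> - l) * y))"
          using AE_lborel_singleton[of s]
          by eventually_elim (use k in \<open>auto simp: ennreal_mult[symmetric] exp_add[symmetric] algebra_simps\<close>)
      qed
      also have "\<dots> = ennreal (exp (- \<beta> * s) / kr \<beta>) * ennreal ((exp ((\<beta> - l) * s) - 1) / (\<beta> - l))"
        using nn_integral_exp_Icc[of "\<beta> - l" 0 s] elim l by (subst nn_integral_cmult) auto
      also have "\<dots> = ennreal (1 / (kr \<beta> * (l - \<beta>)) * (exp (- \<beta> * s) - exp (- l * s)))"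
      proof -
        have "exp (- \<beta> * s) / kr \<beta> * ((exp ((\<beta> - l) * s) - 1) / (\<beta> - l)) = 1 / (kr \<beta> * (l - \<beta>)) * (exp (- \<beta> * s) - exp (- l * s))"
        proof -
          have "exp (- l * s) = exp (- \<beta> * s) * exp ((\<beta> - l) * s)" by (simp add: exp_add[symmetric] algebra_simps)
          then show ?thesis using k l by (simp add: divide_simps) (simp add: algebra_simps)
        qed
        then show ?thesis using k by (simp add: ennreal_mult'[symmetric])
      qed
      also have "\<dots> = ennreal (1 / (kr \<beta> * (l - \<beta>))) * ennreal (exp (- \<beta> * s) - exp (- l * s))"
        by (rule ennreal_mult') (use k l in simp)
      also have "ennreal (exp (- \<beta> * s) - exp (- l * s)) = eexp (- \<beta> * s) - eexp (- l * s)"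
        by (simp add: ennreal_minus)
      finally show ?case .
    qed
  qed
  also have "\<dots> = ennreal (1 / (kr \<beta> * (l - \<beta>))) * (ennreal (kr \<beta>) - ennreal (kr l))"
  proof (subst nn_integral_cmult)
    have "(\<integral>\<^sup>+s. eexp (- \<beta> * s) - eexp (- l * s) \<partial>F) = (\<integral>\<^sup>+s. eexp (- \<beta> * s) \<partial>F) - (\<integral>\<^sup>+s. eexp (- l * s) \<partial>F)"
    proof (rule nn_integral_diff)
      show "(\<integral>\<^sup>+s. eexp (- l * s) \<partial>F) \<noteq> \<infinity>" unfolding F_laplace using inf_lt_eq[of l] \<beta> l by simp
      show "AE s in F. eexp (- l * s) \<le> eexp (- \<beta> * s)"
        using AE_F_nonneg by eventually_elim (use l in \<open>auto intro!: ennreal_leI mult_right_mono\<close>)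
    qed measurable
    then show "ennreal (1 / (kr \<beta> * (l - \<beta>))) * (\<integral>\<^sup>+s. eexp (- \<beta> * s) - eexp (- l * s) \<partial>F)
      = ennreal (1 / (kr \<beta> * (l - \<beta>))) * (ennreal (kr \<beta>) - ennreal (kr l))"
      using inf_lt_eq[OF \<beta>] inf_lt_eq[of l] \<beta> l by (simp only: F_laplace)
  qed measurable
  also have "\<dots> = ennreal ((kr \<beta> - kr l) / (kr \<beta> * (l - \<beta>)))"
    using k l kl kr_pos[of l] \<beta> by (simp add: ennreal_minus ennreal_mult'[symmetric])
  finally show "(\<integral>\<^sup>+y\<in>{0..}. eexp (- l * y) * overshoot_lt \<beta> y \<partial>lborel) = ennreal ((kr \<beta> - kr l) / (kr \<beta> * (l - \<beta>)))" .
qed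

end

section \<open>The overshoot law\<close>

definition theta :: "real \<Rightarrow> real \<Rightarrow> real" where
  "theta \<beta> u = exp (- \<beta> * u) - 1 + \<beta> * u * indicator {0<..<1} u"

lemma exp_minus_bounds:
  fixes x :: real
  assumes "0 \<le> x"
  shows "0 \<le> exp (- x) - 1 + x" "exp (- x) - 1 + x \<le> x\<^sup>2"
proof -
  show "0 \<le> exp (- x) - 1 + x" using exp_ge_add_one_self[of "- x"] by simp
  \<comment> \<open>The product is 1 + x^3.\<close>
  have "1 \<le> (1 + x) * (1 - x + x\<^sup>2)"
    using assms by (simp add: algebra_simps power2_eq_square)
  also have "\<dots> \<le> exp x * (1 - x + x\<^sup>2)"
  proof (rule mult_right_mono)
    show "1 + x \<le> exp x" by (rule exp_ge_add_one_self)
    have "0 \<le> (x - 1/2)\<^sup>2" by simp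
    then show "0 \<le> 1 - x + x\<^sup>2" by (simp add: power2_eq_square algebra_simps)
  qed
  finally have "exp (- x) * 1 \<le> exp (- x) * (exp x * (1 - x + x\<^sup>2))" by (intro mult_left_mono) auto
  then show "exp (- x) - 1 + x \<le> x\<^sup>2" by (simp add: mult.assoc[symmetric] exp_add[symmetric])
qed

text \<open>Compensation makes \<open>theta\<close> quadratic below 1, and from 1 on it lies between
  -1 and 0. The majorant is a multiple of the function that a Levy measure integrates.\<close>

lemma theta_bound:
  assumes "0 \<le> \<beta>" "0 < u"
  shows "\<bar>theta \<beta> u\<bar> \<le> max 1 (\<beta>\<^sup>2) * min 1 (u\<^sup>2)"
proof (cases "u < 1")
  case True
  have "\<bar>theta \<beta> u\<bar> \<le> (\<beta> * u)\<^sup>2"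
    using exp_minus_bounds[of "\<beta> * u"] assms True by (simp add: theta_def)
  also have "\<dots> = \<beta>\<^sup>2 * u\<^sup>2" by (simp add: power_mult_distrib)
  also have "\<dots> \<le> max 1 (\<beta>\<^sup>2) * u\<^sup>2" by (intro mult_right_mono) auto
  also have "u\<^sup>2 = min 1 (u\<^sup>2)" using True assms by (simp add: power_le_one min_absorb2)
  finally show ?thesis .
next
  case False
  then have "\<bar>theta \<beta> u\<bar> \<le> 1" using assms by (simp add: theta_def)
  also have "\<dots> \<le> max 1 (\<beta>\<^sup>2) * min 1 (u\<^sup>2)" using False by (simp add: min_absorb1)
  finally show ?thesis .
qed

locale levy_meas =
  fixes \<nu> :: "real measure"
  assumes lm: "levy_measure \<nu>"
begin

lemma sets_nu[measurable_cong, simp]: "sets \<nu> = sets borel" using lm by (simp add: levy_measure_def)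
lemma space_nu[simp]: "space \<nu> = UNIV" using sets_eq_imp_space_eq[OF sets_nu] by simp

lemma AE_nu_pos: "AE u in \<nu>. 0 < u"
proof -
  have "AE u in \<nu>. u \<notin> {..0}" using lm by (intro AE_not_in null_setsI) (auto simp: levy_measure_def)
  then show ?thesis by eventually_elim auto
qed

lemma nu_min: "(\<integral>\<^sup>+u. ennreal (min 1 (u\<^sup>2)) \<partial>\<nu>) < \<infinity>"
proof -
  have "(\<integral>\<^sup>+u. ennreal (min 1 (u\<^sup>2)) \<partial>\<nu>) = (\<integral>\<^sup>+u\<in>{0<..}. ennreal (min 1 (u\<^sup>2)) \<partial>\<nu>)"
    using AE_nu_pos by (intro nn_integral_cong_AE, eventually_elim) auto
  then show ?thesis using lm by (simp add: levy_measure_def)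
qed

lemma nu_tail: assumes "0 < e" shows "emeasure \<nu> {e<..} < \<infinity>"
proof -
  have "ennreal (min 1 (e\<^sup>2)) * emeasure \<nu> {e<..} = (\<integral>\<^sup>+u. ennreal (min 1 (e\<^sup>2)) * indicator {e<..} u \<partial>\<nu>)"
    by (simp add: nn_integral_cmult_indicator)
  also have "\<dots> \<le> (\<integral>\<^sup>+u. ennreal (min 1 (u\<^sup>2)) \<partial>\<nu>)"
  proof (rule nn_integral_mono)
    fix u
    have "min 1 (e\<^sup>2) \<le> min 1 (u\<^sup>2)" if "e < u"
    proof -
      have "e\<^sup>2 \<le> u\<^sup>2" using that assms by (intro power_mono) auto
      then show ?thesis by (auto simp: min_def)
    qed
    then show "ennreal (min 1 (e\<^sup>2)) * indicator {e<..} u \<le> ennreal (min 1 (u\<^sup>2))"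
      by (auto simp: indicator_def intro!: ennreal_leI)
  qed
  finally have "ennreal (min 1 (e\<^sup>2)) * emeasure \<nu> {e<..} < top" using nu_min le_less_trans by auto
  moreover have "0 < min 1 (e\<^sup>2)" using assms by simp
  ultimately show ?thesis by (auto simp: ennreal_mult_less_top)
qed

text \<open>Tails away from 0 have finite mass and exhaust the positive axis. Sigma-finiteness is
  what Fubini on the product with \<open>lborel\<close> requires.\<close>

sublocale nu: sigma_finite_measure \<nu>
proof
  show "\<exists>A. countable A \<and> A \<subseteq> sets \<nu> \<and> \<Union> A = space \<nu> \<and> (\<forall>a\<in>A. emeasure \<nu> a \<noteq> \<infinity>)"
  proof (intro exI conjI)
    show "countable (insert {..0} (range (\<lambda>n. {1 / real (Suc n)<..})))" by simp
    show "insert {..0} (range (\<lambda>n. {1 / real (Suc n)<..})) \<subseteq> sets \<nu>" by auto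
    have "\<exists>n. 1 / real (Suc n) < x" if "0 < x" for x
      using reals_Archimedean[OF that] by (auto simp: inverse_eq_divide)
    then show "\<Union> (insert {..0} (range (\<lambda>n. {1 / real (Suc n)<..}))) = space \<nu>"
      by (auto simp: not_le) (meson not_le)
    show "\<forall>a\<in>insert {..0} (range (\<lambda>n. {1 / real (Suc n)<..})). emeasure \<nu> a \<noteq> \<infinity>"
    proof
      fix a assume "a \<in> insert {..0} (range (\<lambda>n. {1 / real (Suc n)<..}))"
      then show "emeasure \<nu> a \<noteq> \<infinity>"
      proof
        assume "a = {..0}" then show ?thesis using lm by (simp add: levy_measure_def)
      next
        assume "a \<in> range (\<lambda>n. {1 / real (Suc n)<..})"
        then obtain n where "a = {1 / real (Suc n)<..}" by blast
        then show ?thesis using nu_tail[of "1 / real (Suc n)"] by simp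
      qed
    qed
  qed
qed

lemma theta_meas[measurable]: "theta \<beta> \<in> borel_measurable borel"
  unfolding theta_def by measurable

lemma theta_integrable: assumes "0 \<le> \<beta>" shows "integrable \<nu> (\<lambda>u. indicator {0<..} u * theta \<beta> u)"
proof (rule Bochner_Integration.integrable_bound)
  show "integrable \<nu> (\<lambda>u. max 1 (\<beta>\<^sup>2) * min 1 (u\<^sup>2))"
    using nu_min by (intro integrable_mult_right integrableI_nonneg) auto
  show "AE u in \<nu>. norm (indicator {0<..} u * theta \<beta> u) \<le> norm (max 1 (\<beta>\<^sup>2) * min 1 (u\<^sup>2))"
    using theta_bound[OF assms] by (auto simp: indicator_def)
qed measurable

definition "J \<beta> = (\<integral>u. indicator {0<..} u * theta \<beta> u \<partial>\<nu>)"

lemma laplace_exponent_J: "laplace_exponent c \<sigma> \<nu> \<beta> = c * \<beta> + 1/2 * \<sigma>\<^sup>2 * \<beta>\<^sup>2 + J \<beta>"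
  by (simp add: laplace_exponent_def J_def theta_def set_lebesgue_integral_def)

end

section \<open>The overshoot transform predicted by the Levy measure\<close>

locale snl_nu = snl_scale M Y \<psi> q \<Phi> W + levy_meas \<nu>
  for M :: "'a measure" and Y \<psi> q \<Phi> W \<nu> +
  fixes c \<sigma> :: real
  assumes \<psi>_def: "\<And>\<beta>. 0 \<le> \<beta> \<Longrightarrow> \<psi> \<beta> = c * \<beta> + 1/2 * \<sigma>\<^sup>2 * \<beta>\<^sup>2 + J \<beta>"
begin

text \<open>A point (u, z) stands for a jump of size u from height z above the level; for z \<le> u
  it ends at distance u - z below it.\<close>

definition "N = \<nu> \<Otimes>\<^sub>M lborel"

sublocale pN: pair_sigma_finite \<nu> lborel ..
sublocale N: sigma_finite_measure N unfolding N_def by (rule pN.P.sigma_finite_measure_axioms)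
sublocale LN: pair_sigma_finite lborel N ..

text \<open>This is exp (- \<beta> v) - exp (- (\<beta> + 1) v), factored so that sign and smallness
  at 0 are visible.\<close>

definition "gw \<beta> v = exp (- \<beta> * v) * (1 - exp (- v))" for \<beta> v :: real

lemma gw_nonneg: "0 \<le> v \<Longrightarrow> 0 \<le> gw \<beta> v" by (simp add: gw_def)

lemma gw_meas[measurable]: "gw \<beta> \<in> borel_measurable borel" unfolding gw_def by measurable

lemma ww_meas[measurable]: "(\<lambda>p. ww (fst p) (snd p)) \<in> borel_measurable (borel \<Otimes>\<^sub>M borel)"
  unfolding ww_def by measurable

definition "G \<beta> p = of_bool (0 \<le> snd p \<and> snd p \<le> fst p) * ennreal (gw \<beta> (fst p - snd p))"

lemma G_meas[measurable]: "G \<beta> \<in> borel_measurable N"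
  unfolding G_def N_def by measurable

text \<open>The integral of \<open>gw \<beta>\<close> over the overshoot when jumps (u, z) are
  weighted by the resolvent density \<open>ww\<close>.\<close>

definition "H \<beta> y = (\<integral>\<^sup>+p. G \<beta> p * ennreal (ww y (snd p)) \<partial>N)"

text \<open>Integration over 0 \<le> z \<le> u gives at most u^2, since \<open>gw \<beta> v\<close>
  is at most v, and at most 1 / \<beta>, by dropping the factor 1 - exp (- v). A single exponential
  would be of order u only, which a Levy measure need not integrate near 0.\<close>

lemma G_finite: assumes \<beta>: "0 < \<beta>" shows "(\<integral>\<^sup>+p. G \<beta> p \<partial>N) < \<infinity>"
proof -
  \<comment> \<open>Covers both regimes: u^2 for small jumps, 1 / \<beta> for large ones.\<close>
  define C where "C = max 1 (1 / \<beta>)"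
  have C: "1 \<le> C" "1 / \<beta> \<le> C" "0 \<le> C" by (auto simp: C_def)
  have in1: "(\<integral>\<^sup>+z. G \<beta> (u, z) \<partial>lborel) \<le> ennreal (C * min 1 (u\<^sup>2))" if u: "0 < u" for u
  proof -
    have "(\<integral>\<^sup>+z. G \<beta> (u, z) \<partial>lborel) \<le> (\<integral>\<^sup>+z. ennreal u * indicator {0..u} z \<partial>lborel)"
    proof (rule nn_integral_mono)
      fix z
      have "gw \<beta> (u - z) \<le> u" if "0 \<le> z" "z \<le> u"
      proof -
        have "gw \<beta> (u - z) \<le> 1 * (u - z)"
        proof -
          have "1 - exp (- (u - z)) \<le> u - z" using exp_ge_add_one_self[of "- (u - z)"] by linarith
          then show ?thesis unfolding gw_def by (intro mult_mono) (use that \<beta> in auto)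
        qed
        then show ?thesis using that by simp
      qed
      then show "G \<beta> (u, z) \<le> ennreal u * indicator {0..u} z"
        by (auto simp: G_def indicator_def intro!: ennreal_leI)
    qed
    also have "\<dots> = ennreal (u\<^sup>2)" using u by (simp add: nn_integral_cmult_indicator ennreal_mult[symmetric] power2_eq_square)
    finally have 1: "(\<integral>\<^sup>+z. G \<beta> (u, z) \<partial>lborel) \<le> ennreal (u\<^sup>2)" .
    have "(\<integral>\<^sup>+z. G \<beta> (u, z) \<partial>lborel) \<le> (\<integral>\<^sup>+z. eexp (- \<beta> * u) * (of_bool (0 \<le> z \<and> z \<le> u) * eexp (\<beta> * z)) \<partial>lborel)"
    proof (rule nn_integral_mono)
      fix z
      have "gw \<beta> (u - z) \<le> exp (- \<beta> * u) * exp (\<beta> * z)" if "0 \<le> z" "z \<le> u"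
      proof -
        have "gw \<beta> (u - z) \<le> exp (- \<beta> * (u - z)) * 1"
          unfolding gw_def using that by (intro mult_left_mono) auto
        then show ?thesis by (simp add: exp_add[symmetric] algebra_simps)
      qed
      then show "G \<beta> (u, z) \<le> eexp (- \<beta> * u) * (of_bool (0 \<le> z \<and> z \<le> u) * eexp (\<beta> * z))"
        by (auto simp: G_def ennreal_mult[symmetric] intro!: ennreal_leI)
    qed
    also have "\<dots> = eexp (- \<beta> * u) * ennreal ((exp (\<beta> * u) - 1) / \<beta>)"
      using nn_integral_exp_Icc[of \<beta> 0 u] \<beta> u by (subst nn_integral_cmult) auto
    also have "\<dots> = ennreal ((1 - exp (- \<beta> * u)) / \<beta>)"
      using \<beta> by (simp add: ennreal_mult'[symmetric] right_diff_distrib exp_add[symmetric])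
    also have "\<dots> \<le> ennreal (1 / \<beta>)" using \<beta> by (intro ennreal_leI divide_right_mono) auto
    finally have 2: "(\<integral>\<^sup>+z. G \<beta> (u, z) \<partial>lborel) \<le> ennreal (1 / \<beta>)" .
    show ?thesis
    proof (cases "u\<^sup>2 \<le> 1")
      case True
      have "u\<^sup>2 \<le> C * min 1 (u\<^sup>2)" using True C mult_right_mono[of 1 C "u\<^sup>2"] by (simp add: min_absorb2)
      then show ?thesis using 1 ennreal_leI order_trans by blast
    next
      case False
      have "1 / \<beta> \<le> C * min 1 (u\<^sup>2)" using False C by (simp add: min_absorb1)
      then show ?thesis using 2 ennreal_leI order_trans by blast
    qed
  qed
  have "(\<integral>\<^sup>+p. G \<beta> p \<partial>N) = (\<integral>\<^sup>+u. \<integral>\<^sup>+z. G \<beta> (u, z) \<partial>lborel \<partial>\<nu>)"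
    using G_meas unfolding N_def by (subst lborel.nn_integral_fst[symmetric]) auto
  also have "\<dots> \<le> (\<integral>\<^sup>+u. ennreal (C * min 1 (u\<^sup>2)) \<partial>\<nu>)"
    by (intro nn_integral_mono_AE, use AE_nu_pos in eventually_elim) (rule in1)
  also have "\<dots> = ennreal C * (\<integral>\<^sup>+u. ennreal (min 1 (u\<^sup>2)) \<partial>\<nu>)"
    using C by (subst nn_integral_cmult[symmetric]) (auto simp: ennreal_mult')
  also have "\<dots> < \<infinity>" using nu_min by (simp add: ennreal_mult_less_top)
  finally show ?thesis .
qed

lemma GW_meas[measurable]: "(\<lambda>p. G \<beta> p * ennreal (ww y (snd p))) \<in> borel_measurable N"
proof -
  have "(\<lambda>p. ennreal (ww y (snd p))) \<in> borel_measurable N" unfolding N_def ww_def by measurable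
  then show ?thesis by measurable
qed

lemma GW_le: "p \<in> space N \<Longrightarrow> y \<le> B \<Longrightarrow> G \<beta> p * ennreal (ww y (snd p)) \<le> G \<beta> p * ennreal (W B)"
  using ww_le[of "snd p" y] W_mono'[of y B] by (auto simp: G_def intro!: mult_left_mono ennreal_leI)

lemma GWB_finite: "0 < \<beta> \<Longrightarrow> (\<integral>\<^sup>+p. G \<beta> p * ennreal (W B) \<partial>N) < \<infinity>"
  using G_finite[of \<beta>] by (subst nn_integral_multc) (auto simp: ennreal_mult_less_top)

lemma H_finite: "0 < \<beta> \<Longrightarrow> H \<beta> y < \<infinity>"
  unfolding H_def using nn_integral_mono[of N "\<lambda>p. G \<beta> p * ennreal (ww y (snd p))" "\<lambda>p. G \<beta> p * ennreal (W y)"] GW_le[of _ y y] GWB_finite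
  by (meson le_less_trans order_refl)

text \<open>Dominated convergence along sequences decreasing to y. \<open>W\<close> may jump at 0,
  but y - z is also approached from the right, so right continuity of \<open>W\<close>
  suffices.\<close>

lemma H_right_cont: assumes \<beta>: "0 < \<beta>" shows "((\<lambda>y. enn2real (H \<beta> y)) \<longlongrightarrow> enn2real (H \<beta> y)) (at_right y)"
  unfolding tendsto_at_iff_sequentially comp_def
proof (intro allI impI)
  fix X :: "nat \<Rightarrow> real" assume X: "\<forall>i. X i \<in> {y<..} - {y}" "X \<longlonglongrightarrow> y"
  have "Bseq X" using X(2) convergentI convergent_imp_Bseq by blast
  then obtain B where B: "\<And>i. X i \<le> B" by (auto simp: Bseq_def abs_le_iff)
  have Xy: "y < X i" "X i \<noteq> y" for i using X(1) by auto
  have Xr: "filterlim X (at_right y) sequentially"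
    by (simp add: filterlim_at X(2) Xy)
  have "(\<lambda>i. H \<beta> (X i)) \<longlonglongrightarrow> H \<beta> y"
    unfolding H_def
  proof (rule nn_integral_dominated_convergence[where w = "\<lambda>p. G \<beta> p * ennreal (W B)"])
    show "(\<integral>\<^sup>+p. G \<beta> p * ennreal (W B) \<partial>N) < \<infinity>" by (rule GWB_finite[OF \<beta>])
    show "AE p in N. G \<beta> p * ennreal (ww (X j) (snd p)) \<le> G \<beta> p * ennreal (W B)" for j
      using GW_le B by auto
    have "(\<lambda>i. G \<beta> p * ennreal (ww (X i) (snd p))) \<longlonglongrightarrow> G \<beta> p * ennreal (ww y (snd p))" for p
    proof (intro ennreal_tendsto_cmult tendsto_ennrealI)
      have 1: "(\<lambda>i. W (X i)) \<longlonglongrightarrow> W y" using W_right_cont Xr by (rule filterlim_compose)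
      have "filterlim (\<lambda>i. X i - snd p) (at_right (y - snd p)) sequentially"
        using tendsto_diff[OF X(2) tendsto_const[of "snd p"]] by (simp add: filterlim_at Xy)
      with W_right_cont have 2: "(\<lambda>i. W (X i - snd p)) \<longlonglongrightarrow> W (y - snd p)" by (rule filterlim_compose)
      show "(\<lambda>i. ww (X i) (snd p)) \<longlonglongrightarrow> ww y (snd p)"
        unfolding ww_def by (intro tendsto_intros 1 2)
      show "G \<beta> p < top" by (simp add: G_def ennreal_mult_less_top)
    qed
    then show "AE p in N. (\<lambda>i. G \<beta> p * ennreal (ww (X i) (snd p))) \<longlonglongrightarrow> G \<beta> p * ennreal (ww y (snd p))" by simp
  qed measurable
  then have "(\<lambda>i. H \<beta> (X i)) \<longlonglongrightarrow> ennreal (enn2real (H \<beta> y))"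
    using H_finite[OF \<beta>, of y] by (simp add: less_top[symmetric])
  then show "(\<lambda>i. enn2real (H \<beta> (X i))) \<longlonglongrightarrow> enn2real (H \<beta> y)"
    by (rule tendsto_enn2real) simp
qed

lemma W_laplace:
  assumes l: "\<Phi> < l" shows "(\<integral>\<^sup>+y\<in>{0..}. eexp (- l * y) * ennreal (W y) \<partial>lborel) = ennreal (1 / (\<psi> l - q))"
  unfolding Wt_laplace[OF l, symmetric] by (intro nn_integral_cong) (auto simp: indicator_def W_eq_Wt)

text \<open>The shifted function W (y - z) has transform exp (- l z) times that of \<open>W\<close>.
  It is added to both sides so that no subtraction of infinite integrals can occur; nonnegativity of
  \<open>ww\<close> allows the splitting.\<close>

lemma ww_laplace:
  assumes l: "\<Phi> < l" and z: "0 \<le> z"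
  shows "(\<integral>\<^sup>+y\<in>{0..}. eexp (- l * y) * ennreal (ww y z) \<partial>lborel) = ennreal ((exp (- \<Phi> * z) - exp (- l * z)) / (\<psi> l - q))"
proof -
  have P: "0 < \<psi> l - q" using \<psi>_gt[OF l] by simp
  define A where "A = (\<integral>\<^sup>+y\<in>{0..}. eexp (- l * y) * ennreal (ww y z) \<partial>lborel)"
  have "(\<integral>\<^sup>+y\<in>{0..}. eexp (- l * y) * ennreal (W (y - z)) \<partial>lborel)
    = (\<integral>\<^sup>+x. eexp (- l * (z + 1 * x)) * ennreal (W (z + 1 * x - z)) * indicator {0..} (z + 1 * x) \<partial>lborel)"
    by (subst nn_integral_real_affine[where c = 1 and t = z]) auto
  also have "\<dots> = (\<integral>\<^sup>+x. eexp (- l * z) * (eexp (- l * x) * ennreal (W x) * indicator {0..} x) \<partial>lborel)"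
    using z W0 by (intro nn_integral_cong) (auto simp: indicator_def ennreal_mult[symmetric] exp_add[symmetric] algebra_simps W_nonneg)
  also have "\<dots> = eexp (- l * z) * ennreal (1 / (\<psi> l - q))"
    by (subst nn_integral_cmult) (auto simp only: W_laplace[OF l], measurable)
  finally have B: "(\<integral>\<^sup>+y\<in>{0..}. eexp (- l * y) * ennreal (W (y - z)) \<partial>lborel) = ennreal (exp (- l * z) / (\<psi> l - q))"
    using P by (simp add: ennreal_mult[symmetric])
  have "A + ennreal (exp (- l * z) / (\<psi> l - q))
    = (\<integral>\<^sup>+y. eexp (- l * y) * ennreal (ww y z) * indicator {0..} y + eexp (- l * y) * ennreal (W (y - z)) * indicator {0..} y \<partial>lborel)"
    unfolding A_def B[symmetric] by (rule nn_integral_add[symmetric]) (auto simp: ww_def)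
  also have "\<dots> = (\<integral>\<^sup>+y. eexp (- \<Phi> * z) * (eexp (- l * y) * ennreal (W y) * indicator {0..} y) \<partial>lborel)"
  proof (rule nn_integral_cong)
    fix y
    have "ennreal (ww y z) + ennreal (W (y - z)) = ennreal (exp (- \<Phi> * z) * W y)"
      using ww_nonneg[OF z, of y] W_nonneg[of "y - z"] by (simp add: ww_def mult.commute flip: ennreal_plus)
    then show "eexp (- l * y) * ennreal (ww y z) * indicator {0..} y + eexp (- l * y) * ennreal (W (y - z)) * indicator {0..} y
      = eexp (- \<Phi> * z) * (eexp (- l * y) * ennreal (W y) * indicator {0..} y)"
      by (simp add: distrib_left[symmetric] distrib_right[symmetric] ennreal_mult W_nonneg mult_ac)
  qed
  also have "\<dots> = eexp (- \<Phi> * z) * ennreal (1 / (\<psi> l - q))"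
    by (subst nn_integral_cmult) (auto simp only: W_laplace[OF l], measurable)
  finally have e: "A + ennreal (exp (- l * z) / (\<psi> l - q)) = ennreal (exp (- \<Phi> * z) / (\<psi> l - q))"
    using P by (simp add: ennreal_mult[symmetric])
  then obtain a where a: "A = ennreal a" "0 \<le> a" by (cases A) auto
  have "a + exp (- l * z) / (\<psi> l - q) = exp (- \<Phi> * z) / (\<psi> l - q)"
    using e a P by (simp flip: ennreal_plus)
  then have "a = (exp (- \<Phi> * z) - exp (- l * z)) / (\<psi> l - q)" by (simp add: diff_divide_distrib)
  then show ?thesis using a A_def by simp
qed

text \<open>\<open>K a b\<close> is a primitive of exp (- a (u - z)) exp (- b z) when a and b
  differ, and the product expands into four such terms. The order of the exponents makes the
  integrand nonnegative.\<close>

lemma exp_convolution: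
  fixes a b a' b' u :: real
  assumes ne: "a \<noteq> b" "a \<noteq> b'" "a' \<noteq> b" "a' \<noteq> b'" and le: "a \<le> a'" "b \<le> b'" and u: "0 \<le> u"
  shows "(\<integral>\<^sup>+z. of_bool (0 \<le> z \<and> z \<le> u) * ennreal ((exp (- a * (u - z)) - exp (- a' * (u - z))) * (exp (- b * z) - exp (- b' * z))) \<partial>lborel)
    = ennreal ((exp (- b * u) - exp (- a * u)) / (a - b) - (exp (- b' * u) - exp (- a * u)) / (a - b')
        - (exp (- b * u) - exp (- a' * u)) / (a' - b) + (exp (- b' * u) - exp (- a' * u)) / (a' - b'))"
proof -
  define K where "K a b z = exp (- a * (u - z) - b * z) / (a - b)" for a b z :: real
  define FF where "FF z = K a b z - K a b' z - K a' b z + K a' b' z" for z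
  have dK: "(K a b has_real_derivative exp (- a * (u - z)) * exp (- b * z)) (at z)" if "a \<noteq> b" for a b z
  proof -
    have "((\<lambda>z. exp (- a * (u - z) - b * z)) has_real_derivative (a - b) * exp (- a * (u - z) - b * z)) (at z)"
      by (auto intro!: derivative_eq_intros simp: algebra_simps)
    from DERIV_cdivide[OF this, of "a - b"] show ?thesis
      unfolding K_def using that by (simp add: mult_exp_exp)
  qed
  have "(\<integral>\<^sup>+z. of_bool (0 \<le> z \<and> z \<le> u) * ennreal ((exp (- a * (u - z)) - exp (- a' * (u - z))) * (exp (- b * z) - exp (- b' * z))) \<partial>lborel)
    = (\<integral>\<^sup>+z. ennreal ((exp (- a * (u - z)) - exp (- a' * (u - z))) * (exp (- b * z) - exp (- b' * z))) * indicator {0..u} z \<partial>lborel)"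
    by (intro nn_integral_cong) (auto simp: indicator_def)
  also have "\<dots> = ennreal (FF u - FF 0)"
  proof (rule nn_integral_FTC_Icc[where F = FF])
    fix z assume "z \<in> {0..u}"
    then have z: "0 \<le> z" "z \<le> u" by auto
    show "0 \<le> (exp (- a * (u - z)) - exp (- a' * (u - z))) * (exp (- b * z) - exp (- b' * z))"
      using z le by (intro mult_nonneg_nonneg) (auto intro!: mult_right_mono)
    have "(FF has_real_derivative (exp (- a * (u - z)) * exp (- b * z) - exp (- a * (u - z)) * exp (- b' * z)
        - exp (- a' * (u - z)) * exp (- b * z) + exp (- a' * (u - z)) * exp (- b' * z))) (at z)"
      unfolding FF_def by (intro DERIV_add DERIV_diff dK ne)
    then show "(FF has_real_derivative (exp (- a * (u - z)) - exp (- a' * (u - z))) * (exp (- b * z) - exp (- b' * z))) (at z)"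
      by (simp add: algebra_simps)
  qed (use u in auto)
  also have "FF u - FF 0 = (exp (- b * u) - exp (- a * u)) / (a - b) - (exp (- b' * u) - exp (- a * u)) / (a - b')
        - (exp (- b * u) - exp (- a' * u)) / (a' - b) + (exp (- b' * u) - exp (- a' * u)) / (a' - b')"
    by (simp add: FF_def K_def diff_divide_distrib)
  finally show ?thesis .
qed

text \<open>Drift and Gaussian part contribute to a difference quotient of \<psi> a constant and a
  multiple of a + b. In an alternating sum over two values of a and two of b both contributions
  cancel, which is why a difference in \<beta> eliminates them.\<close>

lemma J_quotient:
  assumes "0 \<le> a" "0 \<le> b" "a \<noteq> b"
  shows "(J a - J b) / (a - b) = (\<psi> a - \<psi> b) / (a - b) - c - \<sigma>\<^sup>2 / 2 * (a + b)"
proof -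
  have "\<psi> a - \<psi> b = (c + \<sigma>\<^sup>2 / 2 * (a + b)) * (a - b) + (J a - J b)"
    using assms(1,2) by (simp add: \<psi>_def field_simps power2_eq_square)
  then have "(\<psi> a - \<psi> b) / (a - b) = c + \<sigma>\<^sup>2 / 2 * (a + b) + (J a - J b) / (a - b)"
    using assms(3) by (simp add: add_divide_distrib)
  then show ?thesis by simp
qed

text \<open>Tonelli reduces the transform to \<open>ww_laplace\<close>, the integral over z to
  \<open>exp_convolution\<close>, and the integral over \<nu> to difference quotients of
  \<open>J\<close>. The right side is written as the difference of
  \<open>overshoot_lt_laplace\<close> at \<beta> and \<beta> + 1, which is the comparison aimed
  at.\<close>

lemma H_laplace:
  assumes \<beta>: "\<Phi> < \<beta>" and l: "\<beta> + 1 < l"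
  shows "(\<integral>\<^sup>+y\<in>{0..}. eexp (- l * y) * H \<beta> y \<partial>lborel)
    = ennreal ((kr \<beta> - kr l) / (kr \<beta> * (l - \<beta>)) - (kr (\<beta> + 1) - kr l) / (kr (\<beta> + 1) * (l - (\<beta> + 1))))"
proof -
  have l': "\<Phi> < l" using \<beta> l by simp
  have P: "0 < \<psi> l - q" using \<psi>_gt[OF l'] by simp
  have \<beta>0: "0 < \<beta>" using \<beta> \<Phi>0 by simp
  let ?a = \<beta> and ?a' = "\<beta> + 1" and ?b = \<Phi> and ?b' = l
  \<comment> \<open>The value of \<open>exp_convolution\<close> with \<open>theta\<close> in place
    of plain exponentials: the compensators add the same term to all four quotients and cancel. Each
    \<open>theta\<close> is integrable against \<nu>, so the sum can be integrated term by
    term.\<close>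
  define th where "th u = - (theta ?a u - theta ?b u) / (?a - ?b) + (theta ?a u - theta ?b' u) / (?a - ?b')
     + (theta ?a' u - theta ?b u) / (?a' - ?b) - (theta ?a' u - theta ?b' u) / (?a' - ?b')" for u
  have th: "(\<integral>\<^sup>+z. of_bool (0 \<le> z \<and> z \<le> u) * ennreal (gw \<beta> (u - z) * (exp (- \<Phi> * z) - exp (- l * z))) \<partial>lborel) = ennreal (th u)"
    if u: "0 < u" for u
  proof -
    have "(\<integral>\<^sup>+z. of_bool (0 \<le> z \<and> z \<le> u) * ennreal (gw \<beta> (u - z) * (exp (- \<Phi> * z) - exp (- l * z))) \<partial>lborel)
      = (\<integral>\<^sup>+z. of_bool (0 \<le> z \<and> z \<le> u) * ennreal ((exp (- ?a * (u - z)) - exp (- ?a' * (u - z))) * (exp (- ?b * z) - exp (- ?b' * z))) \<partial>lborel)"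
      by (intro nn_integral_cong) (simp add: gw_def right_diff_distrib exp_add[symmetric] algebra_simps)
    also have "\<dots> = ennreal ((exp (- ?b * u) - exp (- ?a * u)) / (?a - ?b) - (exp (- ?b' * u) - exp (- ?a * u)) / (?a - ?b')
        - (exp (- ?b * u) - exp (- ?a' * u)) / (?a' - ?b) + (exp (- ?b' * u) - exp (- ?a' * u)) / (?a' - ?b'))"
      using \<beta> l u by (intro exp_convolution) auto
    also have "(exp (- ?b * u) - exp (- ?a * u)) / (?a - ?b) - (exp (- ?b' * u) - exp (- ?a * u)) / (?a - ?b')
        - (exp (- ?b * u) - exp (- ?a' * u)) / (?a' - ?b) + (exp (- ?b' * u) - exp (- ?a' * u)) / (?a' - ?b') = th u"
    proof -
      have t: "(exp (- y * u) - exp (- x * u)) / (x - y) = u * indicator {0<..<1} u - (theta x u - theta y u) / (x - y)" if "x \<noteq> y" for x y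
      proof -
        have "theta x u - theta y u = (exp (- x * u) - exp (- y * u)) + (x - y) * (u * indicator {0<..<1} u)"
          by (simp add: theta_def algebra_simps)
        then have "(theta x u - theta y u) / (x - y) = (exp (- x * u) - exp (- y * u)) / (x - y) + u * indicator {0<..<1} u"
          using that by (simp add: add_divide_distrib)
        then show ?thesis by (simp add: diff_divide_distrib)
      qed
      show ?thesis unfolding th_def using \<beta> l by (simp only: t[of ?a ?b] t[of ?a ?b'] t[of ?a' ?b] t[of ?a' ?b'])
    qed
    finally show ?thesis .
  qed
  define T where "T = - (J ?a - J ?b) / (?a - ?b) + (J ?a - J ?b') / (?a - ?b') + (J ?a' - J ?b) / (?a' - ?b) - (J ?a' - J ?b') / (?a' - ?b')"
  have ith: "integrable \<nu> (\<lambda>u. indicator {0<..} u * th u)" and vth: "(\<integral>u. indicator {0<..} u * th u \<partial>\<nu>) = T"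
  proof -
    note i = theta_integrable[of ?a] theta_integrable[of ?a'] theta_integrable[of ?b] theta_integrable[of ?b']
    have e: "indicator {0<..} u * th u = - (indicator {0<..} u * theta ?a u - indicator {0<..} u * theta ?b u) / (?a - ?b)
       + (indicator {0<..} u * theta ?a u - indicator {0<..} u * theta ?b' u) / (?a - ?b')
       + (indicator {0<..} u * theta ?a' u - indicator {0<..} u * theta ?b u) / (?a' - ?b)
       - (indicator {0<..} u * theta ?a' u - indicator {0<..} u * theta ?b' u) / (?a' - ?b')" for u
      by (simp add: th_def indicator_def)
    show "integrable \<nu> (\<lambda>u. indicator {0<..} u * th u)"
      unfolding e using i \<beta>0 \<Phi>0 l by (intro Bochner_Integration.integrable_add Bochner_Integration.integrable_diff integrable_divide Bochner_Integration.integrable_minus) auto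
    show "(\<integral>u. indicator {0<..} u * th u \<partial>\<nu>) = T"
      unfolding e T_def J_def using i \<beta>0 \<Phi>0 l by simp
  qed
  \<comment> \<open>The identity for \<open>th\<close> leaves its sign open, as
    \<open>ennreal\<close> maps negative numbers to 0. A negative value would make the integral
    vanish although its integrand is positive on (0, u).\<close>
  have thnn: "0 \<le> th u" if "0 < u" for u
  proof (rule ccontr)
    assume "\<not> 0 \<le> th u"
    then have z: "(\<integral>\<^sup>+z. of_bool (0 \<le> z \<and> z \<le> u) * ennreal (gw \<beta> (u - z) * (exp (- \<Phi> * z) - exp (- l * z))) \<partial>lborel) = 0"
      unfolding th[OF that] by (simp add: ennreal_neg)
    then have "AE z in lborel. of_bool (0 \<le> z \<and> z \<le> u) * ennreal (gw \<beta> (u - z) * (exp (- \<Phi> * z) - exp (- l * z))) = 0"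
      by (subst (asm) nn_integral_0_iff_AE) auto
    then have "AE z in lborel. z \<notin> {0<..<u}"
    proof eventually_elim
      case (elim z)
      have "0 < gw \<beta> (u - z) * (exp (- \<Phi> * z) - exp (- l * z))" if "0 < z" "z < u"
        using that l' by (intro mult_pos_pos) (auto simp: gw_def)
      then show ?case using elim by auto
    qed
    then have "{0<..<u} \<in> null_sets lborel" by (subst AE_iff_null_sets) auto
    then show False using that by auto
  qed
  have "(\<integral>\<^sup>+y\<in>{0..}. eexp (- l * y) * H \<beta> y \<partial>lborel)
    = (\<integral>\<^sup>+y. \<integral>\<^sup>+p. G \<beta> p * (eexp (- l * y) * ennreal (ww y (snd p)) * indicator {0..} y) \<partial>N \<partial>lborel)"
  proof (rule nn_integral_cong)
    fix y :: real
    have "eexp (- l * y) * H \<beta> y * indicator {0..} y = (eexp (- l * y) * indicator {0..} y) * (\<integral>\<^sup>+p. G \<beta> p * ennreal (ww y (snd p)) \<partial>N)"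
      unfolding H_def by (simp only: mult_ac)
    also have "\<dots> = (\<integral>\<^sup>+p. (eexp (- l * y) * indicator {0..} y) * (G \<beta> p * ennreal (ww y (snd p))) \<partial>N)"
      by (rule nn_integral_cmult[symmetric]) (rule GW_meas)
    finally show "eexp (- l * y) * H \<beta> y * indicator {0..} y = (\<integral>\<^sup>+p. G \<beta> p * (eexp (- l * y) * ennreal (ww y (snd p)) * indicator {0..} y) \<partial>N)"
      by (simp only: mult_ac)
  qed
  also have "\<dots> = (\<integral>\<^sup>+p. \<integral>\<^sup>+y. G \<beta> p * (eexp (- l * y) * ennreal (ww y (snd p)) * indicator {0..} y) \<partial>lborel \<partial>N)"
  proof (rule LN.Fubini'[symmetric])
    have [measurable]: "(\<lambda>x. G \<beta> (snd x)) \<in> borel_measurable (lborel \<Otimes>\<^sub>M N)"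
      by (rule measurable_compose[OF measurable_snd G_meas])
    have [measurable]: "(\<lambda>x. ww (fst x) (snd (snd x))) \<in> borel_measurable (lborel \<Otimes>\<^sub>M N)"
      unfolding N_def ww_def by measurable
    show "(\<lambda>(y, p). G \<beta> p * (eexp (- l * y) * ennreal (ww y (snd p)) * indicator {0..} y)) \<in> borel_measurable (lborel \<Otimes>\<^sub>M N)"
      unfolding case_prod_beta by measurable
  qed
  also have "\<dots> = (\<integral>\<^sup>+p. G \<beta> p * ennreal ((exp (- \<Phi> * snd p) - exp (- l * snd p)) / (\<psi> l - q)) \<partial>N)"
  proof (rule nn_integral_cong)
    fix p :: "real \<times> real"
    have "(\<integral>\<^sup>+y. G \<beta> p * (eexp (- l * y) * ennreal (ww y (snd p)) * indicator {0..} y) \<partial>lborel)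
      = G \<beta> p * (\<integral>\<^sup>+y\<in>{0..}. eexp (- l * y) * ennreal (ww y (snd p)) \<partial>lborel)"
      by (rule nn_integral_cmult) (simp add: ww_def)
    also have "\<dots> = G \<beta> p * ennreal ((exp (- \<Phi> * snd p) - exp (- l * snd p)) / (\<psi> l - q))"
    proof (cases "0 \<le> snd p")
      case True then show ?thesis by (simp only: ww_laplace[OF l'])
    qed (simp add: G_def)
    finally show "(\<integral>\<^sup>+y. G \<beta> p * (eexp (- l * y) * ennreal (ww y (snd p)) * indicator {0..} y) \<partial>lborel)
      = G \<beta> p * ennreal ((exp (- \<Phi> * snd p) - exp (- l * snd p)) / (\<psi> l - q))" .
  qed
  also have "\<dots> = (\<integral>\<^sup>+u. \<integral>\<^sup>+z. G \<beta> (u, z) * ennreal ((exp (- \<Phi> * z) - exp (- l * z)) / (\<psi> l - q)) \<partial>lborel \<partial>\<nu>)"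
  proof -
    have "(\<lambda>p. G \<beta> p * ennreal ((exp (- \<Phi> * snd p) - exp (- l * snd p)) / (\<psi> l - q))) \<in> borel_measurable (\<nu> \<Otimes>\<^sub>M lborel)"
      unfolding G_def by measurable
    from lborel.nn_integral_fst[OF this] show ?thesis unfolding N_def by simp
  qed
  also have "\<dots> = (\<integral>\<^sup>+u. ennreal (1 / (\<psi> l - q)) * ennreal (indicator {0<..} u * th u) \<partial>\<nu>)"
  proof (rule nn_integral_cong_AE)
    show "AE u in \<nu>. (\<integral>\<^sup>+z. G \<beta> (u, z) * ennreal ((exp (- \<Phi> * z) - exp (- l * z)) / (\<psi> l - q)) \<partial>lborel)
      = ennreal (1 / (\<psi> l - q)) * ennreal (indicator {0<..} u * th u)"
      using AE_nu_pos
    proof eventually_elim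
      case (elim u)
      have "(\<integral>\<^sup>+z. G \<beta> (u, z) * ennreal ((exp (- \<Phi> * z) - exp (- l * z)) / (\<psi> l - q)) \<partial>lborel)
        = (\<integral>\<^sup>+z. ennreal (1 / (\<psi> l - q)) * (of_bool (0 \<le> z \<and> z \<le> u) * ennreal (gw \<beta> (u - z) * (exp (- \<Phi> * z) - exp (- l * z)))) \<partial>lborel)"
      proof (rule nn_integral_cong)
        fix z
        show "G \<beta> (u, z) * ennreal ((exp (- \<Phi> * z) - exp (- l * z)) / (\<psi> l - q))
          = ennreal (1 / (\<psi> l - q)) * (of_bool (0 \<le> z \<and> z \<le> u) * ennreal (gw \<beta> (u - z) * (exp (- \<Phi> * z) - exp (- l * z))))"
          using P gw_nonneg[of "u - z" \<beta>] by (auto simp: G_def ennreal_mult'[symmetric])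
      qed
      also have "\<dots> = ennreal (1 / (\<psi> l - q)) * ennreal (th u)"
        by (subst nn_integral_cmult) (auto simp only: th[OF elim], measurable)
      finally show ?case using elim by simp
    qed
  qed
  also have "\<dots> = ennreal (1 / (\<psi> l - q)) * (\<integral>\<^sup>+u. ennreal (indicator {0<..} u * th u) \<partial>\<nu>)"
    by (rule nn_integral_cmult) (simp add: th_def)
  also have "(\<integral>\<^sup>+u. ennreal (indicator {0<..} u * th u) \<partial>\<nu>) = ennreal T"
    unfolding vth[symmetric] by (rule nn_integral_eq_integral[OF ith]) (use thnn in \<open>auto simp: indicator_def\<close>)
  also have "ennreal (1 / (\<psi> l - q)) * ennreal T = ennreal (T / (\<psi> l - q))"
    using P by (simp add: ennreal_mult'[symmetric])
  also have "T / (\<psi> l - q) = (kr \<beta> - kr l) / (kr \<beta> * (l - \<beta>)) - (kr (\<beta> + 1) - kr l) / (kr (\<beta> + 1) * (l - (\<beta> + 1)))"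
  proof -
    \<comment> \<open>Expresses an overshoot transform through \<psi>, with the same factor 1 /
      (\<psi> l - q) that \<open>ww_laplace\<close> has produced.\<close>
    have one: "(kr x - kr l) / (kr x * (l - x)) = (- (\<psi> x - q) / (x - \<Phi>) + (\<psi> x - \<psi> l) / (x - l)) / (\<psi> l - q)"
      if x: "\<Phi> < x" "x < l" for x
    proof -
      define p where "p = \<psi> x - q"
      define s where "s = \<psi> l - q"
      have p: "0 < p" using \<psi>_gt[OF x(1)] by (simp add: p_def)
      have s: "0 < s" using P by (simp add: s_def)
      have "kr l / kr x = (l - \<Phi>) * p / ((x - \<Phi>) * s)"
        unfolding kr_def p_def[symmetric] s_def[symmetric] using q \<Phi>0 x p s by (simp add: field_simps)
      moreover have "(kr x - kr l) / (kr x * (l - x)) = (1 - kr l / kr x) / (l - x)"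
        using kr_pos[OF x(1)] by (simp add: diff_divide_distrib)
      ultimately have "(kr x - kr l) / (kr x * (l - x)) = (1 - (l - \<Phi>) * p / ((x - \<Phi>) * s)) / (l - x)"
        by (simp only:)
      also have "\<dots> = (- p / (x - \<Phi>) + (p - s) / (x - l)) / s"
        using x s by (simp add: divide_simps) (simp add: algebra_simps)
      also have "p - s = \<psi> x - \<psi> l" by (simp add: p_def s_def)
      finally show ?thesis by (simp add: p_def s_def)
    qed
    have "T = - (\<psi> ?a - q) / (?a - \<Phi>) + (\<psi> ?a - \<psi> l) / (?a - l) - (- (\<psi> ?a' - q) / (?a' - \<Phi>) + (\<psi> ?a' - \<psi> l) / (?a' - l))"
    proof -
      have m: "- (x::real) / y = - (x / y)" for x y by simp
      have "T = - ((J ?a - J ?b) / (?a - ?b)) + (J ?a - J ?b') / (?a - ?b') + (J ?a' - J ?b) / (?a' - ?b) - (J ?a' - J ?b') / (?a' - ?b')"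
        unfolding T_def m ..
      also have "\<dots> = - ((\<psi> ?a - q) / (?a - \<Phi>)) + (\<psi> ?a - \<psi> l) / (?a - l) - (- ((\<psi> ?a' - q) / (?a' - \<Phi>)) + (\<psi> ?a' - \<psi> l) / (?a' - l))"
      proof -
        have j1: "(J ?a - J ?b) / (?a - ?b) = (\<psi> ?a - q) / (?a - \<Phi>) - c - \<sigma>\<^sup>2 / 2 * (?a + ?b)"
          and j2: "(J ?a' - J ?b) / (?a' - ?b) = (\<psi> ?a' - q) / (?a' - \<Phi>) - c - \<sigma>\<^sup>2 / 2 * (?a' + ?b)"
          and j3: "(J ?a - J ?b') / (?a - ?b') = (\<psi> ?a - \<psi> l) / (?a - l) - c - \<sigma>\<^sup>2 / 2 * (?a + ?b')"
          and j4: "(J ?a' - J ?b') / (?a' - ?b') = (\<psi> ?a' - \<psi> l) / (?a' - l) - c - \<sigma>\<^sup>2 / 2 * (?a' + ?b')"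
          using \<beta> \<beta>0 \<Phi>0 l by (auto simp: J_quotient \<psi>\<Phi>)
        \<comment> \<open>The Gaussian terms cancel; the four constants c have alternating signs and
          cancel as well.\<close>
        have k: "\<sigma>\<^sup>2 / 2 * (?a + ?b) - \<sigma>\<^sup>2 / 2 * (?a + ?b') - \<sigma>\<^sup>2 / 2 * (?a' + ?b) + \<sigma>\<^sup>2 / 2 * (?a' + ?b') = 0"
          by (simp add: field_simps)
        show ?thesis unfolding j1 j2 j3 j4 using k by linarith
      qed
      finally show ?thesis unfolding m .
    qed
    then show ?thesis using one[of ?a] one[of ?a'] \<beta> l by (simp add: diff_divide_distrib)
  qed
  finally show ?thesis .
qed

end

section \<open>First passage times\<close>

text \<open>Replaces an uncountable union by countable operations. A value at most A is nearly
  repeated at rational times just to the right; the right end point leaves no room for this and is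
  rational itself. Conversely, a path above A on the compact interval is above A by a margin,
  because left limits are no smaller than values.\<close>

lemma path_reaches_iff:
  fixes f :: "real \<Rightarrow> real"
  assumes rc: "\<And>t. 0 \<le> t \<Longrightarrow> (f \<longlongrightarrow> f t) (at_right t)"
    and ll: "\<And>t. 0 < t \<Longrightarrow> \<exists>l. (f \<longlongrightarrow> l) (at_left t) \<and> f t \<le> l"
    and e: "0 < e" "e \<le> e'" "e' \<in> \<rat>"
  shows "(\<exists>t\<in>{e..e'}. f t \<le> A) \<longleftrightarrow> (\<forall>k::nat. \<exists>s\<in>\<rat> \<inter> {e..e'}. f s < A + 1 / (Suc k))"
proof
  assume "\<exists>t\<in>{e..e'}. f t \<le> A"
  then obtain t where t: "e \<le> t" "t \<le> e'" "f t \<le> A" by auto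
  show "\<forall>k::nat. \<exists>s\<in>\<rat> \<inter> {e..e'}. f s < A + 1 / (Suc k)"
  proof
    fix k :: nat
    have pos: "0 < 1 / real (Suc k)" by simp
    show "\<exists>s\<in>\<rat> \<inter> {e..e'}. f s < A + 1 / (Suc k)"
    proof (cases "t = e'")
      case True
      have "f e' < A + 1 / real (Suc k)" using t(3) pos unfolding True by linarith
      then show ?thesis using e by (intro bexI[of _ e']) auto
    next
      case False
      have "f t < A + 1 / real (Suc k)" using t(3) pos by linarith
      then have "\<forall>\<^sub>F s in at_right t. f s < A + 1 / real (Suc k)"
        using rc[of t] t(1) e(1) by (intro order_tendstoD(2)[OF rc]) auto
      then obtain b where b: "b > t" "\<And>s. t < s \<Longrightarrow> s < b \<Longrightarrow> f s < A + 1 / real (Suc k)"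
        by (auto simp: eventually_at_right_field)
      obtain s where s: "s \<in> \<rat>" "t < s" "s < min b e'"
        using Rats_dense_in_real[of t "min b e'"] b(1) False t(2) by auto
      then show ?thesis using b(2)[of s] t(1) by (intro bexI[of _ s]) auto
    qed
  qed
next
  assume *: "\<forall>k::nat. \<exists>s\<in>\<rat> \<inter> {e..e'}. f s < A + 1 / (Suc k)"
  show "\<exists>t\<in>{e..e'}. f t \<le> A"
  proof (rule ccontr)
    assume "\<not> (\<exists>t\<in>{e..e'}. f t \<le> A)"
    then have gt: "\<And>t. e \<le> t \<Longrightarrow> t \<le> e' \<Longrightarrow> A < f t" by force
    have loc: "\<exists>U d. open U \<and> t \<in> U \<and> 0 < d \<and> (\<forall>y\<in>U. A + d < f y)" if t: "e \<le> t" "t \<le> e'" for t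
    proof -
      have t0: "0 < t" using t e by simp
      define d where "d = (f t - A) / 2"
      have d: "0 < d" "A + d < f t" using gt[OF t] by (auto simp: d_def field_simps)
      have "\<forall>\<^sub>F y in at_right t. A + d < f y" using d(2) t0 by (intro order_tendstoD(1)[OF rc]) auto
      then obtain b where b: "b > t" "\<And>y. t < y \<Longrightarrow> y < b \<Longrightarrow> A + d < f y"
        by (auto simp: eventually_at_right_field)
      obtain l where l: "(f \<longlongrightarrow> l) (at_left t)" "f t \<le> l" using ll[OF t0] by blast
      have "\<forall>\<^sub>F y in at_left t. A + d < f y" using d(2) l(2) by (intro order_tendstoD(1)[OF l(1)]) auto
      then obtain a where a: "a < t" "\<And>y. a < y \<Longrightarrow> y < t \<Longrightarrow> A + d < f y"
        by (auto simp: eventually_at_left_field)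
      have "A + d < f y" if "a < y" "y < b" for y
        using a(2)[of y] b(2)[of y] d(2) that by (cases y t rule: linorder_cases) auto
      then show ?thesis using a(1) b(1) d(1) by (intro exI[of _ "{a<..<b}"] exI[of _ d]) auto
    qed
    define Q where "Q t Ud \<longleftrightarrow> open (fst Ud) \<and> t \<in> fst Ud \<and> 0 < snd Ud \<and> (\<forall>y\<in>fst Ud. A + snd Ud < f y)" for t Ud
    have "\<forall>t\<in>{e..e'}. \<exists>Ud. Q t Ud" using loc by (fastforce simp: Q_def)
    then obtain Ud where Ud: "\<And>t. t \<in> {e..e'} \<Longrightarrow> Q t (Ud t)" using bchoice[of "{e..e'}" Q] by blast
    have op: "open (fst (Ud t))" if "t \<in> {e..e'}" for t using Ud[OF that] by (simp add: Q_def)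
    have cov: "{e..e'} \<subseteq> (\<Union>t\<in>{e..e'}. fst (Ud t))" using Ud by (auto simp: Q_def)
    obtain C where C: "C \<subseteq> {e..e'}" "finite C" "{e..e'} \<subseteq> (\<Union>c\<in>C. fst (Ud c))"
      by (rule compactE_image[OF compact_Icc op cov])
    have "C \<noteq> {}" using C(3) e(2) by auto
    define m where "m = Min ((\<lambda>c. snd (Ud c)) ` C)"
    have m: "0 < m" unfolding m_def using C \<open>C \<noteq> {}\<close> Ud by (subst Min_gr_iff) (auto simp: Q_def)
    have fm: "A + m < f s" if s: "s \<in> {e..e'}" for s
    proof -
      have "s \<in> (\<Union>c\<in>C. fst (Ud c))" by (rule subsetD[OF C(3) s])
      then obtain c where c: "c \<in> C" "s \<in> fst (Ud c)" by (rule UN_E)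
      have "m \<le> snd (Ud c)" unfolding m_def using C(2) c(1) by (intro Min_le) auto
      moreover have "Q c (Ud c)" by (rule Ud[OF subsetD[OF C(1) c(1)]])
      then have "A + snd (Ud c) < f s" using c(2) by (simp add: Q_def)
      ultimately show ?thesis by linarith
    qed
    obtain k :: nat where k: "1 / real (Suc k) < m" using reals_Archimedean[OF m] by (auto simp: inverse_eq_divide)
    obtain s where "s \<in> {e..e'}" "f s < A + 1 / real (Suc k)" using * by blast
    then show False using fm[of s] k by linarith
  qed
qed

lemma first_passage_less_iff:
  "first_passage X A \<omega> < y \<longleftrightarrow> (\<exists>t>0. X t \<omega> \<le> A \<and> ereal t < y)"
  unfolding first_passage_def by (auto simp: Inf_less_iff)

text \<open>Passage before y means that the closed half-line is reached within some rational
  interval [e, e'] ending before y. The condition 0 < e reflects that time 0 does not count as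
  passage.\<close>

lemma first_passage_measurable:
  fixes X :: "real \<Rightarrow> 'a \<Rightarrow> real"
  assumes Xm: "\<And>t. 0 \<le> t \<Longrightarrow> X t \<in> borel_measurable M"
    and rc: "\<And>\<omega> t. \<omega> \<in> space M \<Longrightarrow> 0 \<le> t \<Longrightarrow> ((\<lambda>t. X t \<omega>) \<longlongrightarrow> X t \<omega>) (at_right t)"
    and ll: "\<And>\<omega> t. \<omega> \<in> space M \<Longrightarrow> 0 < t \<Longrightarrow> \<exists>l. ((\<lambda>t. X t \<omega>) \<longlongrightarrow> l) (at_left t) \<and> X t \<omega> \<le> l"
  shows "first_passage X A \<in> borel_measurable M"
proof (rule borel_measurableI_less)
  fix y :: ereal
  have ep: "0 < e \<Longrightarrow> s \<in> {e..e'} \<Longrightarrow> 0 \<le> s" for e s e' :: real by auto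
  have eq: "first_passage X A \<omega> < y \<longleftrightarrow>
     (\<exists>e\<in>\<rat>. \<exists>e'\<in>\<rat>. 0 < e \<and> e \<le> e' \<and> ereal e' < y \<and> (\<forall>k::nat. \<exists>s\<in>\<rat> \<inter> {e..e'}. X s \<omega> < A + 1 / real (Suc k)))"
    if \<omega>: "\<omega> \<in> space M" for \<omega>
  proof
    assume "first_passage X A \<omega> < y"
    then obtain t where t: "0 < t" "X t \<omega> \<le> A" "ereal t < y" unfolding first_passage_less_iff by blast
    obtain e where e: "e \<in> \<rat>" "0 < e" "e < t" using Rats_dense_in_real[OF t(1)] by auto
    obtain r where r: "t < r" "ereal r < y"
      using ereal_dense2[OF t(3)] by auto
    obtain e' where e': "e' \<in> \<rat>" "t < e'" "e' < r" using Rats_dense_in_real[OF r(1)] by auto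
    have "ereal e' < y" using e'(3) r(2) by (meson ereal_less_eq(3) le_less_trans less_imp_le)
    moreover have "\<forall>k::nat. \<exists>s\<in>\<rat> \<inter> {e..e'}. X s \<omega> < A + 1 / real (Suc k)"
      by (subst path_reaches_iff[symmetric, OF rc[OF \<omega>] ll[OF \<omega>]]) (use e e' t in \<open>auto intro!: bexI[of _ t]\<close>)
    ultimately show "\<exists>e\<in>\<rat>. \<exists>e'\<in>\<rat>. 0 < e \<and> e \<le> e' \<and> ereal e' < y \<and> (\<forall>k::nat. \<exists>s\<in>\<rat> \<inter> {e..e'}. X s \<omega> < A + 1 / real (Suc k))"
      using e e' by (intro bexI[of _ e] bexI[of _ e']) auto
  next
    assume "\<exists>e\<in>\<rat>. \<exists>e'\<in>\<rat>. 0 < e \<and> e \<le> e' \<and> ereal e' < y \<and> (\<forall>k::nat. \<exists>s\<in>\<rat> \<inter> {e..e'}. X s \<omega> < A + 1 / real (Suc k))"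
    then obtain e e' where e: "e \<in> \<rat>" "e' \<in> \<rat>" "0 < e" "e \<le> e'" "ereal e' < y"
      and k: "\<forall>k::nat. \<exists>s\<in>\<rat> \<inter> {e..e'}. X s \<omega> < A + 1 / real (Suc k)" by blast
    have "\<exists>t\<in>{e..e'}. X t \<omega> \<le> A"
      by (subst path_reaches_iff[OF rc[OF \<omega>] ll[OF \<omega>]]) (use e k in auto)
    then obtain t where t: "e \<le> t" "t \<le> e'" "X t \<omega> \<le> A" by auto
    then have "ereal t < y" using e(5) by (meson ereal_less_eq(3) le_less_trans)
    then show "first_passage X A \<omega> < y" unfolding first_passage_less_iff using t e(3) by (intro exI[of _ t]) auto
  qed
  have "{\<omega> \<in> space M. first_passage X A \<omega> < y} =
    (\<Union>e\<in>\<rat>. \<Union>e'\<in>\<rat>. {\<omega> \<in> space M. 0 < e \<and> e \<le> e' \<and> ereal e' < y \<and> (\<forall>k::nat. \<exists>s\<in>\<rat> \<inter> {e..e'}. X s \<omega> < A + 1 / real (Suc k))})"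
  proof -
    define R where "R e e' \<omega> \<longleftrightarrow> 0 < e \<and> e \<le> e' \<and> ereal e' < y \<and> (\<forall>k::nat. \<exists>s\<in>\<rat> \<inter> {e..e'}. X s \<omega> < A + 1 / real (Suc k))" for e e' \<omega>
    have "first_passage X A \<omega> < y \<longleftrightarrow> (\<exists>e\<in>\<rat>. \<exists>e'\<in>\<rat>. R e e' \<omega>)" if "\<omega> \<in> space M" for \<omega>
      unfolding R_def by (rule eq[OF that])
    then have "{\<omega> \<in> space M. first_passage X A \<omega> < y} = (\<Union>e\<in>\<rat>. \<Union>e'\<in>\<rat>. {\<omega> \<in> space M. R e e' \<omega>})"
      by blast
    then show ?thesis by (simp only: R_def)
  qed
  also have "\<dots> \<in> sets M"
  proof (intro sets.countable_UN'' countable_rat)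
    fix e e' :: real
    show "{\<omega> \<in> space M. 0 < e \<and> e \<le> e' \<and> ereal e' < y \<and> (\<forall>k::nat. \<exists>s\<in>\<rat> \<inter> {e..e'}. X s \<omega> < A + 1 / real (Suc k))} \<in> sets M"
    proof (cases "0 < e \<and> e \<le> e' \<and> ereal e' < y")
      case True
      have "{\<omega> \<in> space M. \<exists>s\<in>\<rat> \<inter> {e..e'}. X s \<omega> < A + 1 / real (Suc k)} \<in> sets M" for k
      proof -
        have "{\<omega> \<in> space M. \<exists>s\<in>\<rat> \<inter> {e..e'}. X s \<omega> < A + 1 / real (Suc k)} = (\<Union>s\<in>\<rat> \<inter> {e..e'}. {\<omega> \<in> space M. X s \<omega> < A + 1 / real (Suc k)})"
          by blast
        also have "\<dots> \<in> sets M"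
        proof (intro sets.countable_UN'' countable_Int1 countable_rat)
          fix s assume "s \<in> \<rat> \<inter> {e..e'}"
          then have [measurable]: "X s \<in> borel_measurable M" using True by (intro Xm) auto
          show "{\<omega> \<in> space M. X s \<omega> < A + 1 / real (Suc k)} \<in> sets M" by measurable
        qed
        finally show ?thesis .
      qed
      then have "{\<omega> \<in> space M. \<forall>k::nat. \<exists>s\<in>\<rat> \<inter> {e..e'}. X s \<omega> < A + 1 / real (Suc k)} \<in> sets M"
        by (intro sets.sets_Collect_countable_All)
      then show ?thesis using True by simp
    next
      case False
      then have "{\<omega> \<in> space M. 0 < e \<and> e \<le> e' \<and> ereal e' < y \<and> (\<forall>k::nat. \<exists>s\<in>\<rat> \<inter> {e..e'}. X s \<omega> < A + 1 / real (Suc k))} = {}" by auto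
      then show ?thesis by (simp only: sets.empty_sets)
    qed
  qed
  finally show "{\<omega> \<in> space M. first_passage X A \<omega> < y} \<in> sets M" .
qed

text \<open>\<open>T\<close> is approximated by the next grid point strictly after it. There the
  process is a countable patchwork of measurable variables, and right continuity gives the
  limit.\<close>

lemma process_at_time_measurable:
  fixes X :: "real \<Rightarrow> 'a \<Rightarrow> real"
  assumes Xm: "\<And>t. 0 \<le> t \<Longrightarrow> X t \<in> borel_measurable M"
    and rc: "\<And>\<omega> t. \<omega> \<in> space M \<Longrightarrow> 0 \<le> t \<Longrightarrow> ((\<lambda>t. X t \<omega>) \<longlongrightarrow> X t \<omega>) (at_right t)"
    and T[measurable]: "T \<in> borel_measurable M" and T0: "\<And>\<omega>. 0 \<le> T \<omega>"
  shows "(\<lambda>\<omega>. X (T \<omega>) \<omega>) \<in> borel_measurable M"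
proof (rule borel_measurable_LIMSEQ_real)
  fix \<omega> assume \<omega>: "\<omega> \<in> space M"
  define s where "s n = dy n (Suc (kap n (T \<omega>)))" for n
  have s1: "T \<omega> < s n" for n
    using le_kap_iff[OF T0, of "Suc (kap n (T \<omega>))" n \<omega>] by (auto simp: s_def)
  have s2: "s n \<le> T \<omega> + (1/2) ^ n" for n
    using le_kap_iff[OF T0, of "kap n (T \<omega>)" n \<omega>] by (simp add: s_def dy_def power_one_over field_simps)
  have "s \<longlonglongrightarrow> T \<omega>"
  proof (rule tendsto_sandwich[where f = "\<lambda>_. T \<omega>" and h = "\<lambda>n. T \<omega> + (1/2) ^ n"])
    have "(\<lambda>n. T \<omega> + (1/2::real) ^ n) \<longlonglongrightarrow> T \<omega> + 0"
      by (intro tendsto_add tendsto_const LIMSEQ_power_zero) simp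
    then show "(\<lambda>n. T \<omega> + (1/2::real) ^ n) \<longlonglongrightarrow> T \<omega>" by simp
    show "\<forall>\<^sub>F n in sequentially. T \<omega> \<le> s n" by (rule always_eventually, rule allI, rule less_imp_le, rule s1)
    show "\<forall>\<^sub>F n in sequentially. s n \<le> T \<omega> + (1/2) ^ n" by (rule always_eventually, rule allI, rule s2)
  qed (rule tendsto_const)
  moreover have "s n \<noteq> T \<omega>" for n using s1[of n] by simp
  ultimately have "filterlim s (at_right (T \<omega>)) sequentially" using s1 by (simp add: filterlim_at)
  with rc[OF \<omega> T0] show "(\<lambda>n. X (dy n (Suc (kap n (T \<omega>)))) \<omega>) \<longlonglongrightarrow> X (T \<omega>) \<omega>"
    unfolding s_def by (rule filterlim_compose)
next
  fix n
  show "(\<lambda>\<omega>. X (dy n (Suc (kap n (T \<omega>)))) \<omega>) \<in> borel_measurable M"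
  proof (rule measurable_compose_countable[of "\<lambda>k \<omega>. X (dy n (Suc k)) \<omega>" M borel "\<lambda>\<omega>. kap n (T \<omega>)"])
    show "X (dy n (Suc k)) \<in> borel_measurable M" for k by (rule Xm) simp
    show "(\<lambda>\<omega>. kap n (T \<omega>)) \<in> measurable M (count_space UNIV)"
      by (rule measurable_compose[OF T measurable_kap])
  qed
qed

text \<open>Strict and weak passage below \<open>- y\<close> can differ only if the running infimum stays at \<open>- y\<close>
  for a while.\<close>

lemma (in snpath) passage_time_eq_entry_time:
  assumes y: "0 < y" and t: "0 < t" "f t \<le> - y"
    and good: "\<And>a b. 0 \<le> a \<Longrightarrow> a < b \<Longrightarrow> \<exists>t. a < t \<and> t < b \<and> run_inf f t \<noteq> - y"
  defines "\<tau> \<equiv> Inf {t. 0 < t \<and> f t \<le> - y}"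
  shows "\<exists>s\<ge>0. f s < - y" "entry_time {..<- y} f = \<tau>" "f \<tau> \<le> - y"
proof -
  have bdd: "bdd_below {t. 0 < t \<and> f t \<le> - y}" by (intro bdd_belowI[of _ 0]) auto
  have ne: "{t. 0 < t \<and> f t \<le> - y} \<noteq> {}" using t by auto
  have \<tau>0: "0 \<le> \<tau>" unfolding \<tau>_def using ne by (intro cInf_greatest) auto
  show att: "f \<tau> \<le> - y"
  proof (rule ccontr)
    assume "\<not> f \<tau> \<le> - y"
    then have "\<forall>\<^sub>F s in at_right \<tau>. - y < f s" by (intro order_tendstoD(1)[OF rc[OF \<tau>0]]) auto
    then obtain b where b: "b > \<tau>" "\<And>s. \<tau> < s \<Longrightarrow> s < b \<Longrightarrow> - y < f s"
      by (auto simp: eventually_at_right_field)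
    have "b \<le> \<tau>"
      unfolding \<tau>_def
    proof (rule cInf_greatest[OF ne])
      fix s assume s: "s \<in> {t. 0 < t \<and> f t \<le> - y}"
      have "\<tau> \<le> s" unfolding \<tau>_def by (rule cInf_lower[OF s bdd])
      moreover have "s \<noteq> \<tau>" using s \<open>\<not> f \<tau> \<le> - y\<close> by auto
      ultimately show "b \<le> s" using b(2)[of s] s by force
    qed
    then show False using b(1) by simp
  qed
  \<comment> \<open>Otherwise the path touches - y at \<tau> without going below it before b. Then
    its running infimum equals - y on the whole interval (\<tau>, b), against
    \<open>good\<close>.\<close>
  have key: "\<exists>s\<ge>0. s < b \<and> f s < - y" if b: "\<tau> < b" for b
  proof (rule ccontr)
    assume "\<not> (\<exists>s\<ge>0. s < b \<and> f s < - y)"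
    then have no: "\<And>s. 0 \<le> s \<Longrightarrow> s < b \<Longrightarrow> - y \<le> f s" by force
    have f\<tau>: "f \<tau> = - y" using no[OF \<tau>0 b] att by simp
    have "run_inf f t = - y" if t: "\<tau> < t" "t < b" for t
    proof (rule antisym)
      have t0: "0 \<le> t" using t \<tau>0 by simp
      show "- y \<le> run_inf f t"
      proof (rule ccontr)
        assume "\<not> - y \<le> run_inf f t"
        then obtain n j where "dy n j \<le> t" "f (dy n j) < - y"
          using run_inf_less_iff[OF t0, of "- y"] ginf_less_iff[OF t0, of _ "- y"] by auto
        then show False using no[of "dy n j"] t by simp
      qed
      show "run_inf f t \<le> - y"
      proof (rule ccontr)
        assume "\<not> run_inf f t \<le> - y"
        then have "\<forall>\<^sub>F s in at_right \<tau>. f s < run_inf f t"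
          using f\<tau> by (intro order_tendstoD(2)[OF rc[OF \<tau>0]]) auto
        then obtain b' where b': "b' > \<tau>" "\<And>s. \<tau> < s \<Longrightarrow> s < b' \<Longrightarrow> f s < run_inf f t"
          by (auto simp: eventually_at_right_field)
        have "\<forall>\<^sub>F n in sequentially. \<exists>k. \<tau> < dy n k \<and> dy n k < min b' t"
          using b'(1) t \<tau>0 by (intro dyadic_between) auto
        then obtain n k where "\<tau> < dy n k" "dy n k < min b' t"
          using eventually_happens'[OF sequentially_bot] by blast
        then show False using b'(2)[of "dy n k"] run_inf_le[OF t0, of n k] by auto
      qed
    qed
    then show False using good[OF \<tau>0 b] by blast
  qed
  show "\<exists>s\<ge>0. f s < - y" using key[of "\<tau> + 1"] by auto
  then have ne': "{s. 0 \<le> s \<and> f s \<in> {..<- y}} \<noteq> {}" by auto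
  show "entry_time {..<- y} f = \<tau>"
  proof (rule antisym)
    show "entry_time {..<- y} f \<le> \<tau>"
    proof (rule field_le_epsilon)
      fix d :: real assume "0 < d"
      then obtain s where s: "0 \<le> s" "s < \<tau> + d" "f s < - y" using key[of "\<tau> + d"] by auto
      have "entry_time {..<- y} f \<le> s" unfolding entry_time_def using s by (intro cInf_lower entry_bdd) auto
      then show "entry_time {..<- y} f \<le> \<tau> + d" using s by simp
    qed
    show "\<tau> \<le> entry_time {..<- y} f"
      unfolding entry_time_def
    proof (rule cInf_greatest[OF ne'])
      fix s assume s: "s \<in> {s. 0 \<le> s \<and> f s \<in> {..<- y}}"
      then have "0 < s" using f0 y by (cases "s = 0") auto
      then show "\<tau> \<le> s" unfolding \<tau>_def using s by (intro cInf_lower[OF _ bdd]) auto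
    qed
  qed
qed

text \<open>\<open>Y\<close> is the increment of \<open>X\<close> on every path, whereas
  \<open>X 0 = x\<close> holds almost surely only. Hence passage of \<open>X\<close> below x - y is
  passage of \<open>Y\<close> below - y outside a null set.\<close>

locale snl_X = snl_nu M Y \<psi> q \<Phi> W \<nu> c \<sigma>
  for M :: "'a measure" and Y \<psi> q \<Phi> W \<nu> c \<sigma> +
  fixes X :: "real \<Rightarrow> 'a \<Rightarrow> real" and x :: real
  assumes YX: "\<And>t \<omega>. Y t \<omega> = X t \<omega> - X 0 \<omega>"
    and X0: "AE \<omega> in M. X 0 \<omega> = x"
    and Xm: "\<And>t. 0 \<le> t \<Longrightarrow> X t \<in> borel_measurable M"
begin

lemma X_path:
  assumes \<omega>: "\<omega> \<in> space M"
  shows "0 \<le> t \<Longrightarrow> ((\<lambda>t. X t \<omega>) \<longlongrightarrow> X t \<omega>) (at_right t)"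
    and "0 < t \<Longrightarrow> \<exists>l. ((\<lambda>t. X t \<omega>) \<longlongrightarrow> l) (at_left t) \<and> X t \<omega> \<le> l"
proof -
  interpret snpath "yp \<omega>" by (rule path[OF \<omega>])
  have XY: "X t \<omega> = Y t \<omega> + X 0 \<omega>" for t by (simp add: YX)
  show "((\<lambda>t. X t \<omega>) \<longlongrightarrow> X t \<omega>) (at_right t)" if "0 \<le> t"
    using tendsto_add[OF rc[OF that] tendsto_const[of "X 0 \<omega>"]] by (simp add: XY[symmetric])
  show "\<exists>l. ((\<lambda>t. X t \<omega>) \<longlongrightarrow> l) (at_left t) \<and> X t \<omega> \<le> l" if t: "0 < t"
  proof -
    obtain l where l: "(yp \<omega> \<longlongrightarrow> l) (at_left t)" "Y t \<omega> \<le> l" using ll[OF t] by blast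
    have "((\<lambda>t. X t \<omega>) \<longlongrightarrow> l + X 0 \<omega>) (at_left t)"
      using tendsto_add[OF l(1) tendsto_const[of "X 0 \<omega>"]] by (simp add: XY[symmetric])
    then show ?thesis using l(2) XY[of t] by (intro exI[of _ "l + X 0 \<omega>"]) auto
  qed
qed

text \<open>\<open>real_of_ereal\<close> sends \<open>\<infinity>\<close> to 0, so this is a passage
  time only where \<open>first_passage\<close> is finite.\<close>

definition "pt A \<omega> = real_of_ereal (first_passage X A \<omega>)"

lemma fp_meas[measurable]: "first_passage X A \<in> borel_measurable M"
  by (rule first_passage_measurable[OF Xm X_path])

lemma pt_meas[measurable]: "pt A \<in> borel_measurable M"
  unfolding pt_def by measurable

lemma pt_nonneg: "0 \<le> pt A \<omega>"
proof -
  have "0 \<le> first_passage X A \<omega>" unfolding first_passage_def by (intro Inf_greatest) auto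
  then show ?thesis unfolding pt_def by (simp add: real_of_ereal_pos)
qed

lemma Xpt_meas[measurable]: "(\<lambda>\<omega>. X (pt A \<omega>) \<omega>) \<in> borel_measurable M"
  by (rule process_at_time_measurable[OF Xm X_path(1) pt_meas pt_nonneg])

lemma first_passage_real:
  assumes "0 < t" "X t \<omega> \<le> A"
  shows "first_passage X A \<omega> < \<infinity>" "pt A \<omega> = Inf {t. 0 < t \<and> X t \<omega> \<le> A}"
proof -
  show "first_passage X A \<omega> < \<infinity>" unfolding first_passage_less_iff using assms by auto
  have "ereal (Inf {t. 0 < t \<and> X t \<omega> \<le> A}) = Inf (ereal ` {t. 0 < t \<and> X t \<omega> \<le> A})"
    using assms by (intro ereal_Inf') (auto intro: bdd_belowI[of _ 0])
  then show "pt A \<omega> = Inf {t. 0 < t \<and> X t \<omega> \<le> A}"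
    unfolding pt_def first_passage_def by (metis real_of_ereal.simps(1))
qed

text \<open>\<open>F\<close> has no atom at y, so by Fubini almost every path has infimum different
  from - y at almost every time under \<open>TX\<close>. The exponential density is positive on [0,
  \<infinity>), so the exceptional times form a Lebesgue null set and contain no interval.\<close>

lemma AE_run_inf_moves:
  assumes y: "0 < y"
  shows "AE \<omega> in M. \<forall>a b. 0 \<le> a \<longrightarrow> a < b \<longrightarrow> (\<exists>t. a < t \<and> t < b \<and> run_inf (yp \<omega>) t \<noteq> - y)"
proof -
  interpret TX: prob_space TX by (rule prob_TX)
  interpret pair_prob_space TX M ..
  have [measurable]: "RI \<in> borel_measurable (TX \<Otimes>\<^sub>M M)" using RI_meas by (simp add: MM_def)
  have "AE s in F. s \<notin> {y}" using F_no_atom[OF y] by (intro AE_not_in null_setsI) auto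
  then have "AE p in MM. - RI p \<notin> {y}" unfolding F_def by (subst (asm) AE_distr_iff) auto
  then have "AE p in TX \<Otimes>\<^sub>M M. RI p \<noteq> - y" unfolding MM_def by eventually_elim auto
  then have "AE t in TX. AE \<omega> in M. RI (t, \<omega>) \<noteq> - y" by (rule AE_pair)
  moreover have "(AE t in TX. AE \<omega> in M. RI (t, \<omega>) \<noteq> - y) \<longleftrightarrow> (AE \<omega> in M. AE t in TX. RI (t, \<omega>) \<noteq> - y)"
  proof (rule AE_commute)
    show "{p \<in> space (TX \<Otimes>\<^sub>M M). RI (fst p, snd p) \<noteq> - y} \<in> sets (TX \<Otimes>\<^sub>M M)"
      unfolding prod.collapse by measurable
  qed
  ultimately have "AE \<omega> in M. AE t in TX. RI (t, \<omega>) \<noteq> - y" by simp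
  then show ?thesis
  proof eventually_elim
    case (elim \<omega>)
    show ?case
    proof (intro allI impI, rule ccontr)
      fix a b :: real assume ab: "0 \<le> a" "a < b" and "\<not> (\<exists>t. a < t \<and> t < b \<and> run_inf (yp \<omega>) t \<noteq> - y)"
      then have all: "\<And>t. a < t \<Longrightarrow> t < b \<Longrightarrow> RI (t, \<omega>) = - y" by (auto simp: RI_def)
      have "AE t in lborel. 0 < ennreal (exponential_density q t) \<longrightarrow> RI (t, \<omega>) \<noteq> - y"
        using elim unfolding TX_def by (subst (asm) AE_density) auto
      then have "AE t in lborel. t \<notin> {a<..<b}"
      proof eventually_elim
        case (elim t)
        show ?case
        proof
          assume t: "t \<in> {a<..<b}"
          then have "0 < exponential_density q t" using ab q by (simp add: exponential_density_def)
          then show False using elim all[of t] t by simp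
        qed
      qed
      then have "{a<..<b} \<in> null_sets lborel" by (subst AE_iff_null_sets) auto
      then show False using ab by auto
    qed
  qed
qed

definition "discount A \<omega> = of_bool (first_passage X A \<omega> < \<infinity>) * eexp (- q * pt A \<omega>)"

lemma discount_meas[measurable]: "discount A \<in> borel_measurable M"
  unfolding discount_def by measurable

text \<open>Combines the coincidence of weak and strict passage with the starting point, so that
  transforms computed for the entry of \<open>Y\<close> apply to
  \<open>first_passage\<close>.\<close>

lemma AE_passage:
  assumes y: "0 < y"
  shows "AE \<omega> in M. (first_passage X (x - y) \<omega> < \<infinity> \<longleftrightarrow> (\<exists>s\<ge>0. Y s \<omega> < - y))
     \<and> (first_passage X (x - y) \<omega> < \<infinity> \<longrightarrow> pt (x - y) \<omega> = entry_time {..<- y} (yp \<omega>)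
          \<and> X (pt (x - y) \<omega>) \<omega> = x + Y (pt (x - y) \<omega>) \<omega> \<and> X (pt (x - y) \<omega>) \<omega> \<le> x - y)"
  using AE_run_inf_moves[OF y] X0 AE_space
proof eventually_elim
  case (elim \<omega>)
  interpret snpath "yp \<omega>" by (rule path[OF elim(3)])
  have XY: "X t \<omega> \<le> x - y \<longleftrightarrow> Y t \<omega> \<le> - y" for t using elim(2) by (auto simp: YX)
  have fin: "(\<exists>s\<ge>0. Y s \<omega> < - y) \<and> pt (x - y) \<omega> = entry_time {..<- y} (yp \<omega>)
     \<and> X (pt (x - y) \<omega>) \<omega> = x + Y (pt (x - y) \<omega>) \<omega> \<and> X (pt (x - y) \<omega>) \<omega> \<le> x - y"
    if "first_passage X (x - y) \<omega> < \<infinity>"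
  proof -
    obtain t where t: "0 < t" "X t \<omega> \<le> x - y" using \<open>first_passage X (x - y) \<omega> < \<infinity>\<close> unfolding first_passage_less_iff by blast
    have g: "\<And>a b. 0 \<le> a \<Longrightarrow> a < b \<Longrightarrow> \<exists>t. a < t \<and> t < b \<and> run_inf (yp \<omega>) t \<noteq> - y" using elim(1) by blast
    note p = passage_time_eq_entry_time[OF y t(1) _ g]
    have ty: "Y t \<omega> \<le> - y" using t(2) XY by simp
    have e: "pt (x - y) \<omega> = Inf {t. 0 < t \<and> Y t \<omega> \<le> - y}"
      using first_passage_real(2)[OF t] by (simp add: XY)
    have "Y (pt (x - y) \<omega>) \<omega> \<le> - y" using p(3)[OF ty] by (simp add: e)
    then show ?thesis using p(1,2)[OF ty] e XY elim(2) by (simp add: YX)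
  qed
  have "first_passage X (x - y) \<omega> < \<infinity>" if s: "0 \<le> s" "Y s \<omega> < - y" for s
  proof -
    have "0 < s" using s f0 y by (cases "s = 0") auto
    then show ?thesis using first_passage_real(1)[of s \<omega> "x - y"] s XY by auto
  qed
  then show ?case using fin by blast
qed

lemma overshoot_lt_passage:
  assumes \<beta>: "0 \<le> \<beta>" and y: "0 < y"
  shows "overshoot_lt \<beta> y = (\<integral>\<^sup>+\<omega>. discount (x - y) \<omega> * eexp (- \<beta> * (x - y - X (pt (x - y) \<omega>) \<omega>)) \<partial>M)"
proof -
  have "overshoot_lt \<beta> y = (\<integral>\<^sup>+\<omega>. eexp (\<beta> * y) * (of_bool (\<exists>s\<ge>0. Y s \<omega> < - y) * ennreal (exp (- q * entry_time {..<- y} (yp \<omega>)) * exp (\<beta> * Y (entry_time {..<- y} (yp \<omega>)) \<omega>))) \<partial>M)"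
    unfolding overshoot_lt_def passage_lt_def by (rule nn_integral_cmult[symmetric, OF td_tendsto(2)[OF \<beta>]]) (use y in simp)
  also have "\<dots> = (\<integral>\<^sup>+\<omega>. discount (x - y) \<omega> * eexp (- \<beta> * (x - y - X (pt (x - y) \<omega>) \<omega>)) \<partial>M)"
  proof (rule nn_integral_cong_AE)
    show "AE \<omega> in M. eexp (\<beta> * y) * (of_bool (\<exists>s\<ge>0. Y s \<omega> < - y) * ennreal (exp (- q * entry_time {..<- y} (yp \<omega>)) * exp (\<beta> * Y (entry_time {..<- y} (yp \<omega>)) \<omega>)))
      = discount (x - y) \<omega> * eexp (- \<beta> * (x - y - X (pt (x - y) \<omega>) \<omega>))"
      using AE_passage[OF y]
    proof eventually_elim
      case (elim \<omega>)
      show ?case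
      proof (cases "first_passage X (x - y) \<omega> < \<infinity>")
        case True
        then have e: "\<exists>s\<ge>0. Y s \<omega> < - y" "entry_time {..<- y} (yp \<omega>) = pt (x - y) \<omega>"
          "Y (pt (x - y) \<omega>) \<omega> = X (pt (x - y) \<omega>) \<omega> - x" using elim by auto
        have "exp (\<beta> * y) * (exp (- q * pt (x - y) \<omega>) * exp (\<beta> * (X (pt (x - y) \<omega>) \<omega> - x)))
          = exp (- q * pt (x - y) \<omega>) * exp (- \<beta> * (x - y - X (pt (x - y) \<omega>) \<omega>))"
          by (simp add: exp_add[symmetric] algebra_simps)
        then show ?thesis unfolding discount_def e(2) e(3)
          using True e(1) by (simp only: of_bool_eq mult_1_left ennreal_mult[symmetric] exp_ge_zero mult_nonneg_nonneg)
      next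
        case False
        then have "\<not> (\<exists>s\<ge>0. Y s \<omega> < - y)" using elim by simp
        then show ?thesis unfolding discount_def using False by (simp only: of_bool_eq mult_zero_left mult_zero_right)
      qed
    qed
  qed
  finally show ?thesis .
qed

text \<open>\<open>overshoot_measure y\<close> may charge 0, when the level is crossed continuously,
  while the diagonal u = z is null for \<open>levy_overshoot y\<close>. The two are to be compared
  on (0, \<infinity>) only.\<close>

definition "overshoot_measure y = distr (density M (discount (x - y))) borel (\<lambda>\<omega>. x - y - X (pt (x - y) \<omega>) \<omega>)"
definition "levy_overshoot y = distr (density N (\<lambda>p. of_bool (0 \<le> snd p \<and> snd p \<le> fst p) * ennreal (ww y (snd p)))) borel (\<lambda>p. fst p - snd p)"

lemma wN_meas[measurable]: "(\<lambda>p. of_bool (0 \<le> snd p \<and> snd p \<le> fst p) * ennreal (ww y (snd p))) \<in> borel_measurable N"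
  unfolding N_def ww_def by measurable

lemma dN_meas[measurable]: "(\<lambda>p. fst p - snd p) \<in> borel_measurable N"
  unfolding N_def by measurable

lemma nn_overshoot_measure: "h \<in> borel_measurable borel \<Longrightarrow> (\<integral>\<^sup>+v. h v \<partial>overshoot_measure y) = (\<integral>\<^sup>+\<omega>. discount (x - y) \<omega> * h (x - y - X (pt (x - y) \<omega>) \<omega>) \<partial>M)"
  unfolding overshoot_measure_def by (subst nn_integral_distr; simp?; subst nn_integral_density; simp)

lemma nn_levy_overshoot: "h \<in> borel_measurable borel \<Longrightarrow> (\<integral>\<^sup>+v. h v \<partial>levy_overshoot y) = (\<integral>\<^sup>+p. of_bool (0 \<le> snd p \<and> snd p \<le> fst p) * ennreal (ww y (snd p)) * h (fst p - snd p) \<partial>N)"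
  unfolding levy_overshoot_def by (subst nn_integral_distr; simp?; subst nn_integral_density; simp)

section \<open>Comparison of the two overshoot laws\<close>

lemma sets_overshoot_measure[measurable_cong, simp]: "sets (overshoot_measure y) = sets borel" by (simp add: overshoot_measure_def)
lemma sets_levy_overshoot[measurable_cong, simp]: "sets (levy_overshoot y) = sets borel" by (simp add: levy_overshoot_def)

text \<open>The real form of \<open>overshoot_lt\<close> beyond \<Phi>, in which differences and
  one-sided limits can be taken.\<close>

definition "overshoot_fun \<beta> y = exp (\<beta> * y) / kr \<beta> * (kr \<beta> - cdf (Qm \<beta>) y)"

lemma overshoot_lt_overshoot_fun: "\<Phi> < \<beta> \<Longrightarrow> 0 \<le> y \<Longrightarrow> overshoot_lt \<beta> y = ennreal (overshoot_fun \<beta> y)"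
  unfolding overshoot_fun_def by (rule overshoot_lt_eq(2))

lemma overshoot_fun_nonneg: assumes \<beta>: "\<Phi> < \<beta>" shows "0 \<le> overshoot_fun \<beta> y"
proof -
  interpret finite_borel_measure "Qm \<beta>" using finite_Qm[of \<beta>] \<beta> \<Phi>0 by simp
  have "emeasure (Qm \<beta>) UNIV = ennreal (kr \<beta>)"
    using F_laplace[of \<beta>] inf_lt_eq[OF \<beta>] by (simp add: Qm_def emeasure_density)
  then have "measure (Qm \<beta>) UNIV = kr \<beta>" using kr_pos[OF \<beta>] by (simp add: emeasure_eq_measure)
  moreover have "measure (Qm \<beta>) {..y} \<le> measure (Qm \<beta>) UNIV" by (intro finite_measure_mono) auto
  ultimately have "cdf (Qm \<beta>) y \<le> kr \<beta>" by (simp add: cdf_def)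
  then show ?thesis using kr_pos[OF \<beta>] by (simp add: overshoot_fun_def)
qed

lemma overshoot_fun_right_cont: assumes \<beta>: "\<Phi> < \<beta>" shows "(overshoot_fun \<beta> \<longlongrightarrow> overshoot_fun \<beta> y) (at_right y)"
proof -
  interpret finite_borel_measure "Qm \<beta>" using finite_Qm[of \<beta>] \<beta> \<Phi>0 by simp
  have "(cdf (Qm \<beta>) \<longlongrightarrow> cdf (Qm \<beta>) y) (at_right y)"
    using cdf_is_right_cont[of y] by (simp add: continuous_within)
  then show ?thesis unfolding overshoot_fun_def
    using kr_pos[OF \<beta>] by (intro tendsto_mult[OF tendsto_divide] tendsto_diff tendsto_intros) auto
qed

lemma overshoot_fun_meas[measurable]: assumes \<beta>: "\<Phi> < \<beta>" shows "overshoot_fun \<beta> \<in> borel_measurable borel"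
proof -
  interpret finite_borel_measure "Qm \<beta>" using finite_Qm[of \<beta>] \<beta> \<Phi>0 by simp
  have [measurable]: "cdf (Qm \<beta>) \<in> borel_measurable borel"
    by (intro borel_measurable_mono monoI cdf_nondecreasing)
  show ?thesis unfolding overshoot_fun_def by measurable
qed

text \<open>On nonnegative overshoots exp (- \<beta> v) is the sum of \<open>gw \<beta> v\<close>
  and exp (- (\<beta> + 1) v), all nonnegative with finite integrals. The monotonicity in the second
  claim comes out of the same equation.\<close>

lemma overshoot_measure_gw:
  assumes \<beta>: "\<Phi> < \<beta>" and y: "0 < y"
  shows "(\<integral>\<^sup>+v. ennreal (gw \<beta> v) \<partial>overshoot_measure y) = ennreal (overshoot_fun \<beta> y - overshoot_fun (\<beta> + 1) y)" "overshoot_fun (\<beta> + 1) y \<le> overshoot_fun \<beta> y"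
proof -
  have \<beta>0: "0 \<le> \<beta>" using \<beta> \<Phi>0 by simp
  have o: "(\<integral>\<^sup>+v. eexp (- \<beta> * v) \<partial>overshoot_measure y) = overshoot_lt \<beta> y" if "0 \<le> \<beta>" for \<beta>
    using overshoot_lt_passage[OF that y] by (simp add: nn_overshoot_measure)
  have "overshoot_lt \<beta> y = (\<integral>\<^sup>+v. ennreal (gw \<beta> v) + eexp (- (\<beta> + 1) * v) \<partial>overshoot_measure y)"
    unfolding o[OF \<beta>0, symmetric]
  proof (rule nn_integral_cong_AE)
    have "AE v in overshoot_measure y. 0 \<le> v"
    proof -
      have "AE \<omega> in M. 0 < discount (x - y) \<omega> \<longrightarrow> 0 \<le> x - y - X (pt (x - y) \<omega>) \<omega>"
        using AE_passage[OF y]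
      proof eventually_elim
        case (elim \<omega>)
        show ?case
        proof
          assume "0 < discount (x - y) \<omega>"
          then have "first_passage X (x - y) \<omega> < \<infinity>" by (cases "first_passage X (x - y) \<omega> < \<infinity>") (simp_all add: discount_def)
          then have "X (pt (x - y) \<omega>) \<omega> \<le> x - y" using elim by blast
          then show "0 \<le> x - y - X (pt (x - y) \<omega>) \<omega>" by linarith
        qed
      qed
      then have "AE \<omega> in density M (discount (x - y)). 0 \<le> x - y - X (pt (x - y) \<omega>) \<omega>"
        by (subst AE_density) (rule discount_meas)
      then show ?thesis unfolding overshoot_measure_def by (subst AE_distr_iff) auto
    qed
    then show "AE v in overshoot_measure y. eexp (- \<beta> * v) = ennreal (gw \<beta> v) + eexp (- (\<beta> + 1) * v)"
    proof eventually_elim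
      case (elim v)
      have "exp (- \<beta> * v) = gw \<beta> v + exp (- (\<beta> + 1) * v)"
        by (simp add: gw_def right_diff_distrib exp_add[symmetric] algebra_simps)
      then show ?case using gw_nonneg[OF elim, of \<beta>] by simp
    qed
  qed
  also have "\<dots> = (\<integral>\<^sup>+v. ennreal (gw \<beta> v) \<partial>overshoot_measure y) + overshoot_lt (\<beta> + 1) y"
    using \<beta>0 by (subst nn_integral_add) (auto simp: o[symmetric])
  finally have e: "ennreal (overshoot_fun \<beta> y) = (\<integral>\<^sup>+v. ennreal (gw \<beta> v) \<partial>overshoot_measure y) + ennreal (overshoot_fun (\<beta> + 1) y)"
    using overshoot_lt_overshoot_fun[of \<beta> y] overshoot_lt_overshoot_fun[of "\<beta> + 1" y] \<beta> y by simp
  then obtain a where a: "(\<integral>\<^sup>+v. ennreal (gw \<beta> v) \<partial>overshoot_measure y) = ennreal a" "0 \<le> a"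
    by (cases "\<integral>\<^sup>+v. ennreal (gw \<beta> v) \<partial>overshoot_measure y") auto
  have "overshoot_fun \<beta> y = a + overshoot_fun (\<beta> + 1) y"
    using e a overshoot_fun_nonneg[of \<beta> y] overshoot_fun_nonneg[of "\<beta> + 1" y] \<beta> by (simp flip: ennreal_plus)
  then show "(\<integral>\<^sup>+v. ennreal (gw \<beta> v) \<partial>overshoot_measure y) = ennreal (overshoot_fun \<beta> y - overshoot_fun (\<beta> + 1) y)" "overshoot_fun (\<beta> + 1) y \<le> overshoot_fun \<beta> y"
    using a by auto
qed

lemma overshoot_fun_laplace:
  assumes "\<Phi> < \<beta>" "\<beta> < l"
  shows "(\<integral>\<^sup>+y\<in>{0..}. eexp (- l * y) * ennreal (overshoot_fun \<beta> y) \<partial>lborel) = ennreal ((kr \<beta> - kr l) / (kr \<beta> * (l - \<beta>)))"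
proof -
  have "(\<integral>\<^sup>+y\<in>{0..}. eexp (- l * y) * ennreal (overshoot_fun \<beta> y) \<partial>lborel) = (\<integral>\<^sup>+y\<in>{0..}. eexp (- l * y) * overshoot_lt \<beta> y \<partial>lborel)"
    using assms by (intro nn_integral_cong) (auto simp: indicator_def overshoot_lt_overshoot_fun)
  then show ?thesis using overshoot_lt_laplace[OF assms] by simp
qed

lemma H_meas[measurable]: "H \<beta> \<in> borel_measurable borel"
proof -
  have [measurable]: "(\<lambda>x. G \<beta> (snd x)) \<in> borel_measurable (borel \<Otimes>\<^sub>M N)"
    by (rule measurable_compose[OF measurable_snd G_meas])
  have [measurable]: "(\<lambda>x. ww (fst x) (snd (snd x))) \<in> borel_measurable (borel \<Otimes>\<^sub>M N)"
    unfolding N_def ww_def by measurable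
  have "(\<lambda>(y, p). G \<beta> p * ennreal (ww y (snd p))) \<in> borel_measurable (borel \<Otimes>\<^sub>M N)"
    unfolding case_prod_beta by measurable
  then show ?thesis unfolding H_def by (rule N.borel_measurable_nn_integral)
qed

text \<open>Both sides have the same transform in y beyond \<beta> + 1, hence agree almost
  everywhere, and both are right continuous.\<close>

lemma overshoot_fun_eq_H:
  assumes \<beta>: "\<Phi> < \<beta>" and y: "0 < y"
  shows "ennreal (overshoot_fun \<beta> y - overshoot_fun (\<beta> + 1) y) = H \<beta> y"
proof -
  have \<beta>': "\<Phi> < \<beta> + 1" and \<beta>0: "0 < \<beta>" using \<beta> \<Phi>0 by auto
  note [measurable] = overshoot_fun_meas[OF \<beta>] overshoot_fun_meas[OF \<beta>']
  have L: "(\<integral>\<^sup>+y\<in>{0..}. eexp (- l * y) * ennreal (overshoot_fun \<beta> y - overshoot_fun (\<beta> + 1) y) \<partial>lborel)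
    = ennreal ((kr \<beta> - kr l) / (kr \<beta> * (l - \<beta>)) - (kr (\<beta> + 1) - kr l) / (kr (\<beta> + 1) * (l - (\<beta> + 1))))"
    if l: "\<beta> + 1 < l" for l
  proof -
    define a where "a = (kr \<beta> - kr l) / (kr \<beta> * (l - \<beta>))"
    define b where "b = (kr (\<beta> + 1) - kr l) / (kr (\<beta> + 1) * (l - (\<beta> + 1)))"
    have b0: "0 \<le> b" unfolding b_def using overshoot_lt_laplace(2)[OF \<beta>' l] kr_pos[OF \<beta>'] l by simp
    have a0: "0 \<le> a" unfolding a_def using overshoot_lt_laplace(2)[OF \<beta>, of l] kr_pos[OF \<beta>] l by simp
    have "(\<integral>\<^sup>+y\<in>{0..}. eexp (- l * y) * ennreal (overshoot_fun \<beta> y - overshoot_fun (\<beta> + 1) y) \<partial>lborel) + ennreal b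
      = (\<integral>\<^sup>+y. eexp (- l * y) * ennreal (overshoot_fun \<beta> y - overshoot_fun (\<beta> + 1) y) * indicator {0..} y + eexp (- l * y) * ennreal (overshoot_fun (\<beta> + 1) y) * indicator {0..} y \<partial>lborel)"
      unfolding b_def overshoot_fun_laplace[OF \<beta>' l, symmetric] by (rule nn_integral_add[symmetric]) measurable
    also have "\<dots> = (\<integral>\<^sup>+y\<in>{0..}. eexp (- l * y) * ennreal (overshoot_fun \<beta> y) \<partial>lborel)"
    proof (rule nn_integral_cong_AE)
      show "AE y in lborel. eexp (- l * y) * ennreal (overshoot_fun \<beta> y - overshoot_fun (\<beta> + 1) y) * indicator {0..} y + eexp (- l * y) * ennreal (overshoot_fun (\<beta> + 1) y) * indicator {0..} y
        = eexp (- l * y) * ennreal (overshoot_fun \<beta> y) * indicator {0..} y"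
        \<comment> \<open>The inequality between the two values of \<open>overshoot_fun\<close> is
          available for y > 0 only; the single point 0 is null.\<close>
        using AE_lborel_singleton[of "0::real"]
      proof eventually_elim
        case (elim y)
        show ?case
        proof (cases "0 < y")
          case True
          have "ennreal (overshoot_fun \<beta> y - overshoot_fun (\<beta> + 1) y) + ennreal (overshoot_fun (\<beta> + 1) y) = ennreal (overshoot_fun \<beta> y)"
            using overshoot_measure_gw(2)[OF \<beta> True] overshoot_fun_nonneg[OF \<beta>', of y] by (simp flip: ennreal_plus)
          then show ?thesis by (simp only: distrib_left[symmetric] distrib_right[symmetric])
        qed (use elim in simp)
      qed
    qed
    also have "\<dots> = ennreal a" unfolding a_def by (rule overshoot_fun_laplace) (use \<beta> l in auto)
    finally have e: "(\<integral>\<^sup>+y\<in>{0..}. eexp (- l * y) * ennreal (overshoot_fun \<beta> y - overshoot_fun (\<beta> + 1) y) \<partial>lborel) + ennreal b = ennreal a" .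
    then obtain d where d: "(\<integral>\<^sup>+y\<in>{0..}. eexp (- l * y) * ennreal (overshoot_fun \<beta> y - overshoot_fun (\<beta> + 1) y) \<partial>lborel) = ennreal d" "0 \<le> d"
      by (cases "\<integral>\<^sup>+y\<in>{0..}. eexp (- l * y) * ennreal (overshoot_fun \<beta> y - overshoot_fun (\<beta> + 1) y) \<partial>lborel") auto
    have "d + b = a" using e unfolding d(1) using d(2) a0 b0 by (simp flip: ennreal_plus)
    then have "d = a - b" by simp
    then show ?thesis unfolding d(1) a_def b_def by simp
  qed
  have "AE y in lborel. 0 \<le> y \<longrightarrow> ennreal (overshoot_fun \<beta> y - overshoot_fun (\<beta> + 1) y) = H \<beta> y"
  proof (rule AE_eq_laplace[of _ _ "\<beta> + 1"])
    show "(\<lambda>y. ennreal (overshoot_fun \<beta> y - overshoot_fun (\<beta> + 1) y)) \<in> borel_measurable borel" by measurable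
    show "H \<beta> \<in> borel_measurable borel" by measurable
    show "(\<integral>\<^sup>+y\<in>{0..}. eexp (- l * y) * ennreal (overshoot_fun \<beta> y - overshoot_fun (\<beta> + 1) y) \<partial>lborel) = (\<integral>\<^sup>+y\<in>{0..}. eexp (- l * y) * H \<beta> y \<partial>lborel)"
      if "\<beta> + 1 < l" for l unfolding L[OF that] H_laplace[OF \<beta> that] ..
    show "(\<integral>\<^sup>+y\<in>{0..}. eexp (- l * y) * ennreal (overshoot_fun \<beta> y - overshoot_fun (\<beta> + 1) y) \<partial>lborel) < \<infinity>" if "\<beta> + 1 < l" for l
      unfolding L[OF that] by simp
  qed
  then have "AE y in lborel. 0 \<le> y \<longrightarrow> overshoot_fun \<beta> y - overshoot_fun (\<beta> + 1) y = enn2real (H \<beta> y)"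
    using AE_lborel_singleton[of "0::real"]
  proof eventually_elim
    case (elim z)
    show ?case
    proof
      assume "0 \<le> z"
      then have "0 < z" "ennreal (overshoot_fun \<beta> z - overshoot_fun (\<beta> + 1) z) = H \<beta> z" using elim by auto
      then show "overshoot_fun \<beta> z - overshoot_fun (\<beta> + 1) z = enn2real (H \<beta> z)"
        using overshoot_measure_gw(2)[OF \<beta> \<open>0 < z\<close>] by (metis diff_ge_0_iff_ge enn2real_ennreal)
    qed
  qed
  then have "overshoot_fun \<beta> y - overshoot_fun (\<beta> + 1) y = enn2real (H \<beta> y)"
    by (rule AE_lborel_right_continuous_eq)
      (use y in \<open>auto intro!: tendsto_diff overshoot_fun_right_cont \<beta> \<beta>' H_right_cont \<beta>0\<close>)
  then show ?thesis using H_finite[OF \<beta>0, of y] by simp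
qed

text \<open>The weight 1 - exp (- v), which as an \<open>ennreal\<close> is 0 for v \<le> 0, removes
  a possible mass at 0, and the transforms of the weighted measures are both \<open>H\<close>. For v
  > 0 the weight can be divided out, which is why \<open>h\<close> has to vanish elsewhere.\<close>

lemma overshoot_law:
  assumes y: "0 < y" and h[measurable]: "h \<in> borel_measurable borel" and h0: "\<And>v. v \<le> 0 \<Longrightarrow> h v = 0"
  shows "(\<integral>\<^sup>+v. h v \<partial>overshoot_measure y) = (\<integral>\<^sup>+v. h v \<partial>levy_overshoot y)"
proof -
  define w where "w v = ennreal (1 - exp (- v))" for v :: real
  have [measurable]: "w \<in> borel_measurable borel" unfolding w_def by measurable
  have gw: "ennreal (gw \<beta> v) = w v * eexp (- \<beta> * v)" for \<beta> v
    unfolding w_def gw_def by (subst ennreal_mult') (simp_all add: mult.commute)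
  have lt: "(\<integral>\<^sup>+v. eexp (- \<beta> * v) \<partial>density K w) = (\<integral>\<^sup>+v. ennreal (gw \<beta> v) \<partial>K)"
    if [measurable_cong]: "sets K = sets borel" for K \<beta>
    unfolding gw by (rule nn_integral_density) measurable
  have nullK: "emeasure (density K w) {..<0} = 0" if [measurable_cong]: "sets K = sets borel" for K
  proof -
    have "emeasure (density K w) {..<0} = (\<integral>\<^sup>+v. w v * indicator {..<0} v \<partial>K)"
      by (rule emeasure_density) (auto simp: that)
    also have "\<dots> = (\<integral>\<^sup>+v. 0 \<partial>K)"
      by (intro nn_integral_cong) (auto simp: w_def indicator_def ennreal_neg)
    finally show ?thesis by simp
  qed
  have nuH: "(\<integral>\<^sup>+v. ennreal (gw \<beta> v) \<partial>levy_overshoot y) = H \<beta> y" for \<beta>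
    unfolding H_def G_def by (subst nn_levy_overshoot) (auto intro!: nn_integral_cong simp: mult_ac)
  have "density (overshoot_measure y) w = density (levy_overshoot y) w"
  proof (rule measure_eqI_laplace[of _ _ \<Phi>])
    fix l assume l: "\<Phi> < l"
    have e: "(\<integral>\<^sup>+v. eexp (- l * v) \<partial>density (overshoot_measure y) w) = H l y"
      unfolding lt[OF sets_overshoot_measure] overshoot_measure_gw(1)[OF l y] overshoot_fun_eq_H[OF l y] ..
    then show "(\<integral>\<^sup>+v. eexp (- l * v) \<partial>density (overshoot_measure y) w) = (\<integral>\<^sup>+v. eexp (- l * v) \<partial>density (levy_overshoot y) w)"
      unfolding lt[OF sets_levy_overshoot] nuH by simp
    show "(\<integral>\<^sup>+v. eexp (- l * v) \<partial>density (overshoot_measure y) w) < \<infinity>"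
      unfolding e by (rule H_finite) (use l \<Phi>0 in simp)
  qed (simp_all add: nullK)
  moreover have "(\<integral>\<^sup>+v. h v * ennreal (1 / (1 - exp (- v))) \<partial>density K w) = (\<integral>\<^sup>+v. h v \<partial>K)"
    if [measurable_cong]: "sets K = sets borel" for K
  proof -
    have "(\<integral>\<^sup>+v. h v * ennreal (1 / (1 - exp (- v))) \<partial>density K w) = (\<integral>\<^sup>+v. w v * (h v * ennreal (1 / (1 - exp (- v)))) \<partial>K)"
      by (rule nn_integral_density) measurable
    also have "\<dots> = (\<integral>\<^sup>+v. h v \<partial>K)"
    proof (rule nn_integral_cong)
      fix v
      show "w v * (h v * ennreal (1 / (1 - exp (- v)))) = h v"
      proof (cases "v \<le> 0")
        case False
        then have "w v * ennreal (1 / (1 - exp (- v))) = 1"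
          by (simp add: w_def ennreal_mult[symmetric])
        then show ?thesis by (metis mult.commute mult.left_commute mult_1_right)
      qed (simp add: h0)
    qed
    finally show ?thesis .
  qed
  ultimately show ?thesis using sets_overshoot_measure sets_levy_overshoot by metis
qed

end

section \<open>The right inverse of the Laplace exponent\<close>

context levy_meas
begin

text \<open>Compensated jumps up to e contribute nonnegatively. For larger ones the exponential is
  dropped, leaving - 1, and in addition \<beta> u below 1.\<close>

lemma J_lower_bound:
  assumes \<beta>: "0 \<le> \<beta>" and e: "0 < e" "e < 1"
  shows "\<beta> * (\<integral>u. u * indicator {e<..<1} u \<partial>\<nu>) - measure \<nu> {e<..} \<le> J \<beta>"
    and "integrable \<nu> (\<lambda>u. u * indicator {e<..<1} u)"
proof -
  have fin: "emeasure \<nu> {e<..} < \<infinity>" by (rule nu_tail[OF e(1)])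
  have i1: "integrable \<nu> (\<lambda>u. indicator {e<..} u :: real)"
    using fin by (intro integrable_real_indicator) auto
  show i2: "integrable \<nu> (\<lambda>u. u * indicator {e<..<1} u)"
    by (rule Bochner_Integration.integrable_bound[OF i1]) (use e in \<open>auto simp: indicator_def\<close>)
  have "\<beta> * (\<integral>u. u * indicator {e<..<1} u \<partial>\<nu>) - measure \<nu> {e<..}
     = (\<integral>u. \<beta> * (u * indicator {e<..<1} u) - indicator {e<..} u \<partial>\<nu>)"
    using i1 i2 by simp
  also have "\<dots> \<le> J \<beta>"
    unfolding J_def
  proof (rule integral_mono_AE)
    show "integrable \<nu> (\<lambda>u. \<beta> * (u * indicator {e<..<1} u) - indicator {e<..} u)" using i1 i2 by simp
    show "integrable \<nu> (\<lambda>u. indicator {0<..} u * theta \<beta> u)" by (rule theta_integrable[OF \<beta>])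
    show "AE u in \<nu>. \<beta> * (u * indicator {e<..<1} u) - indicator {e<..} u \<le> indicator {0<..} u * theta \<beta> u"
      using AE_nu_pos
    proof eventually_elim
      case (elim u)
      have "0 \<le> exp (- (\<beta> * u)) - 1 + \<beta> * u" using exp_minus_bounds(1)[of "\<beta> * u"] \<beta> elim by simp
      moreover have "0 < exp (- (\<beta> * u))" by simp
      ultimately show ?case using elim e by (auto simp: theta_def indicator_def)
    qed
  qed
  finally show "\<beta> * (\<integral>u. u * indicator {e<..<1} u \<partial>\<nu>) - measure \<nu> {e<..} \<le> J \<beta>" .
qed

text \<open>For \<sigma> > 0 the quadratic term wins. For \<sigma> = 0 growth is at least linear
  with slope c plus the integral of u over (e, 1): either c is positive, or that integral grows
  without bound as e decreases, or its limit is covered by \<open>bv\<close>.\<close>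

lemma laplace_exponent_unbounded:
  assumes \<sigma>: "0 \<le> \<sigma>"
    and bv: "\<sigma> = 0 \<and> (\<integral>\<^sup>+z\<in>{0<..}. ennreal (min 1 z) \<partial>\<nu>) < \<infinity> \<longrightarrow> c + (LINT z:{0<..<1}|\<nu>. z) > 0"
  shows "\<exists>b\<ge>0. q < laplace_exponent c \<sigma> \<nu> b"
proof (cases "0 < \<sigma>")
  case True
  define K where "K = measure \<nu> {1/2<..}"
  \<comment> \<open>Makes \<open>c + \<sigma>\<^sup>2 / 2 * b\<close> at least
    \<open>\<bar>q\<bar> + K + 1\<close>, where \<open>K\<close> pays for the lower bound on
    \<open>J\<close>.\<close>
  define b where "b = 1 + 2 * (\<bar>c\<bar> + \<bar>q\<bar> + K + 1) / \<sigma>\<^sup>2"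
  have K: "0 \<le> K" by (simp add: K_def)
  have b: "1 \<le> b" using K True by (simp add: b_def)
  have "\<sigma>\<^sup>2 / 2 * b = \<sigma>\<^sup>2 / 2 + (\<bar>c\<bar> + \<bar>q\<bar> + K + 1)" using True by (simp add: b_def field_simps)
  then have l: "\<bar>q\<bar> + K + 1 \<le> c + \<sigma>\<^sup>2 / 2 * b" using zero_le_power2[of \<sigma>] by linarith
  have "0 \<le> b * (\<integral>u. u * indicator {1/2<..<1} u \<partial>\<nu>)"
    using b by (intro mult_nonneg_nonneg integral_nonneg_AE) (auto simp: indicator_def)
  then have J: "- K \<le> J b" using J_lower_bound(1)[of b "1/2"] b by (simp add: K_def)
  have "1 * (\<bar>q\<bar> + K + 1) \<le> b * (c + \<sigma>\<^sup>2 / 2 * b)"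
    using b l K by (intro mult_mono) auto
  then have "q < laplace_exponent c \<sigma> \<nu> b"
    unfolding laplace_exponent_J using J by (simp add: power2_eq_square algebra_simps)
  then show ?thesis using b by (intro exI[of _ b]) auto
next
  case False
  then have \<sigma>0: "\<sigma> = 0" using \<sigma> by simp
  define I where "I n = (\<integral>\<^sup>+u. ennreal (u * indicator {1 / real (Suc (Suc n))<..<1} u) \<partial>\<nu>)" for n
  define I0 where "I0 = (\<integral>\<^sup>+u. ennreal (u * indicator {0<..<1} u) \<partial>\<nu>)"
  have lim: "I \<longlonglongrightarrow> I0"
    unfolding I_def I0_def
  proof (rule nn_integral_LIMSEQ)
    show "incseq (\<lambda>n u. ennreal (u * indicator {1 / real (Suc (Suc n))<..<1} u))"
    proof (intro incseq_SucI le_funI)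
      fix n and u :: real
      define d1 d2 where "d1 = 1 / real (Suc (Suc n))" and "d2 = 1 / real (Suc (Suc (Suc n)))"
      have "d2 \<le> d1" "0 < d2" by (simp_all add: d1_def d2_def frac_le)
      then have "u * indicator {d1<..<1} u \<le> u * indicator {d2<..<1} u" by (auto simp: indicator_def)
      then show "ennreal (u * indicator {1 / real (Suc (Suc n))<..<1} u) \<le> ennreal (u * indicator {1 / real (Suc (Suc (Suc n)))<..<1} u)"
        unfolding d1_def d2_def by (rule ennreal_leI)
    qed
    fix u :: real
    show "(\<lambda>n. ennreal (u * indicator {1 / real (Suc (Suc n))<..<1} u)) \<longlonglongrightarrow> ennreal (u * indicator {0<..<1} u)"
    proof (cases "0 < u \<and> u < 1")
      case True
      have "(\<lambda>n. 1 / real (Suc (Suc n))) \<longlonglongrightarrow> 0"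
        using LIMSEQ_ignore_initial_segment[OF LIMSEQ_inverse_real_of_nat, of 1] by (simp add: inverse_eq_divide)
      then have "\<forall>\<^sub>F n in sequentially. 1 / real (Suc (Suc n)) < u"
        using True by (intro order_tendstoD(2)) auto
      then have "\<forall>\<^sub>F n in sequentially. ennreal (u * indicator {1 / real (Suc (Suc n))<..<1} u) = ennreal (u * indicator {0<..<1} u)"
        by eventually_elim (use True in \<open>simp add: indicator_def\<close>)
      then show ?thesis by (rule tendsto_eventually)
    next
      case False
      have "u * indicator {1 / real (Suc (Suc n))<..<1} u = 0" for n
      proof -
        define d where "d = 1 / real (Suc (Suc n))"
        have "0 < d" by (simp add: d_def)
        then have "u * indicator {d<..<1} u = 0" using False by (auto simp: indicator_def)
        then show ?thesis by (simp only: d_def)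
      qed
      moreover have "u * indicator {0<..<1} u = 0" using False by (auto simp: indicator_def)
      ultimately show ?thesis by (simp only: tendsto_const)
    qed
  qed measurable
  \<comment> \<open>The case c > 0 is kept apart because \<open>ennreal (- c)\<close> is then 0, and
    \<open>I0\<close> may be 0 too.\<close>
  have gt: "c > 0 \<or> ennreal (- c) < I0"
  proof (cases "I0 < \<infinity>")
    case False
    then have "I0 = top" by (simp add: less_top[symmetric])
    then show ?thesis by simp
  next
    case True
    have "(\<integral>\<^sup>+z\<in>{0<..}. ennreal (min 1 z) \<partial>\<nu>) \<le> (\<integral>\<^sup>+u. ennreal (u * indicator {0<..<1} u) + indicator {1/2<..} u \<partial>\<nu>)"
      by (intro nn_integral_mono) (auto simp: indicator_def min_def)
    also have "\<dots> = I0 + emeasure \<nu> {1/2<..}" unfolding I0_def by (subst nn_integral_add) auto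
    also have "\<dots> < \<infinity>" using True nu_tail[of "1/2"] by simp
    finally have pos: "c + (LINT z:{0<..<1}|\<nu>. z) > 0" using bv \<sigma>0 by simp
    have "(LINT z:{0<..<1}|\<nu>. z) = (\<integral>u. u * indicator {0<..<1} u \<partial>\<nu>)"
      by (simp add: set_lebesgue_integral_def mult.commute)
    also have "\<dots> = enn2real I0"
      unfolding I0_def by (rule integral_eq_nn_integral) (auto simp: indicator_def)
    finally have "- c < enn2real I0" using pos by simp
    moreover have "I0 = ennreal (enn2real I0)" using True by (simp add: less_top)
    ultimately show ?thesis by (cases "c > 0") (auto simp: ennreal_less_iff, metis ennreal_less_iff neg_0_le_iff_le not_less)
  qed
  obtain n where n: "c > 0 \<or> ennreal (- c) < I n"
  proof (cases "c > 0")
    case False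
    then have "\<forall>\<^sub>F n in sequentially. ennreal (- c) < I n"
      using gt lim by (intro order_tendstoD(1)) auto
    then show ?thesis using that eventually_happens'[OF sequentially_bot] by blast
  qed blast
  define e where "e = 1 / real (Suc (Suc n))"
  have e: "0 < e" "e < 1" by (simp_all add: e_def)
  define d where "d = c + (\<integral>u. u * indicator {e<..<1} u \<partial>\<nu>)"
  have In: "I n = ennreal (\<integral>u. u * indicator {e<..<1} u \<partial>\<nu>)"
    unfolding I_def e_def[symmetric]
    by (rule nn_integral_eq_integral[OF J_lower_bound(2)[OF order_refl e]]) (use e in \<open>auto simp: indicator_def\<close>)
  have int0: "0 \<le> (\<integral>u. u * indicator {e<..<1} u \<partial>\<nu>)"
    using e by (intro integral_nonneg_AE) (auto simp: indicator_def)
  have d: "0 < d"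
  proof (cases "c > 0")
    case True then show ?thesis using int0 by (simp add: d_def)
  next
    case False
    then have "ennreal (- c) < ennreal (\<integral>u. u * indicator {e<..<1} u \<partial>\<nu>)" using n In by simp
    then have "- c < (\<integral>u. u * indicator {e<..<1} u \<partial>\<nu>)" using False by (subst (asm) ennreal_less_iff) auto
    then show ?thesis by (simp add: d_def)
  qed
  define b where "b = (\<bar>q\<bar> + measure \<nu> {e<..} + 1) / d"
  have b: "0 \<le> b" using d by (simp add: b_def)
  have "b * d = \<bar>q\<bar> + measure \<nu> {e<..} + 1" using d by (simp add: b_def)
  then have "q < laplace_exponent c \<sigma> \<nu> b"
    unfolding laplace_exponent_J using J_lower_bound(1)[OF b e] \<sigma>0 by (simp add: d_def algebra_simps)
  then show ?thesis using b by blast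
qed

end

section \<open>Existence and uniqueness of the root of \<psi> = q\<close>

context snl
begin

text \<open>exp (\<psi> \<beta>) is the transform of \<open>Y 1\<close>, continuous by dominated
  convergence: for exponents between 0 and B the integrand is at most 1 + exp (B Y 1).\<close>

lemma psi_continuous: "continuous_on {0..} \<psi>"
  unfolding continuous_on_sequentially
proof (intro allI ballI impI)
  fix u :: "nat \<Rightarrow> real" and a assume a: "a \<in> {0..}" and u: "(\<forall>n. u n \<in> {0..}) \<and> u \<longlonglongrightarrow> a"
  then have u0: "\<And>n. 0 \<le> u n" and ul: "u \<longlonglongrightarrow> a" and a0: "0 \<le> a" by auto
  have [measurable]: "Y 1 \<in> borel_measurable M" by (rule Ym) simp
  have "Bseq u" using ul convergentI convergent_imp_Bseq by blast
  then obtain B where B: "0 < B" "\<And>n. u n \<le> B" by (auto simp: Bseq_def abs_le_iff)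
  have "(\<lambda>n. \<integral>\<^sup>+\<omega>. eexp (u n * Y 1 \<omega>) \<partial>M) \<longlonglongrightarrow> (\<integral>\<^sup>+\<omega>. eexp (a * Y 1 \<omega>) \<partial>M)"
  proof (rule nn_integral_dominated_convergence[where w = "\<lambda>\<omega>. 1 + eexp (B * Y 1 \<omega>)"])
    have "(\<integral>\<^sup>+\<omega>. 1 + eexp (B * Y 1 \<omega>) \<partial>M) = 1 + eexp (1 * \<psi> B)"
      using B(1) mgf[of B 1] by (subst nn_integral_add) (auto simp: emeasure_space_1)
    then show "(\<integral>\<^sup>+\<omega>. 1 + eexp (B * Y 1 \<omega>) \<partial>M) < \<infinity>" by simp
    have "exp (u n * Y 1 \<omega>) \<le> 1 + exp (B * Y 1 \<omega>)" for n \<omega>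
    proof (cases "0 \<le> Y 1 \<omega>")
      case True
      then have "exp (u n * Y 1 \<omega>) \<le> exp (B * Y 1 \<omega>)" using B(2) by (simp add: mult_right_mono)
      then show ?thesis by linarith
    next
      case False
      then have "exp (u n * Y 1 \<omega>) \<le> 1" using u0[of n] by (simp add: mult_nonneg_nonpos)
      moreover have "0 < exp (B * Y 1 \<omega>)" by simp
      ultimately show ?thesis by linarith
    qed
    then show "AE \<omega> in M. eexp (u j * Y 1 \<omega>) \<le> 1 + eexp (B * Y 1 \<omega>)" for j
      by (auto simp: ennreal_1[symmetric] ennreal_plus[symmetric] simp del: ennreal_1 ennreal_plus intro!: ennreal_leI)
    show "AE \<omega> in M. (\<lambda>n. eexp (u n * Y 1 \<omega>)) \<longlonglongrightarrow> eexp (a * Y 1 \<omega>)"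
      by (auto intro!: tendsto_ennrealI tendsto_intros ul)
  qed measurable
  then have "(\<lambda>n. eexp (\<psi> (u n))) \<longlonglongrightarrow> eexp (\<psi> a)"
    using mgf[OF u0, of 1] mgf[OF a0, of 1] by simp
  then have "(\<lambda>n. exp (\<psi> (u n))) \<longlonglongrightarrow> exp (\<psi> a)" by (rule tendsto_ennrealD) auto
  from tendsto_ln[OF this] show "(\<psi> \<circ> u) \<longlonglongrightarrow> \<psi> a" by (simp add: comp_def)
qed

text \<open>At any root a, \<open>sup_tail_identity\<close> at level 1 reads exp a * P (sup > 1) =
  1, which determines a.\<close>

lemma psi_root_unique:
  assumes "0 \<le> a" "\<psi> a = q" "0 \<le> b" "\<psi> b = q"
  shows "a = b"
proof -
  have "exp a * enn2real (sup_tail 1) = 1" "exp b * enn2real (sup_tail 1) = 1"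
    using sup_tail_identity[of a 1] sup_tail_identity[of b 1] assms by simp_all
  then have "exp a = exp b" by (metis mult_cancel_right zero_neq_one mult_zero_right)
  then show ?thesis by simp
qed

lemma psi_root_exists:
  assumes "\<psi> 0 = 0" "0 \<le> b" "q < \<psi> b"
  shows "\<exists>a>0. \<psi> a = q"
proof -
  have "continuous_on {0..b} \<psi>" by (rule continuous_on_subset[OF psi_continuous]) auto
  then obtain a where a: "0 \<le> a" "a \<le> b" "\<psi> a = q"
    using IVT'[of \<psi> 0 q b] assms q by auto
  moreover have "a \<noteq> 0" using a assms q by auto
  ultimately show ?thesis by (intro exI[of _ a]) auto
qed

end

section \<open>The formula\<close>

context snl_X
begin

text \<open>By \<open>overshoot_law\<close> the expectation is the integral of \<open>F3\<close>,
  and the definition of \<open>ww\<close> splits \<open>F3\<close> into \<open>W y * F1\<close> and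
  \<open>F2\<close>. The work lies in the absolute convergence of the two pieces.\<close>

lemma passage_formula:
  fixes g :: "real \<Rightarrow> real"
  assumes A: "A < x"
    and g[measurable]: "g \<in> borel_measurable borel" and lb: "locally_bounded g" and c2: "C2_near g A"
    and sup: "(\<integral>\<^sup>+u\<in>{1..}. (SUP \<zeta>\<in>{A - u..A}. ennreal \<bar>g \<zeta> - g A\<bar>) \<partial>\<nu>) < \<infinity>"
  shows "(\<integral>\<omega>. (if first_passage X A \<omega> < \<infinity> \<and> X (pt A \<omega>) \<omega> < A then exp (- q * pt A \<omega>) * (g (X (pt A \<omega>) \<omega>) - g A) else 0) \<partial>M)
    = W (x - A) * (LINT u:{0<..}|\<nu>. LINT z:{0..u}|lborel. exp (- \<Phi> * z) * (g (z + A - u) - g A)) - varphi \<nu> W g A x"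
proof -
  define y where "y = x - A"
  have y: "0 < y" and Ay: "A = x - y" using A by (auto simp: y_def)
  \<comment> \<open>The payoff as a function of the overshoot, set to 0 for v \<le> 0 so that
    \<open>overshoot_law\<close> applies.\<close>
  define f where "f v = (if 0 < v then g (A - v) - g A else 0)" for v
  have fm[measurable]: "f \<in> borel_measurable borel" unfolding f_def by measurable
  have fle: "f v = 0" if "v \<le> 0" for v using that by (simp add: f_def)
  \<comment> \<open>Differentiability at A bounds the increment by
    \<open>(\<bar>g'\<bar> + 1) * v\<close> for v < d. From d to 1, boundedness on [A - 1, A] gives
    2 B, which is at most (2 B / d) v.\<close>
  obtain C where C: "0 \<le> C" "\<And>v. 0 \<le> v \<Longrightarrow> v \<le> 1 \<Longrightarrow> \<bar>f v\<bar> \<le> C * v"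
  proof -
    obtain g' where g': "(g has_real_derivative g') (at A)" using c2 unfolding C2_near_def by blast
    then have "((\<lambda>h. (g (A + h) - g A) / h) \<longlongrightarrow> g') (at 0)" by (simp add: DERIV_def)
    then have "\<forall>\<^sub>F h in at 0. dist ((g (A + h) - g A) / h) g' < 1" by (rule tendstoD) simp
    then obtain d where d: "0 < d" "\<And>h. h \<noteq> 0 \<Longrightarrow> \<bar>h\<bar> < d \<Longrightarrow> dist ((g (A + h) - g A) / h) g' < 1"
      by (auto simp: eventually_at dist_real_def)
    have "bounded (g ` {A - 1..A})" using lb unfolding locally_bounded_def by blast
    then obtain B where B: "\<And>z. A - 1 \<le> z \<Longrightarrow> z \<le> A \<Longrightarrow> \<bar>g z\<bar> \<le> B" by (force simp: bounded_iff)
    have B0: "0 \<le> B" using B[of A] by simp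
    define C where "C = max (\<bar>g'\<bar> + 1) (2 * B / d)"
    have "\<bar>f v\<bar> \<le> C * v" if v: "0 \<le> v" "v \<le> 1" for v
    proof (cases "v = 0")
      case False
      then have v0: "0 < v" using v by simp
      show ?thesis
      proof (cases "v < d")
        case True
        have "dist ((g (A + - v) - g A) / - v) g' < 1" using d(2)[of "- v"] v0 True by simp
        then have "\<bar>(g (A - v) - g A) / - v\<bar> \<le> \<bar>g'\<bar> + 1" by (auto simp: dist_real_def)
        then have "\<bar>g (A - v) - g A\<bar> \<le> (\<bar>g'\<bar> + 1) * v" using v0 by (simp add: abs_divide pos_divide_le_eq)
        also have "\<dots> \<le> C * v" using v0 by (intro mult_right_mono) (auto simp: C_def)
        finally show ?thesis using v0 by (simp add: f_def)
      next
        case False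
        have "\<bar>g (A - v) - g A\<bar> \<le> 2 * B" using B[of "A - v"] B[of A] v by linarith
        also have "\<dots> = 2 * B / d * d" using d by simp
        also have "\<dots> \<le> C * v" using False d B0 by (intro mult_mono) (auto simp: C_def)
        finally show ?thesis using v0 by (simp add: f_def)
      qed
    qed (simp add: f_def)
    moreover have "0 \<le> C" by (simp add: C_def)
    ultimately show ?thesis using that by blast
  qed
  define F1 where "F1 p = (if 0 \<le> snd p \<and> snd p \<le> fst p then exp (- \<Phi> * snd p) * f (fst p - snd p) else 0)" for p :: "real \<times> real"
  define F2 where "F2 p = (if 0 \<le> snd p \<and> snd p \<le> fst p then W (y - snd p) * f (fst p - snd p) else 0)" for p :: "real \<times> real"
  define F3 where "F3 p = (if 0 \<le> snd p \<and> snd p \<le> fst p then ww y (snd p) * f (fst p - snd p) else 0)" for p :: "real \<times> real"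
  have F1m[measurable]: "F1 \<in> borel_measurable N" unfolding F1_def N_def by measurable
  have F2m[measurable]: "F2 \<in> borel_measurable N" unfolding F2_def N_def by measurable
  have F3m[measurable]: "F3 \<in> borel_measurable N" unfolding F3_def N_def ww_def by measurable
  have F1fin: "(\<integral>\<^sup>+p. ennreal \<bar>F1 p\<bar> \<partial>N) < \<infinity>"
  proof -
    \<comment> \<open>Jumps below 1 cost at most C u^2 by the linear bound. Larger ones cost at most
      the supremum over [A - u, A] times 1 / \<Phi>, the integral of exp (- \<Phi> z).\<close>
    define R where "R u = (\<integral>\<^sup>+z. ennreal \<bar>F1 (u, z)\<bar> \<partial>lborel)" for u
    have Rm[measurable]: "R \<in> borel_measurable borel"
    proof -
      have "(\<lambda>(u, z). ennreal \<bar>F1 (u, z)\<bar>) \<in> borel_measurable (borel \<Otimes>\<^sub>M lborel)"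
        unfolding F1_def by measurable
      then show ?thesis unfolding R_def by (rule lborel.borel_measurable_nn_integral)
    qed
    have R1: "R u * indicator {..<1} u \<le> ennreal (C * min 1 (u\<^sup>2))" if u: "0 < u" for u
    proof (cases "u < 1")
      case True
      have "R u \<le> (\<integral>\<^sup>+z. ennreal (C * u) * indicator {0..u} z \<partial>lborel)"
        unfolding R_def
      proof (rule nn_integral_mono)
        fix z
        have "exp (- \<Phi> * z) * \<bar>f (u - z)\<bar> \<le> C * u" if z: "0 \<le> z" "z \<le> u"
        proof -
          have "exp (- \<Phi> * z) * \<bar>f (u - z)\<bar> \<le> 1 * (C * (u - z))"
            using C(2)[of "u - z"] z True \<Phi>0 by (intro mult_mono) auto
          also have "\<dots> \<le> C * u" using z C(1) by (simp add: mult_left_mono)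
          finally show ?thesis .
        qed
        then show "ennreal \<bar>F1 (u, z)\<bar> \<le> ennreal (C * u) * indicator {0..u} z"
          by (auto simp: F1_def indicator_def abs_mult intro!: ennreal_leI)
      qed
      also have "\<dots> = ennreal (C * u\<^sup>2)"
        using u C(1) by (simp add: nn_integral_cmult_indicator ennreal_mult[symmetric] power2_eq_square mult.assoc)
      also have "u\<^sup>2 = min 1 (u\<^sup>2)" using True u by (simp add: power_le_one min_absorb2)
      finally show ?thesis using True by simp
    qed simp
    have R2: "ennreal \<Phi> * (R u * indicator {1..} u) \<le> (SUP \<zeta>\<in>{A - u..A}. ennreal \<bar>g \<zeta> - g A\<bar>) * indicator {1..} u" for u
    proof (cases "1 \<le> u")
      case True
      define m where "m = (SUP \<zeta>\<in>{A - u..A}. ennreal \<bar>g \<zeta> - g A\<bar>)"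
      have "R u \<le> (\<integral>\<^sup>+z. m * (of_bool (0 \<le> z) * eexp (- \<Phi> * z)) \<partial>lborel)"
        unfolding R_def
      proof (rule nn_integral_mono)
        fix z
        show "ennreal \<bar>F1 (u, z)\<bar> \<le> m * (of_bool (0 \<le> z) * eexp (- \<Phi> * z))"
        proof (cases "0 \<le> z \<and> z \<le> u")
          case True
          have "ennreal \<bar>f (u - z)\<bar> \<le> m"
          proof (cases "z < u")
            case z: True
            have "ennreal \<bar>g (A - (u - z)) - g A\<bar> \<le> m"
              unfolding m_def by (rule SUP_upper) (use True in auto)
            then show ?thesis using z by (simp add: f_def)
          qed (simp add: f_def)
          then have "eexp (- \<Phi> * z) * ennreal \<bar>f (u - z)\<bar> \<le> eexp (- \<Phi> * z) * m"
            by (rule mult_left_mono) simp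
          then show ?thesis using True by (simp add: F1_def abs_mult ennreal_mult mult.commute)
        qed (auto simp: F1_def)
      qed
      also have "\<dots> = m * ennreal (1 / \<Phi>)"
        using nn_integral_exp_Ici[OF \<Phi>0, of 0] by (subst nn_integral_cmult) auto
      finally have "ennreal \<Phi> * R u \<le> ennreal \<Phi> * (m * ennreal (1 / \<Phi>))" by (rule mult_left_mono) simp
      also have "\<dots> = m * (ennreal \<Phi> * ennreal (1 / \<Phi>))" by (simp only: mult_ac)
      also have "ennreal \<Phi> * ennreal (1 / \<Phi>) = 1" using \<Phi>0 by (simp add: ennreal_mult[symmetric])
      finally show ?thesis using True by (simp add: m_def)
    qed simp
    have fin1: "(\<integral>\<^sup>+u. R u * indicator {..<1} u \<partial>\<nu>) < \<infinity>"
    proof -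
      have "(\<integral>\<^sup>+u. R u * indicator {..<1} u \<partial>\<nu>) \<le> (\<integral>\<^sup>+u. ennreal (C * min 1 (u\<^sup>2)) \<partial>\<nu>)"
        by (intro nn_integral_mono_AE, use AE_nu_pos in eventually_elim) (rule R1)
      also have "\<dots> = ennreal C * (\<integral>\<^sup>+u. ennreal (min 1 (u\<^sup>2)) \<partial>\<nu>)"
        using C(1) by (subst nn_integral_cmult[symmetric]) (auto simp: ennreal_mult')
      also have "\<dots> < \<infinity>" using nu_min by (simp add: ennreal_mult_less_top)
      finally show ?thesis .
    qed
    have fin2: "(\<integral>\<^sup>+u. R u * indicator {1..} u \<partial>\<nu>) < \<infinity>"
    proof -
      have "ennreal \<Phi> * (\<integral>\<^sup>+u. R u * indicator {1..} u \<partial>\<nu>) = (\<integral>\<^sup>+u. ennreal \<Phi> * (R u * indicator {1..} u) \<partial>\<nu>)"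
        by (rule nn_integral_cmult[symmetric]) measurable
      also have "\<dots> \<le> (\<integral>\<^sup>+u\<in>{1..}. (SUP \<zeta>\<in>{A - u..A}. ennreal \<bar>g \<zeta> - g A\<bar>) \<partial>\<nu>)"
        by (intro nn_integral_mono R2)
      finally have "ennreal \<Phi> * (\<integral>\<^sup>+u. R u * indicator {1..} u \<partial>\<nu>) < top" using sup le_less_trans by auto
      then show ?thesis using \<Phi>0 by (auto simp: ennreal_mult_less_top)
    qed
    have "(\<integral>\<^sup>+p. ennreal \<bar>F1 p\<bar> \<partial>N) = (\<integral>\<^sup>+u. R u \<partial>\<nu>)"
      unfolding R_def using F1m unfolding N_def by (subst lborel.nn_integral_fst[symmetric]) auto
    also have "\<dots> = (\<integral>\<^sup>+u. R u * indicator {..<1} u + R u * indicator {1..} u \<partial>\<nu>)"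
      by (intro nn_integral_cong) (auto simp: indicator_def)
    also have "\<dots> = (\<integral>\<^sup>+u. R u * indicator {..<1} u \<partial>\<nu>) + (\<integral>\<^sup>+u. R u * indicator {1..} u \<partial>\<nu>)"
      by (rule nn_integral_add) measurable
    also have "\<dots> < \<infinity>" using fin1 fin2 by simp
    finally show ?thesis .
  qed
  have i1: "integrable N F1" by (rule integrableI_bounded) (use F1fin in \<open>auto\<close>)
  \<comment> \<open>\<open>ww_nonneg\<close> says that W (y - z) is at most W y exp (- \<Phi> z), so
    \<open>F2\<close> is dominated by a multiple of \<open>F1\<close>.\<close>
  have i2: "integrable N F2"
  proof (rule Bochner_Integration.integrable_bound)
    show "integrable N (\<lambda>p. W y * F1 p)" using i1 by simp
    have "\<bar>F2 p\<bar> \<le> W y * \<bar>F1 p\<bar>" for p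
    proof (cases "0 \<le> snd p \<and> snd p \<le> fst p")
      case True
      then have "W (y - snd p) \<le> W y * exp (- \<Phi> * snd p)" using ww_nonneg[of "snd p" y] by (simp add: ww_def)
      then have "W (y - snd p) * \<bar>f (fst p - snd p)\<bar> \<le> W y * exp (- \<Phi> * snd p) * \<bar>f (fst p - snd p)\<bar>"
        by (intro mult_right_mono) auto
      then show ?thesis using True W_nonneg by (simp add: F1_def F2_def abs_mult mult.assoc)
    qed (auto simp: F2_def F1_def)
    then show "AE p in N. norm (F2 p) \<le> norm (W y * F1 p)" using W_nonneg by (simp add: abs_mult)
  qed measurable
  have F3: "F3 p = W y * F1 p - F2 p" for p by (simp add: F1_def F2_def F3_def ww_def algebra_simps)
  have i3: "integrable N F3" unfolding F3 using i1 i2 by simp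
  define Ig where "Ig \<omega> = (if first_passage X A \<omega> < \<infinity> \<and> X (pt A \<omega>) \<omega> < A then exp (- q * pt A \<omega>) * (g (X (pt A \<omega>) \<omega>) - g A) else 0)" for \<omega>
  have [measurable]: "Ig \<in> borel_measurable M" unfolding Ig_def by measurable
  have law: "(\<integral>\<^sup>+\<omega>. discount A \<omega> * h (A - X (pt A \<omega>) \<omega>) \<partial>M) = (\<integral>\<^sup>+p. of_bool (0 \<le> snd p \<and> snd p \<le> fst p) * ennreal (ww y (snd p)) * h (fst p - snd p) \<partial>N)"
    if h: "h \<in> borel_measurable borel" "\<And>v. v \<le> 0 \<Longrightarrow> h v = 0" for h
    using overshoot_law[OF y h] unfolding nn_overshoot_measure[OF h(1)] nn_levy_overshoot[OF h(1)] Ay[symmetric] .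
  have Ig: "Ig \<omega> = (if first_passage X A \<omega> < \<infinity> then exp (- q * pt A \<omega>) else 0) * f (A - X (pt A \<omega>) \<omega>)" for \<omega>
    by (simp add: Ig_def f_def)
  \<comment> \<open>The law transfers nonnegative integrands only. Positive homogeneity lets
    \<open>k\<close> pass through the discount and \<open>ww\<close>; the absolute value gives
    integrability, the identity and the negation give positive and negative parts.\<close>
  have tr: "(\<integral>\<^sup>+\<omega>. ennreal (k (Ig \<omega>)) \<partial>M) = (\<integral>\<^sup>+p. ennreal (k (F3 p)) \<partial>N)"
    if k: "k \<in> borel_measurable borel" "\<And>a b. 0 \<le> a \<Longrightarrow> k (a * b) = a * k b" for k :: "real \<Rightarrow> real"
  proof -
    note [measurable] = k(1)
    have k0: "k 0 = 0" using k(2)[of 0 0] by simp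
    have "(\<integral>\<^sup>+\<omega>. ennreal (k (Ig \<omega>)) \<partial>M) = (\<integral>\<^sup>+\<omega>. discount A \<omega> * ennreal (k (f (A - X (pt A \<omega>) \<omega>))) \<partial>M)"
      by (intro nn_integral_cong) (auto simp: Ig discount_def k(2) k0 ennreal_mult')
    also have "\<dots> = (\<integral>\<^sup>+p. of_bool (0 \<le> snd p \<and> snd p \<le> fst p) * ennreal (ww y (snd p)) * ennreal (k (f (fst p - snd p))) \<partial>N)"
      by (rule law) (auto simp: fle k0)
    also have "\<dots> = (\<integral>\<^sup>+p. ennreal (k (F3 p)) \<partial>N)"
      by (intro nn_integral_cong) (auto simp: F3_def k(2) k0 ennreal_mult' ww_nonneg)
    finally show ?thesis .
  qed
  have iIg: "integrable M Ig"
  proof (rule integrableI_bounded)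
    have "(\<integral>\<^sup>+\<omega>. ennreal (norm (Ig \<omega>)) \<partial>M) = (\<integral>\<^sup>+p. ennreal \<bar>F3 p\<bar> \<partial>N)"
      using tr[of abs] by (simp add: abs_mult)
    also have "\<dots> < \<infinity>" using i3 by (simp add: integrable_iff_bounded)
    finally show "(\<integral>\<^sup>+\<omega>. ennreal (norm (Ig \<omega>)) \<partial>M) < \<infinity>" .
  qed measurable
  have "(\<integral>\<omega>. Ig \<omega> \<partial>M) = (\<integral>p. F3 p \<partial>N)"
    unfolding real_lebesgue_integral_def[OF iIg] real_lebesgue_integral_def[OF i3]
    using tr[of "\<lambda>a. a"] tr[of "\<lambda>a. - a"] by simp
  also have "\<dots> = W y * (\<integral>p. F1 p \<partial>N) - (\<integral>p. F2 p \<partial>N)"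
    unfolding F3 using i1 i2 by simp
  also have "(\<integral>p. F1 p \<partial>N) = (LINT u:{0<..}|\<nu>. LINT z:{0..u}|lborel. exp (- \<Phi> * z) * (g (z + A - u) - g A))"
  proof -
    have "(\<integral>p. F1 p \<partial>N) = (\<integral>u. \<integral>z. F1 (u, z) \<partial>lborel \<partial>\<nu>)"
      using i1 unfolding N_def by (rule pN.integral_fst'[symmetric])
    also have "\<dots> = (LINT u:{0<..}|\<nu>. LINT z:{0..u}|lborel. exp (- \<Phi> * z) * (g (z + A - u) - g A))"
      unfolding set_lebesgue_integral_def
    proof (rule Bochner_Integration.integral_cong[OF refl])
      fix u
      have "(\<lambda>z. F1 (u, z)) = (\<lambda>z. indicator {0<..} u *\<^sub>R (indicator {0..u} z *\<^sub>R (exp (- \<Phi> * z) * (g (z + A - u) - g A))))"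
        by (auto simp: fun_eq_iff F1_def f_def indicator_def algebra_simps)
      then show "(\<integral>z. F1 (u, z) \<partial>lborel) = indicator {0<..} u *\<^sub>R (\<integral>z. indicator {0..u} z *\<^sub>R (exp (- \<Phi> * z) * (g (z + A - u) - g A)) \<partial>lborel)"
        by simp
    qed
    finally show ?thesis .
  qed
  also have "(\<integral>p. F2 p \<partial>N) = varphi \<nu> W g A x"
  proof -
    have "(\<integral>p. F2 p \<partial>N) = (\<integral>u. \<integral>z. F2 (u, z) \<partial>lborel \<partial>\<nu>)"
      using i2 unfolding N_def by (rule pN.integral_fst'[symmetric])
    also have "\<dots> = varphi \<nu> W g A x"
      unfolding varphi_def set_lebesgue_integral_def
    proof (rule Bochner_Integration.integral_cong[OF refl])
      fix u
      \<comment> \<open>For z > y the factor \<open>W (y - z)\<close> vanishes, which accounts for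
        the upper limit \<open>min u (x - A)\<close>; at z = u both integrands are 0.\<close>
      have "(\<lambda>z. F2 (u, z)) = (\<lambda>z. indicator {0<..} u *\<^sub>R (indicator {0..min u (x - A)} z *\<^sub>R (W (x - z - A) * (g (z + A - u) - g A))))"
      proof (rule ext)
        fix z
        have "W (x - z - A) = W (y - z)" by (simp add: y_def algebra_simps)
        moreover have "W (y - z) = 0" if "\<not> z \<le> x - A" using that by (intro W0) (simp add: y_def)
        moreover have "g (z + A - u) = g (A - (u - z))" by (simp add: algebra_simps)
        ultimately show "F2 (u, z) = indicator {0<..} u *\<^sub>R (indicator {0..min u (x - A)} z *\<^sub>R (W (x - z - A) * (g (z + A - u) - g A)))"
          by (auto simp: F2_def f_def indicator_def)
      qed
      then show "(\<integral>z. F2 (u, z) \<partial>lborel) = indicator {0<..} u *\<^sub>R (\<integral>z. indicator {0..min u (x - A)} z *\<^sub>R (W (x - z - A) * (g (z + A - u) - g A)) \<partial>lborel)"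
        by simp
    qed
    finally show ?thesis .
  qed
  finally show ?thesis unfolding Ig_def y_def .
qed

end

text \<open>Independence is a condition on finite subfamilies, and a finite set of natural numbers
  lies in an initial segment.\<close>

lemma (in prob_space) indep_vars_nat_if_initial:
  assumes "\<And>n. indep_vars N V {..<n::nat}"
  shows "indep_vars N V UNIV"
proof -
  have rv: "random_variable (N i) (V i)" for i
    using assms[of "Suc i"] by (auto simp: indep_vars_def)
  have "indep_sets (\<lambda>i. {V i -` A \<inter> space M |A. A \<in> sets (N i)}) J" if fin: "finite J" for J :: "nat set"
  proof -
    obtain n where "J \<subseteq> {..<n}" using fin finite_nat_iff_bounded[of J] by metis
    moreover have "indep_sets (\<lambda>i. {V i -` A \<inter> space M |A. A \<in> sets (N i)}) {..<n}"
      using assms[of n] unfolding indep_vars_def2 by (rule conjunct2)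
    ultimately show ?thesis by (rule indep_sets_mono_index)
  qed
  then have "indep_sets (\<lambda>i. {V i -` A \<inter> space M |A. A \<in> sets (N i)}) UNIV"
    by (subst indep_sets_finite_index_sets) blast
  then show ?thesis using rv unfolding indep_vars_def2 by blast
qed

lemma snl_of_levy:
  assumes L: "spectrally_negative_levy P X c \<sigma> \<nu>" and q: "0 < q"
  shows "snl (P x) (\<lambda>t \<omega>. X t \<omega> - X 0 \<omega>) (laplace_exponent c \<sigma> \<nu>) q"
proof -
  have lp: "levy_process (P x) X" and X0: "AE \<omega> in P x. X 0 \<omega> = x"
    and nj: "\<And>\<omega>. \<omega> \<in> space (P x) \<Longrightarrow> only_negative_jumps (\<lambda>t. X t \<omega>)"
    and mg: "\<And>\<beta> t. 0 \<le> \<beta> \<Longrightarrow> 0 \<le> t \<Longrightarrow> (\<integral>\<omega>. exp (\<beta> * X t \<omega>) \<partial>P x) = exp (\<beta> * x + t * laplace_exponent c \<sigma> \<nu> \<beta>)"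
    using L unfolding spectrally_negative_levy_def by blast+
  have ps: "prob_space (P x)" and Xm: "\<And>t. 0 \<le> t \<Longrightarrow> X t \<in> borel_measurable (P x)"
    and ind: "\<And>(n::nat) (t :: nat \<Rightarrow> real). 0 \<le> t 0 \<Longrightarrow> mono t \<Longrightarrow>
        prob_space.indep_vars (P x) (\<lambda>_. borel) (\<lambda>i \<omega>. X (t (Suc i)) \<omega> - X (t i) \<omega>) {..<n}"
    and stat: "\<And>s t. 0 \<le> s \<Longrightarrow> 0 \<le> t \<Longrightarrow> distr (P x) borel (\<lambda>\<omega>. X (s + t) \<omega> - X s \<omega>) = distr (P x) borel (\<lambda>\<omega>. X t \<omega> - X 0 \<omega>)"
    and cl: "\<And>\<omega>. \<omega> \<in> space (P x) \<Longrightarrow> cadlag (\<lambda>t. X t \<omega>)"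
    using lp unfolding levy_process_def by blast+
  interpret prob_space "P x" by fact
  have [measurable]: "X 0 \<in> borel_measurable (P x)" by (rule Xm) simp
  show ?thesis
  proof (intro snl.intro snl_axioms.intro)
    show "prob_space (P x)" by fact
    show "(\<lambda>\<omega>. X t \<omega> - X 0 \<omega>) \<in> borel_measurable (P x)" if "0 \<le> t" for t
      using Xm[OF that] by measurable
    show "snpath (\<lambda>t. X t \<omega> - X 0 \<omega>)" if \<omega>: "\<omega> \<in> space (P x)" for \<omega>
    proof (rule snpath.intro)
      show "((\<lambda>t. X t \<omega> - X 0 \<omega>) \<longlongrightarrow> X t \<omega> - X 0 \<omega>) (at_right t)" if "0 \<le> t" for t
        using cl[OF \<omega>] that unfolding cadlag_def by (intro tendsto_diff tendsto_const) auto
      show "\<exists>l. ((\<lambda>t. X t \<omega> - X 0 \<omega>) \<longlongrightarrow> l) (at_left t) \<and> X t \<omega> - X 0 \<omega> \<le> l" if t: "0 < t" for t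
      proof -
        obtain l where l: "((\<lambda>t. X t \<omega>) \<longlongrightarrow> l) (at_left t)" using cl[OF \<omega>] t unfolding cadlag_def by blast
        have "X t \<omega> \<le> l" using nj[OF \<omega>] t l unfolding only_negative_jumps_def by blast
        then show ?thesis by (intro exI[of _ "l - X 0 \<omega>"] conjI tendsto_diff l tendsto_const) simp
      qed
    qed simp
    show "distr (P x) (\<Pi>\<^sub>M i\<in>(UNIV::nat set). borel) (\<lambda>\<omega>. incr n (\<lambda>t. X t \<omega> - X 0 \<omega>))
       = (\<Pi>\<^sub>M i\<in>(UNIV::nat set). distr (P x) borel (\<lambda>\<omega>. X (dy n 1) \<omega> - X 0 \<omega>))" for n
    proof -
      have mono: "mono (dy n)" by (auto simp: mono_def dy_def divide_right_mono)
      have rv: "random_variable borel (\<lambda>\<omega>. X (dy n (Suc i)) \<omega> - X (dy n i) \<omega>)" for i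
        using Xm[of "dy n (Suc i)"] Xm[of "dy n i"] by measurable
      have "indep_vars (\<lambda>_. borel) (\<lambda>i \<omega>. X (dy n (Suc i)) \<omega> - X (dy n i) \<omega>) UNIV"
        by (rule indep_vars_nat_if_initial) (rule ind, simp, rule mono)
      then have "distr (P x) (\<Pi>\<^sub>M i\<in>(UNIV::nat set). borel) (\<lambda>\<omega>. \<lambda>i\<in>UNIV. X (dy n (Suc i)) \<omega> - X (dy n i) \<omega>)
        = (\<Pi>\<^sub>M i\<in>(UNIV::nat set). distr (P x) borel (\<lambda>\<omega>. X (dy n (Suc i)) \<omega> - X (dy n i) \<omega>))"
        by (subst (asm) indep_vars_iff_distr_eq_PiM'[OF _ rv]) auto
      moreover have "distr (P x) borel (\<lambda>\<omega>. X (dy n (Suc i)) \<omega> - X (dy n i) \<omega>) = distr (P x) borel (\<lambda>\<omega>. X (dy n 1) \<omega> - X 0 \<omega>)" for i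
      proof -
        have "dy n (Suc i) = dy n i + dy n 1" by (simp add: dy_def add_divide_distrib)
        then show ?thesis using stat[of "dy n i" "dy n 1"] by simp
      qed
      moreover have "(\<lambda>\<omega>. incr n (\<lambda>t. X t \<omega> - X 0 \<omega>)) = (\<lambda>\<omega>. \<lambda>i\<in>UNIV. X (dy n (Suc i)) \<omega> - X (dy n i) \<omega>)"
        by (simp add: incr_def fun_eq_iff)
      ultimately show ?thesis by simp
    qed
    show "(\<integral>\<^sup>+\<omega>. eexp (\<beta> * (X t \<omega> - X 0 \<omega>)) \<partial>P x) = eexp (t * laplace_exponent c \<sigma> \<nu> \<beta>)"
      if "0 \<le> \<beta>" "0 \<le> t" for \<beta> t
    proof -
      have [measurable]: "X t \<in> borel_measurable (P x)" by (rule Xm[OF that(2)])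
      \<comment> \<open>The Bochner integral of a non-integrable function is 0 by convention,
        whereas the prescribed value is an exponential.\<close>
      have i: "integrable (P x) (\<lambda>\<omega>. exp (\<beta> * X t \<omega>))"
      proof (rule ccontr)
        assume "\<not> integrable (P x) (\<lambda>\<omega>. exp (\<beta> * X t \<omega>))"
        then have "(\<integral>\<omega>. exp (\<beta> * X t \<omega>) \<partial>P x) = 0" by (rule not_integrable_integral_eq)
        then show False using mg[OF that] by simp
      qed
      have "(\<integral>\<^sup>+\<omega>. eexp (\<beta> * (X t \<omega> - X 0 \<omega>)) \<partial>P x) = (\<integral>\<^sup>+\<omega>. eexp (- \<beta> * x) * eexp (\<beta> * X t \<omega>) \<partial>P x)"
      proof (rule nn_integral_cong_AE)
        show "AE \<omega> in P x. eexp (\<beta> * (X t \<omega> - X 0 \<omega>)) = eexp (- \<beta> * x) * eexp (\<beta> * X t \<omega>)"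
          using X0 by eventually_elim (simp add: ennreal_mult[symmetric] exp_add[symmetric] algebra_simps)
      qed
      also have "\<dots> = eexp (- \<beta> * x) * eexp (\<beta> * x + t * laplace_exponent c \<sigma> \<nu> \<beta>)"
        using nn_integral_eq_integral[OF i] mg[OF that] by (subst nn_integral_cmult) auto
      also have "\<dots> = eexp (t * laplace_exponent c \<sigma> \<nu> \<beta>)"
        by (simp add: ennreal_mult[symmetric] exp_add[symmetric])
      finally show ?thesis .
    qed
  qed (rule q)
qed

theorem lemma2p4:
  fixes P :: "real \<Rightarrow> 'a measure"
    and X :: "real \<Rightarrow> 'a \<Rightarrow> real"
    and c \<sigma> q A :: real
    and \<nu> :: "real measure"
    and W g :: "real \<Rightarrow> real"
  assumes "spectrally_negative_levy P X c \<sigma> \<nu>"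
    and "\<forall>z. emeasure \<nu> {z} = 0"
    and "q > 0"
    and "is_scale_function c \<sigma> \<nu> q W"
    and "g \<in> borel_measurable borel"
    and "locally_bounded g"
    and "C2_near g A"
    and "(\<integral>\<^sup>+u\<in>{1..}. (SUP \<zeta>\<in>{A - u..A}. ennreal \<bar>g \<zeta> - g A\<bar>) \<partial>\<nu>) < \<infinity>"
  shows "\<forall>x>A. Gamma2 P X q g x A = W (x - A) * rho c \<sigma> \<nu> q g A - varphi \<nu> W g A x"
proof (intro allI impI)
  fix x assume x: "A < x"
  have \<sigma>: "0 \<le> \<sigma>" and lm: "levy_measure \<nu>"
    and bv: "\<sigma> = 0 \<and> (\<integral>\<^sup>+z\<in>{0<..}. ennreal (min 1 z) \<partial>\<nu>) < \<infinity> \<longrightarrow> c + (LINT z:{0<..<1}|\<nu>. z) > 0"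
    and X0: "AE \<omega> in P x. X 0 \<omega> = x" and lp: "levy_process (P x) X"
    using assms(1) unfolding spectrally_negative_levy_def by blast+
  interpret levy_meas \<nu> by (rule levy_meas.intro[OF lm])
  define Y where "Y t \<omega> = X t \<omega> - X 0 \<omega>" for t \<omega>
  define \<psi> where "\<psi> = laplace_exponent c \<sigma> \<nu>"
  interpret snl "P x" Y \<psi> q
    using snl_of_levy[OF assms(1,3), of x] unfolding Y_def \<psi>_def .
  have \<psi>0: "\<psi> 0 = 0" by (simp add: \<psi>_def laplace_exponent_J J_def theta_def)
  obtain b where "0 \<le> b" "q < \<psi> b" using laplace_exponent_unbounded[OF \<sigma> bv, of q] unfolding \<psi>_def by blast
  then obtain \<Phi> where \<Phi>: "0 < \<Phi>" "\<psi> \<Phi> = q" using psi_root_exists[OF \<psi>0] by blast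
  \<comment> \<open>The supremum defining \<open>Phi\<close> runs over a single root.\<close>
  have "{l. 0 \<le> l \<and> \<psi> l = q} = {\<Phi>}"
    using \<Phi> psi_root_unique[of _ \<Phi>] by (auto intro: less_imp_le)
  then have Phi: "Phi c \<sigma> \<nu> q = \<Phi>" by (simp add: Phi_def \<psi>_def[symmetric])
  interpret snl_X "P x" Y \<psi> q \<Phi> W \<nu> c \<sigma> X x
  proof
    show "0 < \<Phi>" "\<psi> \<Phi> = q" by (rule \<Phi>)+
    show "W z = 0" if "z < 0" for z using assms(4) that unfolding is_scale_function_def by blast
    show "continuous_on {0..} W" "strict_mono_on {0..} W" using assms(4) unfolding is_scale_function_def by blast+
    show "set_integrable lborel {0..} (\<lambda>x. exp (- \<beta> * x) * W x)" "(LINT x:{0..}|lborel. exp (- \<beta> * x) * W x) = 1 / (\<psi> \<beta> - q)"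
      if "\<Phi> < \<beta>" for \<beta>
      using assms(4) that unfolding is_scale_function_def Phi \<psi>_def by blast+
    show "\<psi> \<beta> = c * \<beta> + 1/2 * \<sigma>\<^sup>2 * \<beta>\<^sup>2 + J \<beta>" for \<beta> by (simp add: \<psi>_def laplace_exponent_J)
    show "Y t \<omega> = X t \<omega> - X 0 \<omega>" for t \<omega> by (simp add: Y_def)
    show "AE \<omega> in P x. X 0 \<omega> = x" by (rule X0)
    show "X t \<in> borel_measurable (P x)" if "0 \<le> t" for t using lp that unfolding levy_process_def by blast
  qed
  have "Gamma2 P X q g x A = (\<integral>\<omega>. (if first_passage X A \<omega> < \<infinity> \<and> X (pt A \<omega>) \<omega> < A then exp (- q * pt A \<omega>) * (g (X (pt A \<omega>) \<omega>) - g A) else 0) \<partial>P x)"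
    unfolding Gamma2_def Let_def pt_def ..
  also have "\<dots> = W (x - A) * rho c \<sigma> \<nu> q g A - varphi \<nu> W g A x"
    unfolding rho_def Phi by (rule passage_formula[OF x assms(5-8)])
  finally show "Gamma2 P X q g x A = W (x - A) * rho c \<sigma> \<nu> q g A - varphi \<nu> W g A x" .
qed

end
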